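(* Let $(\mathcal{E},\mathcal{F})$ be a regular Dirichlet form on $L^2(E;m)$ with associated Hunt process $X$ and transition semigroup $P_tf(x)=\mathbb{E}_x[f(X_t)]$. Suppose that $\{P_t\}_{t>0}$ is a Feller semigroup and that $\mu\in\mathcal{S}_{00}$ satisfies $U_1\mu\in C_\infty(E)$. Then $\mu\in\mathcal{K}_{00}$.
   Context: Setting: $E$ is a locally compact separable metric space, $m$ a positive Radon measure on $E$ with full topological support, $(\mathcal{E},\mathcal{F})$ a regular symmetric Dirichlet form on $L^2(E;m)$, $\mathcal{E}_1(f,g)=\mathcal{E}(f,g)+\int_E fg\,dm$, and $X=(X_t,\mathbb{P}_x,\zeta)$ the associated $m$-symmetric Hunt process. $C_c$ is the space of continuous functions with compact support; $C_\infty(E)$ the space of continuous functions vanishing at infinity. A $C_0$-semigroup (strongly continuous semigroup) $\{S_t\}_{t>0}$ on $C_\infty(E)$ has the Feller property (is a Feller semigroup) if $S_t(C_\infty(E))\subset C_\infty(E)$ for each $t>0$ and $\|S_tf\|_\infty\le\|f\|_\infty$ for all $f\in C_\infty(E)$. Capacity: for open $A$, $\mathrm{Cap}(A)=\inf\{\mathcal{E}_1(u,u):u\in\mathcal{F},\,u\ge1\ m\text{-a.e. on }A\}$ ($\inf\emptyset=\infty$), and $\mathrm{Cap}(B)=\inf\{\mathrm{Cap}(A):A\supset B\text{ open}\}$ for general $B$. A compact nest is an increasing sequence $\{F_k\}$ of compact sets with $\mathrm{Cap}(K\setminus F_k)\to0$ for every compact $K$. A positive Borel measure $\mu$ is smooth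 ($\mu\in\mathcal{S}$) if it charges no set of zero capacity and there is a compact nest $\{F_k\}$ with $\mu(F_k)<\infty$ for all $k$. Each $\mu\in\mathcal{S}$ corresponds uniquely (up to equivalence) to a positive continuous additive functional (PCAF) $A^\mu$ via the Revuz correspondence $\mathbb{E}_{hm}[\int_0^\infty e^{-\alpha s}f(X_s)\,dA^\mu_s]=\int_E f\,R_\alpha h\,d\mu$ for all nonnegative Borel $f,h$, where $R_\alpha h(x)=\mathbb{E}_x[\int_0^\infty e^{-\alpha t}h(X_t)dt]$. Put $R_\alpha\mu(x)=\mathbb{E}_x[\int_0^\infty e^{-\alpha t}dA_t^\mu]$, and $\|u\|_{\infty,q}=\inf\{\lambda>0:\mathrm{Cap}(\{|u|\ge\lambda\})=0\}$. $\mathcal{S}_0$: Radon measures $\mu$ for which there is $C>0$ with $\int|f|d\mu\le C\sqrt{\mathcal{E}_1(f,f)}$ for all $f\in\mathcal{F}\cap C_c$; for such $\mu$, $U_1\mu\in\mathcal{F}$ is the element with $\mathcal{E}_1(f,U_1\mu)=\int\tilde f\,d\mu$ for all $f\in\mathcal{F}$ ($\tilde f$ a quasi-continuous version). $\mathcal{S}_{00}$: those $\mu\in\mathcal{S}_0$ with $\mu(E)<\infty$ and $U_1\mu\in L^\infty$. $\mathcal{K}$ (Kato class): $\mu\in\mathcal{S}$ with $\lim_{\alpha\to\infty}\|R_\alpha\mu\|_{\infty,q}=0$. $\mathcal{K}_{00}=\mathcal{K}\cap\mathcal{S}_{00}$. *)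

theory Defs
  imports "HOL-Probability.Probability"
begin

section \<open>Function spaces\<close>

definition C_c :: "('a::topological_space \<Rightarrow> real) set" where
  "C_c = {f. continuous_on UNIV f \<and> compact (closure {x. f x \<noteq> 0})}"

definition C_infty :: "('a::topological_space \<Rightarrow> real) set" where
  "C_infty = {f. continuous_on UNIV f \<and>
     (\<forall>\<epsilon>>0. \<exists>K. compact K \<and> (\<forall>x. x \<notin> K \<longrightarrow> \<bar>f x\<bar> < \<epsilon>))}"

text \<open>Only meaningful for bounded functions; every member of \<open>C_infty\<close> is bounded.\<close>
definition sup_norm :: "('a \<Rightarrow> real) \<Rightarrow> real" where
  "sup_norm f = (SUP x. \<bar>f x\<bar>)"

text \<open>Elements of \<open>L\<^sup>2\<close> are represented by functions; almost everywhere equal functions are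
  identified by requiring everything built on top to respect equality almost everywhere.\<close>
definition L2 :: "'a measure \<Rightarrow> ('a \<Rightarrow> real) set" where
  "L2 m = {f \<in> borel_measurable m. integrable m (\<lambda>x. (f x)\<^sup>2)}"

definition radon_measure :: "'a::topological_space measure \<Rightarrow> bool" where
  "radon_measure \<mu> \<longleftrightarrow> sets \<mu> = sets borel \<and> (\<forall>K. compact K \<longrightarrow> emeasure \<mu> K < \<infinity>)"

definition full_support :: "'a::topological_space measure \<Rightarrow> bool" where
  "full_support \<mu> \<longleftrightarrow> (\<forall>U. open U \<and> U \<noteq> {} \<longrightarrow> emeasure \<mu> U > 0)"


section \<open>Regular symmetric Dirichlet forms\<close>

text \<open>Throughout, \<open>F\<close> is the domain and \<open>E\<close> the form; the values of \<open>E\<close> outside \<open>F \<times> F\<close> are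
  irrelevant.\<close>

type_synonym 'a bilin = "('a \<Rightarrow> real) \<Rightarrow> ('a \<Rightarrow> real) \<Rightarrow> real"

definition E1 :: "'a measure \<Rightarrow> 'a bilin \<Rightarrow> ('a \<Rightarrow> real) \<Rightarrow> ('a \<Rightarrow> real) \<Rightarrow> real"
  where "E1 m E f g = E f g + (\<integral>x. f x * g x \<partial>m)"

definition dirichlet_form ::
    "'a measure \<Rightarrow> ('a \<Rightarrow> real) set \<Rightarrow> 'a bilin \<Rightarrow> bool" where
  "dirichlet_form m F E \<longleftrightarrow>
     \<comment> \<open>a linear subspace of \<open>L\<^sup>2\<close>, on which the form depends only on almost everywhere classes\<close>
     F \<subseteq> L2 m \<and> (\<lambda>_. 0) \<in> F \<and>
     (\<forall>f\<in>F. \<forall>g\<in>F. \<forall>a b. (\<lambda>x. a * f x + b * g x) \<in> F) \<and>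
     (\<forall>f\<in>F. \<forall>g\<in>borel_measurable m. (AE x in m. f x = g x) \<longrightarrow>
        g \<in> F \<and> (\<forall>h\<in>F. E f h = E g h)) \<and>
     \<comment> \<open>densely defined\<close>
     (\<forall>f\<in>L2 m. \<forall>\<epsilon>>0. \<exists>g\<in>F. (\<integral>x. (f x - g x)\<^sup>2 \<partial>m) < \<epsilon>) \<and>
     \<comment> \<open>symmetric, bilinear, nonnegative\<close>
     (\<forall>f\<in>F. \<forall>g\<in>F. E f g = E g f) \<and>
     (\<forall>f\<in>F. \<forall>g\<in>F. \<forall>h\<in>F. \<forall>a b. E (\<lambda>x. a * f x + b * g x) h = a * E f h + b * E g h) \<and>
     (\<forall>f\<in>F. E f f \<ge> 0) \<and>
     \<comment> \<open>closed\<close>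
     (\<forall>u. (\<forall>n. u n \<in> F) \<and>
          (\<forall>\<epsilon>>0. \<exists>N. \<forall>i\<ge>N. \<forall>j\<ge>N.
             E1 m E (\<lambda>x. u i x - u j x) (\<lambda>x. u i x - u j x) < \<epsilon>) \<longrightarrow>
          (\<exists>v\<in>F. (\<lambda>n::nat. E1 m E (\<lambda>x. u n x - v x) (\<lambda>x. u n x - v x)) \<longlonglongrightarrow> 0)) \<and>
     \<comment> \<open>Markovian: the unit contraction operates\<close>
     (\<forall>f\<in>F. (\<lambda>x. min (max (f x) 0) 1) \<in> F \<and>
        E (\<lambda>x. min (max (f x) 0) 1) (\<lambda>x. min (max (f x) 0) 1) \<le> E f f)"

definition regular_form ::
    "'a::topological_space measure \<Rightarrow> ('a \<Rightarrow> real) set \<Rightarrow> 'a bilin \<Rightarrow> bool" where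
  "regular_form m F E \<longleftrightarrow>
     (\<forall>f\<in>F. \<forall>\<epsilon>>0. \<exists>g\<in>F \<inter> C_c. E1 m E (\<lambda>x. f x - g x) (\<lambda>x. f x - g x) < \<epsilon>) \<and>
     (\<forall>f\<in>C_c. \<forall>\<epsilon>>0. \<exists>g\<in>F \<inter> C_c. \<forall>x. \<bar>f x - g x\<bar> < \<epsilon>)"

definition cap_open ::
    "'a measure \<Rightarrow> ('a \<Rightarrow> real) set \<Rightarrow> 'a bilin \<Rightarrow> 'a set \<Rightarrow> ennreal" where
  "cap_open m F E A = (INF u \<in> {u \<in> F. AE x in m. x \<in> A \<longrightarrow> u x \<ge> 1}. ennreal (E1 m E u u))"

text \<open>For open sets this agrees with \<open>cap_open\<close>, which is monotone.\<close>
definition cap ::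
    "'a::topological_space measure \<Rightarrow> ('a \<Rightarrow> real) set \<Rightarrow> 'a bilin \<Rightarrow> 'a set \<Rightarrow> ennreal" where
  "cap m F E B = (INF A \<in> {A. open A \<and> B \<subseteq> A}. cap_open m F E A)"

definition quasi_continuous ::
    "'a::topological_space measure \<Rightarrow> ('a \<Rightarrow> real) set \<Rightarrow> 'a bilin \<Rightarrow> ('a \<Rightarrow> real) \<Rightarrow> bool" where
  "quasi_continuous m F E f \<longleftrightarrow>
     (\<forall>\<epsilon>::real. \<epsilon> > 0 \<longrightarrow> (\<exists>G. open G \<and> cap m F E G < ennreal \<epsilon> \<and> continuous_on (- G) f))"

text \<open>The seminorm \<open>\<parallel>u\<parallel>\<close> with respect to capacity, for \<open>[0,\<infinity>]\<close>-valued \<open>u\<close>.\<close>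
definition qnorm ::
    "'a::topological_space measure \<Rightarrow> ('a \<Rightarrow> real) set \<Rightarrow> 'a bilin \<Rightarrow> ('a \<Rightarrow> ennreal) \<Rightarrow> ennreal" where
  "qnorm m F E u = (INF r \<in> {r::real. r > 0 \<and> cap m F E {x. u x \<ge> ennreal r} = 0}. ennreal r)"


section \<open>Smooth measures and measures of finite energy integral\<close>

definition compact_nest ::
    "'a::topological_space measure \<Rightarrow> ('a \<Rightarrow> real) set \<Rightarrow> 'a bilin \<Rightarrow> (nat \<Rightarrow> 'a set) \<Rightarrow> bool" where
  "compact_nest m F E K \<longleftrightarrow> incseq K \<and> (\<forall>k. compact (K k)) \<and>
     (\<forall>C. compact C \<longrightarrow> (\<lambda>k. cap m F E (C - K k)) \<longlonglongrightarrow> 0)"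

definition smooth_measures ::
    "'a::topological_space measure \<Rightarrow> ('a \<Rightarrow> real) set \<Rightarrow> 'a bilin \<Rightarrow> 'a measure set" where
  "smooth_measures m F E = {\<mu>. sets \<mu> = sets borel \<and>
     (\<forall>B\<in>sets borel. cap m F E B = 0 \<longrightarrow> emeasure \<mu> B = 0) \<and>
     (\<exists>K. compact_nest m F E K \<and> (\<forall>k. emeasure \<mu> (K k) < \<infinity>))}"

definition S0 ::
    "'a::topological_space measure \<Rightarrow> ('a \<Rightarrow> real) set \<Rightarrow> 'a bilin \<Rightarrow> 'a measure set" where
  "S0 m F E = {\<mu>. radon_measure \<mu> \<and>
     (\<exists>C>0. \<forall>f\<in>F \<inter> C_c. (\<integral>\<^sup>+x. ennreal \<bar>f x\<bar> \<partial>\<mu>) \<le> ennreal (C * sqrt (E1 m E f f)))}"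

text \<open>\<open>is_U1 m F E \<mu> u\<close>: the function \<open>u\<close> represents the 1-potential \<open>U\<^sub>1\<mu>\<close>, an element of \<open>F\<close> which
  is unique up to equality almost everywhere.\<close>
definition is_U1 ::
    "'a::topological_space measure \<Rightarrow> ('a \<Rightarrow> real) set \<Rightarrow> 'a bilin \<Rightarrow> 'a measure \<Rightarrow> ('a \<Rightarrow> real) \<Rightarrow> bool" where
  "is_U1 m F E \<mu> u \<longleftrightarrow> u \<in> F \<and>
     (\<forall>f\<in>F. \<forall>f'\<in>borel_measurable borel. quasi_continuous m F E f' \<and> (AE x in m. f' x = f x) \<longrightarrow>
        integrable \<mu> f' \<and> E1 m E f u = (\<integral>x. f' x \<partial>\<mu>))"

definition S00 ::
    "'a::topological_space measure \<Rightarrow> ('a \<Rightarrow> real) set \<Rightarrow> 'a bilin \<Rightarrow> 'a measure set" where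
  "S00 m F E = {\<mu> \<in> S0 m F E. emeasure \<mu> UNIV < \<infinity> \<and>
     (\<exists>u. is_U1 m F E \<mu> u \<and> (\<exists>c. AE x in m. \<bar>u x\<bar> \<le> c))}"


section \<open>Hunt processes\<close>

text \<open>The cemetery is \<open>None\<close>, adjoined as the point at infinity (an isolated point if the state
  space is compact). Time runs through \<open>[0,\<infinity>]\<close>, represented by \<^typ>\<open>ennreal\<close>.\<close>

type_synonym ('w, 'a) coords = "ennreal \<Rightarrow> 'w \<Rightarrow> 'a option"

definition top_pt :: "'a::topological_space option topology" where
  "top_pt = Alexandroff_compactification euclidean"

definition borel_pt :: "'a::topological_space option measure" where
  "borel_pt = sigma UNIV {U. openin top_pt U}"

definition ext0 :: "('a \<Rightarrow> 'b::zero) \<Rightarrow> 'a option \<Rightarrow> 'b" where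
  "ext0 f = case_option 0 f"

definition lifetime :: "('w, 'a) coords \<Rightarrow> 'w \<Rightarrow> ennreal" where
  "lifetime X \<omega> = Inf {t. X t \<omega> = None}"

definition natural_filt :: "('w, 'a::topological_space) coords \<Rightarrow> ennreal \<Rightarrow> 'w measure" where
  "natural_filt X t = sigma UNIV {X s -` B | s B. s \<le> t \<and> B \<in> sets borel_pt}"

text \<open>The minimum augmented admissible filtration: a set belongs to it at time \<open>t\<close> iff for every
  initial law \<open>\<nu>\<close> it differs from a member of the natural filtration by a null set of \<open>P\<^sub>\<nu>\<close>,
  which is \<open>\<nu> \<bind> P\<close>.\<close>
definition aug_filt ::
    "('w, 'a::topological_space) coords \<Rightarrow> ('a option \<Rightarrow> 'w measure) \<Rightarrow> ennreal \<Rightarrow> 'w measure" where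
  "aug_filt X P t = sigma UNIV {\<Lambda>. \<forall>\<nu>\<in>space (prob_algebra borel_pt). \<exists>\<Lambda>'\<in>sets (natural_filt X t).
     (\<Lambda> - \<Lambda>') \<union> (\<Lambda>' - \<Lambda>) \<in> null_sets (completion (\<nu> \<bind> P))}"

definition hunt_process ::
    "('w, 'a::topological_space) coords \<Rightarrow> (ennreal \<Rightarrow> 'w \<Rightarrow> 'w) \<Rightarrow> ('a option \<Rightarrow> 'w measure) \<Rightarrow> bool" where
  "hunt_process X \<theta> P \<longleftrightarrow>
     \<comment> \<open>a measurable family of laws, normal, with \<open>None\<close> a trap\<close>
     P \<in> borel_pt \<rightarrow>\<^sub>M prob_algebra (natural_filt X \<infinity>) \<and>
     (\<forall>x. AE \<omega> in P x. X 0 \<omega> = x) \<and>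
     (\<forall>t. AE \<omega> in P None. X t \<omega> = None) \<and>
     (\<forall>\<omega>. X \<infinity> \<omega> = None) \<and>
     (\<forall>\<omega> t. lifetime X \<omega> \<le> t \<longrightarrow> X t \<omega> = None) \<and>
     \<comment> \<open>shifts\<close>
     (\<forall>s t \<omega>. X s (\<theta> t \<omega>) = X (s + t) \<omega>) \<and>
     \<comment> \<open>paths are right continuous with left limits in the one-point compactification\<close>
     (\<forall>\<omega> t. t < \<infinity> \<longrightarrow> limitin top_pt (\<lambda>s. X s \<omega>) (X t \<omega>) (at_right t)) \<and>
     (\<forall>\<omega> t. 0 < t \<and> t < \<infinity> \<longrightarrow> (\<exists>y. limitin top_pt (\<lambda>s. X s \<omega>) y (at_left t))) \<and>
     \<comment> \<open>right continuous filtration\<close>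
     (\<forall>t<\<infinity>. (\<Inter>s\<in>{t<..}. sets (aug_filt X P s)) = sets (aug_filt X P t)) \<and>
     \<comment> \<open>strong Markov property: \<open>P\<^sub>\<nu>(X\<^bsub>\<sigma>+s\<^esub> \<in> B | F\<^sub>\<sigma>) = P\<^bsub>X\<^sub>\<sigma>\<^esub>(X\<^sub>s \<in> B)\<close>\<close>
     (\<forall>\<nu>\<in>space (prob_algebra borel_pt). \<forall>\<sigma>. stopping_time (aug_filt X P) \<sigma> \<longrightarrow>
        (\<forall>s. \<forall>B\<in>sets borel_pt. \<forall>\<Lambda>\<in>sets (filtration.pre_sigma UNIV (aug_filt X P) \<sigma>).
           emeasure (completion (\<nu> \<bind> P)) {\<omega>\<in>\<Lambda>. X (\<sigma> \<omega> + s) \<omega> \<in> B} =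
           (\<integral>\<^sup>+\<omega>\<in>\<Lambda>. emeasure (P (X (\<sigma> \<omega>) \<omega>)) {\<omega>'. X s \<omega>' \<in> B} \<partial>completion (\<nu> \<bind> P)))) \<and>
     \<comment> \<open>quasi-left continuity\<close>
     (\<forall>\<nu>\<in>space (prob_algebra borel_pt). \<forall>\<sigma>.
        (\<forall>n. stopping_time (aug_filt X P) (\<sigma> n)) \<and> (\<forall>\<omega>. incseq (\<lambda>n. \<sigma> n \<omega>)) \<longrightarrow>
        (AE \<omega> in completion (\<nu> \<bind> P). (SUP n. \<sigma> n \<omega>) < \<infinity> \<longrightarrow>
           limitin top_pt (\<lambda>n::nat. X (\<sigma> n \<omega>) \<omega>) (X (SUP n. \<sigma> n \<omega>) \<omega>) sequentially))"

text \<open>Transition semigroup \<open>P\<^sub>tf(x) = E\<^sub>x[f(X\<^sub>t)]\<close> with \<open>f(\<partial>) = 0\<close>, for real-valued and for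
  \<open>[0,\<infinity>]\<close>-valued functions respectively.\<close>
definition trans_op ::
    "('w, 'a) coords \<Rightarrow> ('a option \<Rightarrow> 'w measure) \<Rightarrow> real \<Rightarrow> ('a \<Rightarrow> real) \<Rightarrow> 'a \<Rightarrow> real" where
  "trans_op X P t f x = (\<integral>\<omega>. ext0 f (X (ennreal t) \<omega>) \<partial>P (Some x))"

definition nn_trans ::
    "('w, 'a) coords \<Rightarrow> ('a option \<Rightarrow> 'w measure) \<Rightarrow> real \<Rightarrow> ('a \<Rightarrow> ennreal) \<Rightarrow> 'a \<Rightarrow> ennreal" where
  "nn_trans X P t f x = (\<integral>\<^sup>+\<omega>. ext0 f (X (ennreal t) \<omega>) \<partial>P (Some x))"

definition resolvent ::
    "('w, 'a) coords \<Rightarrow> ('a option \<Rightarrow> 'w measure) \<Rightarrow> real \<Rightarrow> ('a \<Rightarrow> ennreal) \<Rightarrow> 'a \<Rightarrow> ennreal" where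
  "resolvent X P \<alpha> h x =
     (\<integral>\<^sup>+\<omega>. (\<integral>\<^sup>+t\<in>{0..}. ennreal (exp (- \<alpha> * t)) * ext0 h (X (ennreal t) \<omega>) \<partial>lborel) \<partial>P (Some x))"

definition m_symmetric ::
    "'a::topological_space measure \<Rightarrow> ('w, 'a) coords \<Rightarrow> ('a option \<Rightarrow> 'w measure) \<Rightarrow> bool" where
  "m_symmetric m X P \<longleftrightarrow> (\<forall>t>0. \<forall>f\<in>borel_measurable borel. \<forall>g\<in>borel_measurable borel.
     (\<integral>\<^sup>+x. f x * nn_trans X P t g x \<partial>m) = (\<integral>\<^sup>+x. nn_trans X P t f x * g x \<partial>m))"

text \<open>The process is associated with the form: \<open>(E, F)\<close> is the Dirichlet form of the semigroup on
  \<open>L\<^sup>2\<close> induced by the transition function, that is, the limit as \<open>t \<down> 0\<close> of the approximating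
  forms \<open>t\<^sup>-\<^sup>1 \<langle>f - P\<^sub>tf, g\<rangle>\<close>, with domain the functions for which the limit on the diagonal is
  finite.\<close>
definition associated ::
    "'a measure \<Rightarrow> ('a \<Rightarrow> real) set \<Rightarrow> 'a bilin \<Rightarrow>
     ('w, 'a) coords \<Rightarrow> ('a option \<Rightarrow> 'w measure) \<Rightarrow> bool" where
  "associated m F E X P \<longleftrightarrow>
     F = {f \<in> L2 m. \<exists>l. ((\<lambda>t. (1 / t) * (\<integral>x. (f x - trans_op X P t f x) * f x \<partial>m)) \<longlongrightarrow> l) (at_right 0)} \<and>
     (\<forall>f\<in>F. \<forall>g\<in>F.
        ((\<lambda>t. (1 / t) * (\<integral>x. (f x - trans_op X P t f x) * g x \<partial>m)) \<longlongrightarrow> E f g) (at_right 0))"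

definition feller_semigroup :: "(real \<Rightarrow> ('a::topological_space \<Rightarrow> real) \<Rightarrow> 'a \<Rightarrow> real) \<Rightarrow> bool" where
  "feller_semigroup S \<longleftrightarrow>
     (\<forall>t>0. \<forall>f\<in>C_infty. S t f \<in> C_infty) \<and>
     (\<forall>t>0. \<forall>f\<in>C_infty. \<forall>g\<in>C_infty. \<forall>a b. S t (\<lambda>x. a * f x + b * g x) = (\<lambda>x. a * S t f x + b * S t g x)) \<and>
     (\<forall>s>0. \<forall>t>0. \<forall>f\<in>C_infty. S (s + t) f = S s (S t f)) \<and>
     (\<forall>t>0. \<forall>f\<in>C_infty. sup_norm (S t f) \<le> sup_norm f) \<and>
     (\<forall>f\<in>C_infty. ((\<lambda>t. sup_norm (\<lambda>x. S t f x - f x)) \<longlongrightarrow> 0) (at_right 0))"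


section \<open>Positive continuous additive functionals and the Kato class\<close>

text \<open>\<open>\<Lambda>\<close> is a defining set and \<open>N\<close> an exceptional set. The values at time \<open>\<infinity>\<close> play no role.
  Monotonicity in time follows from additivity.\<close>
definition pcaf ::
    "'a::topological_space measure \<Rightarrow> ('a \<Rightarrow> real) set \<Rightarrow> 'a bilin \<Rightarrow>
     ('w, 'a) coords \<Rightarrow> (ennreal \<Rightarrow> 'w \<Rightarrow> 'w) \<Rightarrow> ('a option \<Rightarrow> 'w measure) \<Rightarrow>
     (ennreal \<Rightarrow> 'w \<Rightarrow> ennreal) \<Rightarrow> bool" where
  "pcaf m F E X \<theta> P A \<longleftrightarrow>
     (\<forall>t<\<infinity>. A t \<in> borel_measurable (aug_filt X P t)) \<and>
     (\<exists>\<Lambda>\<in>sets (aug_filt X P \<infinity>). \<exists>N. cap m F E N = 0 \<and>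
        (\<forall>x. x \<notin> N \<longrightarrow> (AE \<omega> in P (Some x). \<omega> \<in> \<Lambda>)) \<and>
        (\<forall>t. 0 < t \<and> t < \<infinity> \<longrightarrow> \<theta> t ` \<Lambda> \<subseteq> \<Lambda>) \<and>
        (\<forall>\<omega>\<in>\<Lambda>.
           continuous_on {..<\<infinity>} (\<lambda>t. A t \<omega>) \<and>
           A 0 \<omega> = 0 \<and>
           (\<forall>t. t < lifetime X \<omega> \<longrightarrow> A t \<omega> < \<infinity>) \<and>
           (\<forall>t. lifetime X \<omega> \<le> t \<and> t < \<infinity> \<longrightarrow> A t \<omega> = A (lifetime X \<omega>) \<omega>) \<and>
           (\<forall>s t. s < \<infinity> \<and> t < \<infinity> \<longrightarrow> A (s + t) \<omega> = A s \<omega> + A t (\<theta> s \<omega>))))"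

text \<open>\<open>\<integral>\<^sub>0\<^sup>\<infinity> g(t) dA\<^sub>t(\<omega>)\<close>. As \<open>A\<close> is finite before the lifetime and constant from then on, this is
  the supremum over \<open>s < \<zeta>(\<omega>)\<close> of the integrals over \<open>(0,s]\<close>, i.e. the integrals with respect to
  the Stieltjes measure of the finite function \<open>t \<mapsto> A\<^bsub>t \<and> s\<^esub>\<close>, extended by \<open>0 = A\<^sub>0\<close> to negative
  times (\<^term>\<open>ennreal t\<close> is \<open>0\<close> for negative \<open>t\<close>).\<close>
definition af_integral ::
    "('w, 'a) coords \<Rightarrow> (ennreal \<Rightarrow> 'w \<Rightarrow> ennreal) \<Rightarrow> (real \<Rightarrow> ennreal) \<Rightarrow> 'w \<Rightarrow> ennreal" where
  "af_integral X A g \<omega> =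
     (SUP s \<in> {s. 0 \<le> s \<and> ennreal s < lifetime X \<omega>}.
        \<integral>\<^sup>+t. g t \<partial>interval_measure (\<lambda>t. enn2real (A (ennreal (min t s)) \<omega>)))"

text \<open>The Revuz correspondence. Functionals of the path are measurable only for the augmented
  filtration, and their expectations are universally measurable in the starting point; hence the
  completions.\<close>
definition revuz ::
    "'a::topological_space measure \<Rightarrow> ('w, 'a) coords \<Rightarrow> ('a option \<Rightarrow> 'w measure) \<Rightarrow>
     (ennreal \<Rightarrow> 'w \<Rightarrow> ennreal) \<Rightarrow> 'a measure \<Rightarrow> bool" where
  "revuz m X P A \<mu> \<longleftrightarrow>
     (\<forall>\<alpha>>0. \<forall>f\<in>borel_measurable borel. \<forall>h\<in>borel_measurable borel.
        (\<integral>\<^sup>+x. h x *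
           (\<integral>\<^sup>+\<omega>. af_integral X A (\<lambda>s. ennreal (exp (- \<alpha> * s)) * ext0 f (X (ennreal s) \<omega>)) \<omega>
              \<partial>completion (P (Some x))) \<partial>completion m)
        = (\<integral>\<^sup>+x. f x * resolvent X P \<alpha> h x \<partial>\<mu>))"

definition af_potential ::
    "('w, 'a) coords \<Rightarrow> ('a option \<Rightarrow> 'w measure) \<Rightarrow> (ennreal \<Rightarrow> 'w \<Rightarrow> ennreal) \<Rightarrow> real \<Rightarrow> 'a \<Rightarrow> ennreal" where
  "af_potential X P A \<alpha> x =
     (\<integral>\<^sup>+\<omega>. af_integral X A (\<lambda>t. ennreal (exp (- \<alpha> * t))) \<omega> \<partial>completion (P (Some x)))"

text \<open>A realisation \<open>\<mu> \<mapsto> A\<^sup>\<mu>\<close> of the Revuz correspondence: a choice, for each smooth measure, of a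
  representative from the equivalence class of PCAFs with that Revuz measure.\<close>
definition revuz_correspondence ::
    "'a::topological_space measure \<Rightarrow> ('a \<Rightarrow> real) set \<Rightarrow> 'a bilin \<Rightarrow>
     ('w, 'a) coords \<Rightarrow> (ennreal \<Rightarrow> 'w \<Rightarrow> 'w) \<Rightarrow> ('a option \<Rightarrow> 'w measure) \<Rightarrow>
     ('a measure \<Rightarrow> ennreal \<Rightarrow> 'w \<Rightarrow> ennreal) \<Rightarrow> bool" where
  "revuz_correspondence m F E X \<theta> P A \<longleftrightarrow>
     (\<forall>\<mu>\<in>smooth_measures m F E. pcaf m F E X \<theta> P (A \<mu>) \<and> revuz m X P (A \<mu>) \<mu>)"

definition kato_class ::
    "'a::topological_space measure \<Rightarrow> ('a \<Rightarrow> real) set \<Rightarrow> 'a bilin \<Rightarrow>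
     ('w, 'a) coords \<Rightarrow> ('a option \<Rightarrow> 'w measure) \<Rightarrow>
     ('a measure \<Rightarrow> ennreal \<Rightarrow> 'w \<Rightarrow> ennreal) \<Rightarrow> 'a measure set" where
  "kato_class m F E X P A = {\<mu> \<in> smooth_measures m F E.
     ((\<lambda>\<alpha>. qnorm m F E (af_potential X P (A \<mu>) \<alpha>)) \<longlongrightarrow> 0) at_top}"

definition K00 ::
    "'a::topological_space measure \<Rightarrow> ('a \<Rightarrow> real) set \<Rightarrow> 'a bilin \<Rightarrow>
     ('w, 'a) coords \<Rightarrow> ('a option \<Rightarrow> 'w measure) \<Rightarrow>
     ('a measure \<Rightarrow> ennreal \<Rightarrow> 'w \<Rightarrow> ennreal) \<Rightarrow> 'a measure set" where
  "K00 m F E X P A = kato_class m F E X P A \<inter> S00 m F E"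

end

theory Submission
  imports Defs
begin

text \<open>Write \<open>u\<close> for the version of \<open>U\<^sub>1\<mu>\<close> in \<open>C\<^sub>\<infinity>\<close>, \<open>P\<^sub>t\<close> for the transition semigroup and \<open>R\<^sub>\<alpha>\<close> for its
resolvent. Formally \<open>U\<^sub>\<alpha>\<mu> = u - (\<alpha> - 1) R\<^sub>\<alpha>u\<close>, and this tends to \<open>0\<close> uniformly as \<open>\<alpha> \<rightarrow> \<infinity>\<close>, because
\<open>\<alpha> R\<^sub>\<alpha>u\<close> is an average of \<open>P\<^sub>tu\<close> over times \<open>t\<close> of order \<open>1/\<alpha>\<close> and \<open>P\<^sub>tu \<rightarrow> u\<close> uniformly by the Feller
property. What has to be shown is that the probabilistic potential \<open>R\<^sub>\<alpha>\<mu>\<close> of the additive functional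
obeys the same bound outside a set of zero capacity, not merely almost everywhere.

The form enters through resolvents of nonnegative integrable \<open>h \<in> C\<^sub>\<infinity>\<close>. Such an \<open>R\<^sub>\<alpha>h\<close> is a
continuous element of \<open>F\<close> with \<open>\<E>\<^sub>1(R\<^sub>\<alpha>h, g) = \<langle>h, g\<rangle> - (\<alpha> - 1)\<langle>R\<^sub>\<alpha>h, g\<rangle>\<close> for bounded \<open>g \<in> F\<close>
(\<open>R_in_F\<close>, \<open>E1_R\<close>); it is its own quasi-continuous version, so the defining property of \<open>U\<^sub>1\<mu>\<close>
computes \<open>\<integral> R\<^sub>\<alpha>h d\<mu>\<close>, and the Feller property gives \<open>\<integral> R\<^sub>\<alpha>h d\<mu> \<le> \<epsilon> \<integral> h dm\<close> for all large \<open>\<alpha>\<close>,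
uniformly in \<open>h\<close> (\<open>integral_R_\<mu>_small\<close>). By the Revuz correspondence the left-hand side is
\<open>\<integral> h R\<^sub>\<alpha>\<mu> dm\<close>. Hence \<open>R\<^sub>\<alpha>\<mu> \<le> 2\<epsilon>\<close> outside an \<open>m\<close>-null set \<open>B\<close> (\<open>Zpot_AE_le\<close>).

To pass from almost everywhere to quasi-everywhere, let the process run for a short time. If
\<open>P\<^sub>x(X\<^sub>t \<in> B) = 0\<close>, the Markov property bounds by \<open>2\<epsilon>\<close> the expectation under \<open>P\<^sub>x\<close> of the functional
shifted by \<open>t\<close> (\<open>shifted_expectation_le\<close>), and letting \<open>t \<down> 0\<close> along such times Fatou's lemma gives
\<open>R\<^sub>\<alpha>\<mu>(x) \<le> 2\<epsilon>\<close> (\<open>Zpot_le\<close>). That almost all times qualify for quasi-every \<open>x\<close> is where the Feller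
property spares the general theory of quasi-continuous versions: choose \<open>H = sup\<^sub>k H\<^sub>k\<close>, an increasing
limit of functions in \<open>C\<^sub>c\<close>, bounded in \<open>L\<^sup>2\<close> and infinite on \<open>B\<close>. The functions \<open>R\<^sub>1H\<^sub>k\<close> are continuous
and converge in energy, so the open sets \<open>{sup\<^sub>k R\<^sub>1H\<^sub>k > c}\<close> have capacity at most a constant times
\<open>c\<^sup>-\<^sup>2\<close>; and where \<open>R\<^sub>1H\<close> is finite, \<open>X\<^sub>t\<close> misses \<open>B\<close> for almost every \<open>t\<close> (\<open>null_set_not_hit\<close>).

It remains that \<open>\<mu>\<close> is smooth. Here \<open>u\<close> is \<open>1\<close>-excessive, and differentiating \<open>e\<^sup>-\<^sup>tP\<^sub>tu \<le> u\<close> at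
\<open>t = 0\<close> against \<open>v \<in> F\<close> yields \<open>\<integral> h d\<mu> \<le> \<E>\<^sub>1(v, u)\<close> whenever \<open>h \<in> C\<^sub>c\<close> lies between \<open>0\<close> and \<open>v\<close>
(\<open>integral_le_energy\<close>); by the Cauchy--Schwarz inequality \<open>\<mu>(A)\<^sup>2\<close> is at most a constant times the
capacity of \<open>A\<close> for open \<open>A\<close>.\<close>

section \<open>Cut-off functions and regularity of Radon measures\<close>

lemma locally_compact_exhaustion:
  assumes "locally compact (UNIV :: 'a::{metric_space, second_countable_topology} set)"
  obtains W K :: "nat \<Rightarrow> 'a::{metric_space, second_countable_topology} set" where
    "\<And>n. open (W n)" "incseq W" "\<And>n. compact (K n)" "incseq K" "\<And>n. W n \<subseteq> K n" "(\<Union>n. W n) = UNIV"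
proof -
  let ?F = "{u::'a set. open u \<and> (\<exists>v. compact v \<and> u \<subseteq> v)}"
  have "\<exists>u\<in>?F. x \<in> u" for x
  proof -
    have "openin (top_of_set UNIV) (UNIV::'a set)" by simp
    then obtain u v where "openin (top_of_set UNIV) u" "compact v" "x \<in> u" "u \<subseteq> v"
      using assms unfolding locally_def by (metis UNIV_I)
    then show ?thesis by auto
  qed
  then have cov: "\<Union>?F = UNIV" by blast
  obtain G where G: "G \<subseteq> ?F" "countable G" "\<Union>G = \<Union>?F"
    using Lindelof[of ?F] by blast
  have "G \<noteq> {}" using G cov by auto
  then obtain e :: "nat \<Rightarrow> 'a set" where e: "range e = G"
    using G(2) by (metis range_from_nat_into)
  have "\<exists>v. compact v \<and> e n \<subseteq> v" for n using e G(1) by blast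
  then obtain c where c: "\<And>n. compact (c n)" "\<And>n. e n \<subseteq> c n" by metis
  have oe: "open (e n)" for n using e G(1) by blast
  show ?thesis
  proof
    show "open (\<Union>i\<le>n. e i)" for n using oe by auto
    show "compact (\<Union>i\<le>n. c i)" for n using c by auto
    show "(\<Union>i\<le>n. e i) \<subseteq> (\<Union>i\<le>n. c i)" for n using c by blast
    have "(\<Union>n. \<Union>i\<le>n. e i) = \<Union>(range e)" by blast
    then show "(\<Union>n. \<Union>i\<le>n. e i) = UNIV" using e G cov by simp
    show "incseq (\<lambda>n. \<Union>i\<le>n. e i)" "incseq (\<lambda>n. \<Union>i\<le>n. c i)"
      unfolding incseq_def by (intro allI impI UN_mono; simp)+
  qed
qed

lemma compact_subset_incseq:
  fixes W :: "nat \<Rightarrow> 'a::topological_space set"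
  assumes "compact C" "\<And>n. open (W n)" "incseq W" "C \<subseteq> (\<Union>n. W n)"
  shows "\<exists>n. C \<subseteq> W n"
proof -
  obtain D where D: "finite D" "C \<subseteq> (\<Union>n\<in>D. W n)"
    using compactE_image[OF assms(1), of UNIV W] assms by metis
  obtain N where N: "\<And>n. n \<in> D \<Longrightarrow> n \<le> N" using D(1) by (meson finite_nat_set_iff_bounded_le)
  have "(\<Union>n\<in>D. W n) \<subseteq> W N" using N assms(3) unfolding incseq_def by (intro UN_least) blast
  with D show ?thesis by blast
qed

text \<open>The truncated distance to the complement, scaled by \<open>n\<close>; the case distinction covers the
  empty complement, whose distance function is \<open>0\<close> by convention.\<close>

definition hat :: "'a::metric_space set \<Rightarrow> nat \<Rightarrow> 'a \<Rightarrow> real" where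
  "hat S n x = (if S = UNIV then min 1 (real n) else min 1 (real n * infdist x (- S)))"

lemma hat_bounds: "0 \<le> hat S n x" "hat S n x \<le> 1"
  by (auto simp: hat_def infdist_nonneg)

lemma hat_eq_0: "x \<notin> S \<Longrightarrow> hat S n x = 0"
  by (auto simp: hat_def)

lemma continuous_hat: "continuous_on A (hat S n)"
  by (cases "S = UNIV") (auto simp: hat_def[abs_def] intro!: continuous_intros)

lemma hat_mono:
  assumes "S \<subseteq> T" "n \<le> k"
  shows "hat S n x \<le> hat T k x"
proof (cases "T = UNIV")
  case True
  show ?thesis
  proof (cases "k = 0")
    case True then show ?thesis using assms by (auto simp: hat_def)
  next
    case False then have "hat T k x = 1" using \<open>T = UNIV\<close> by (auto simp: hat_def)
    then show ?thesis using hat_bounds by metis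
  qed
next
  case False
  then have "S \<noteq> UNIV" using assms by auto
  have "infdist x (- S) \<le> infdist x (- T)"
    using False assms by (intro infdist_mono) auto
  then have "real n * infdist x (- S) \<le> real k * infdist x (- T)"
    using assms by (intro mult_mono) (auto simp: infdist_nonneg)
  then show ?thesis using False \<open>S \<noteq> UNIV\<close> by (auto simp: hat_def)
qed

lemma hat_eventually_1:
  assumes "\<And>n. open (S n)" "incseq S" "x \<in> (\<Union>n. S n)"
  shows "\<exists>n. hat (S n) n x = 1"
proof -
  obtain k where k: "x \<in> S k" using assms by auto
  show ?thesis
  proof (cases "S k = UNIV")
    case True
    then have "S (Suc k) = UNIV" using assms(2) by (metis incseq_SucD top.extremum_unique)
    then show ?thesis by (intro exI[of _ "Suc k"]) (auto simp: hat_def)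
  next
    case False
    define d where "d = infdist x (- S k)"
    have d: "d > 0" using False k assms(1)[of k] unfolding d_def
      by (metis ComplD ComplI Compl_UNIV_eq closed_Compl double_complement in_closed_iff_infdist_zero infdist_pos_not_in_closed)
    obtain N where N: "1 / d \<le> real N" using real_arch_simple by blast
    define n where "n = max k N"
    have le: "hat (S k) n x \<le> hat (S n) n x" using assms(2) by (intro hat_mono) (auto simp: n_def incseq_def)
    have "1 \<le> real n * d"
      using N d by (auto simp: n_def field_simps max_def intro: order_trans)
    then have "hat (S k) n x = 1" using False by (auto simp: hat_def d_def)
    then show ?thesis using le hat_bounds(2)[of "S n" n x] by (intro exI[of _ n]) linarith
  qed
qed

text \<open>The space need not be complete, so the inner approximation is by closed instead of compact
  sets. A closed set is the intersection of its open \<open>1/n\<close>-neighbourhoods, and the property passes to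
  complements and countable unions.\<close>

lemma finite_measure_open_closed_approx:
  fixes M :: "'a::metric_space measure"
  assumes M: "sets M = sets borel" and fin: "finite_measure M" and B: "B \<in> sets borel" and e: "(e::real) > 0"
  shows "\<exists>C U. closed C \<and> open U \<and> C \<subseteq> B \<and> B \<subseteq> U \<and> measure M (U - C) < e"
proof -
  interpret finite_measure M by fact
  note [measurable_cong] = M
  have sp: "space M = UNIV" using sets_eq_imp_space_eq[OF M] by simp
  have "B \<in> sigma_sets UNIV (Collect closed)" using B by (simp add: borel_eq_closed)
  then show ?thesis using e
  proof (induction arbitrary: e rule: sigma_sets.induct)
    case (Basic B)
    show ?case
    proof (cases "B = {}")
      case True then show ?thesis using Basic by (intro exI[of _ "{}"]) auto
    next
      case False
      define U where "U n = {x. infdist x B < 1 / real (Suc n)}" for n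
      have op: "open (U n)" for n unfolding U_def by (intro open_Collect_less continuous_intros)
      have dec: "decseq (\<lambda>n. U n - B)"
      proof (rule decseq_SucI, intro Diff_mono order_refl subsetI)
        fix n x assume "x \<in> U (Suc n)"
        moreover have "1 / real (Suc (Suc n)) \<le> 1 / real (Suc n)" by (intro divide_left_mono) auto
        ultimately show "x \<in> U n" unfolding U_def by simp
      qed
      have emp: "(\<Inter>n. U n - B) = {}"
      proof (intro equals0I)
        fix x assume x: "x \<in> (\<Inter>n. U n - B)"
        then have "infdist x B > 0" using False Basic
          by (metis DiffD2 INT_iff UNIV_I infdist_pos_not_in_closed mem_Collect_eq)
        then obtain n where "1 / real (Suc n) < infdist x B" using nat_approx_posE by blast
        then show False using x by (auto simp: U_def) (meson not_less_iff_gr_or_eq)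
      qed
      have "(\<lambda>n. measure M (U n - B)) \<longlonglongrightarrow> measure M (\<Inter>n. U n - B)"
        using op Basic dec by (intro finite_Lim_measure_decseq) (auto simp: M)
      then have "(\<lambda>n. measure M (U n - B)) \<longlonglongrightarrow> 0" unfolding emp by simp
      then have "\<forall>\<^sub>F n in sequentially. measure M (U n - B) < e" using Basic(2) by (rule order_tendstoD)
      then obtain n where "measure M (U n - B) < e" by (auto simp: eventually_sequentially)
      moreover have "B \<subseteq> U n" by (auto simp: U_def)
      ultimately show ?thesis using op Basic by (intro exI[of _ B] exI[of _ "U n"]) auto
    qed
  next
    case Empty then show ?case by (intro exI[of _ "{}"]) auto
  next
    case (Compl a)
    from Compl.IH[OF Compl.prems] obtain C U where "closed C" "open U" "C \<subseteq> a" "a \<subseteq> U" "measure M (U - C) < e" by blast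
    moreover have "- C - - U = U - C" by auto
    ultimately show ?case by (intro exI[of _ "- U"] exI[of _ "- C"]) (auto)
  next
    case (Union a)
    have "\<forall>i. \<exists>C U. closed C \<and> open U \<and> C \<subseteq> a i \<and> a i \<subseteq> U \<and> measure M (U - C) < (e/2) * (1/2) ^ Suc i"
    proof
      fix i
      have "0 < (e/2) * (1/2) ^ Suc i" using Union.prems by simp
      from Union.IH[OF this, of i]
      show "\<exists>C U. closed C \<and> open U \<and> C \<subseteq> a i \<and> a i \<subseteq> U \<and> measure M (U - C) < (e/2) * (1/2) ^ Suc i" .
    qed
    then obtain C U where CU: "\<And>i. closed (C i)" "\<And>i. open (U i)" "\<And>i. C i \<subseteq> a i" "\<And>i. a i \<subseteq> U i"
      "\<And>i. measure M (U i - C i) < (e/2) * (1/2) ^ Suc i" by metis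
    define D where "D n = (\<Union>i\<le>n. C i)" for n
    have meas[measurable]: "U i \<in> sets borel" "C i \<in> sets borel" "D i \<in> sets borel" for i
      using CU by (auto simp: D_def)
    have sums: "(\<lambda>i. (e/2) * (1/2) ^ Suc i) sums (e/2)"
      using sums_mult[OF power_half_series, of "e/2"] by simp
    have smb: "summable (\<lambda>i. measure M (U i - C i))"
      by (rule summable_comparison_test'[OF sums_summable[OF sums]]) (use CU(5) in \<open>auto intro: less_imp_le\<close>)
    have "measure M ((\<Union>i. U i) - (\<Union>i. C i)) \<le> measure M (\<Union>i. U i - C i)"
      by (intro finite_measure_mono) (auto simp: M)
    also have "\<dots> \<le> (\<Sum>i. measure M (U i - C i))"
      using smb by (intro finite_measure_subadditive_countably) (auto simp: M)
    also have "\<dots> \<le> (\<Sum>i. (e/2) * (1/2) ^ Suc i)"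
      using smb sums CU(5) by (intro suminf_le) (auto intro: less_imp_le dest: sums_summable)
    also have "\<dots> = e/2" using sums by (simp add: sums_iff)
    finally have 1: "measure M ((\<Union>i. U i) - (\<Union>i. C i)) \<le> e/2" .
    have "(\<lambda>n. measure M ((\<Union>i. U i) - D n)) \<longlonglongrightarrow> measure M (\<Inter>n. (\<Union>i. U i) - D n)"
      by (intro finite_Lim_measure_decseq) (auto simp: M decseq_def D_def)
    moreover have "(\<Inter>n. (\<Union>i. U i) - D n) = (\<Union>i. U i) - (\<Union>i. C i)" by (auto simp: D_def)
    ultimately have "(\<lambda>n. measure M ((\<Union>i. U i) - D n)) \<longlonglongrightarrow> measure M ((\<Union>i. U i) - (\<Union>i. C i))" by simp
    then have "\<forall>\<^sub>F n in sequentially. measure M ((\<Union>i. U i) - D n) < e"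
      using 1 Union.prems by (intro order_tendstoD(2)[where a="e"]) (assumption, simp)
    then obtain n where n: "measure M ((\<Union>i. U i) - D n) < e" by (auto simp: eventually_sequentially)
    have "closed (D n)" unfolding D_def using CU by auto
    moreover have "D n \<subseteq> (\<Union>i. a i)" unfolding D_def using CU(3) by (intro UN_mono) auto
    moreover have "(\<Union>i. a i) \<subseteq> (\<Union>i. U i)" using CU(4) by (intro UN_mono) auto
    ultimately show ?case using n CU(2) by (intro exI[of _ "D n"] exI[of _ "\<Union>i. U i"]) auto
  qed
qed


lemma compact_if_subset:
  fixes K :: "'a::t2_space set"
  assumes "compact K" "S \<subseteq> K" "closed S" shows "compact S"
  using compact_Int_closed[OF assms(1,3)] assms(2) by (simp add: Int_absorb1)

lemma C_infty_continuous: "f \<in> C_infty \<Longrightarrow> continuous_on A f"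
  unfolding C_infty_def by (auto intro: continuous_on_subset)

lemma C_infty_borel: "f \<in> C_infty \<Longrightarrow> f \<in> borel_measurable borel"
  by (intro borel_measurable_continuous_onI C_infty_continuous)

lemma C_infty_bounded:
  fixes f :: "'a::t2_space \<Rightarrow> real"
  assumes "f \<in> C_infty" shows "\<exists>M. \<forall>x. \<bar>f x\<bar> \<le> M"
proof -
  obtain K where K: "compact K" "\<And>x. x \<notin> K \<Longrightarrow> \<bar>f x\<bar> < 1"
    using assms unfolding C_infty_def by (auto dest: spec[of _ 1])
  have "bounded (f ` K)"
    using K(1) assms by (intro compact_imp_bounded compact_continuous_image C_infty_continuous)
  then obtain B where B: "\<And>x. x \<in> K \<Longrightarrow> \<bar>f x\<bar> \<le> B" by (auto simp: bounded_iff)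
  show ?thesis using K(2) B by (intro exI[of _ "max B 1"]) (metis less_eq_real_def max.coboundedI1 max.coboundedI2)
qed

lemma sup_norm_upper:
  fixes f :: "'a::t2_space \<Rightarrow> real"
  assumes "f \<in> C_infty" shows "\<bar>f x\<bar> \<le> sup_norm f"
proof -
  have "bdd_above (range (\<lambda>x. \<bar>f x\<bar>))" using C_infty_bounded[OF assms] by (auto simp: bdd_above_def)
  then show ?thesis unfolding sup_norm_def by (rule cSUP_upper[OF UNIV_I])
qed

lemma C_infty_lincomb:
  fixes f g :: "'a::t2_space \<Rightarrow> real"
  assumes "f \<in> C_infty" "g \<in> C_infty" shows "(\<lambda>x. a * f x + b * g x) \<in> C_infty"
  unfolding C_infty_def
proof (intro CollectI conjI allI impI)
  show "continuous_on UNIV (\<lambda>x. a * f x + b * g x)"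
    using assms by (intro continuous_intros C_infty_continuous)
  fix e :: real assume e: "e > 0"
  define d where "d = e / (2 * (\<bar>a\<bar> + \<bar>b\<bar> + 1))"
  have d: "d > 0" using e by (simp add: d_def)
  obtain K where K: "compact K" "\<And>x. x \<notin> K \<Longrightarrow> \<bar>f x\<bar> < d" using assms(1) d unfolding C_infty_def by blast
  obtain L where L: "compact L" "\<And>x. x \<notin> L \<Longrightarrow> \<bar>g x\<bar> < d" using assms(2) d unfolding C_infty_def by blast
  have "\<bar>a * f x + b * g x\<bar> < e" if "x \<notin> K \<union> L" for x
  proof -
    have "\<bar>a * f x + b * g x\<bar> \<le> \<bar>a\<bar> * \<bar>f x\<bar> + \<bar>b\<bar> * \<bar>g x\<bar>" by (metis abs_mult abs_triangle_ineq)
    also have "\<dots> \<le> \<bar>a\<bar> * d + \<bar>b\<bar> * d"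
      using K(2)[of x] L(2)[of x] that by (intro add_mono mult_left_mono) auto
    also have "\<dots> < (\<bar>a\<bar> + \<bar>b\<bar> + 1) * d * 2" using d by (simp add: algebra_simps add_strict_increasing2)
    also have "\<dots> = e" by (simp add: d_def field_simps)
    finally show ?thesis .
  qed
  then show "\<exists>K. compact K \<and> (\<forall>x. x \<notin> K \<longrightarrow> \<bar>a * f x + b * g x\<bar> < e)"
    using K(1) L(1) by (intro exI[of _ "K \<union> L"]) auto
qed

lemma C_infty_diff:
  fixes f g :: "'a::t2_space \<Rightarrow> real"
  assumes "f \<in> C_infty" "g \<in> C_infty" shows "(\<lambda>x. f x - g x) \<in> C_infty"
  using C_infty_lincomb[OF assms, of 1 "-1"] by simp

lemma C_c_C_infty:
  assumes "f \<in> C_c" shows "f \<in> C_infty"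
proof -
  have "\<bar>f x\<bar> < e" if "e > 0" "x \<notin> closure {x. f x \<noteq> 0}" for e x
    using that closure_subset[of "{x. f x \<noteq> 0}"] by (cases "f x = 0") auto
  then show ?thesis using assms unfolding C_c_def C_infty_def by blast
qed

locale radon_space =
  fixes m :: "'a::{metric_space, second_countable_topology} measure"
  assumes lc: "locally compact (UNIV :: 'a set)"
    and radon: "radon_measure m"
    and full: "full_support m"
begin

lemma sets_m[measurable_cong, simp]: "sets m = sets borel"
  using radon by (simp add: radon_measure_def)

lemma space_m[simp]: "space m = UNIV"
  using sets_eq_imp_space_eq[OF sets_m] by simp

lemma finite_on_compact: "compact K \<Longrightarrow> emeasure m K < \<infinity>"
  using radon by (simp add: radon_measure_def)

lemma sigma_finite_m: "sigma_finite_measure m"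
proof -
  obtain W K :: "nat \<Rightarrow> 'a set" where WK: "\<And>n. open (W n)" "incseq W" "\<And>n. compact (K n)"
      "incseq K" "\<And>n. W n \<subseteq> K n" "(\<Union>n. W n) = UNIV"
    by (rule locally_compact_exhaustion[OF lc]) (rule that; assumption)
  have "x \<in> \<Union>(range K)" for x
  proof -
    obtain n where "x \<in> W n" using WK(6) by (metis UNIV_I UN_iff)
    then show ?thesis using WK(5)[of n] by (intro UN_I[of n]) auto
  qed
  then have "\<Union>(range K) = UNIV" by (intro set_eqI) simp
  then show ?thesis
  proof (intro sigma_finite_measure.intro)
    show "\<exists>A. countable A \<and> A \<subseteq> sets m \<and> \<Union>A = space m \<and> (\<forall>a\<in>A. emeasure m a \<noteq> \<infinity>)"
      if "\<Union>(range K) = UNIV"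
      using that WK(3) finite_on_compact[OF WK(3)] by (intro exI[of _ "range K"]) (auto simp: borel_compact less_top)
  qed
qed

lemma C_c_integrable:
  assumes "h \<in> C_c" shows "integrable m h"
proof -
  define K where "K = closure {x. h x \<noteq> 0}"
  have K: "compact K" using assms by (simp add: C_c_def K_def)
  obtain M where M: "\<And>x. \<bar>h x\<bar> \<le> M" using C_infty_bounded[OF C_c_C_infty[OF assms]] by auto
  have [measurable]: "h \<in> borel_measurable m"
    using C_infty_borel[OF C_c_C_infty[OF assms]] by simp
  have "integrable m (\<lambda>x. M * indicator K x)"
    using K finite_on_compact[OF K] by (intro integrable_mult_right integrable_real_indicator) (auto simp: borel_compact)
  then show ?thesis
  proof (rule Bochner_Integration.integrable_bound)
    show "AE x in m. norm (h x) \<le> norm (M * indicator K x)"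
    proof (rule AE_I2)
      fix x show "norm (h x) \<le> norm (M * indicator K x)"
        using M[of x] closure_subset[of "{x. h x \<noteq> 0}"] by (cases "h x = 0") (auto simp: K_def)
    qed
  qed simp
qed

lemma integrable_bounded_mult:
  fixes f c :: "'a \<Rightarrow> real"
  assumes "integrable m f" "c \<in> borel_measurable borel" "\<And>x. \<bar>c x\<bar> \<le> B"
  shows "integrable m (\<lambda>x. f x * c x)"
proof (rule Bochner_Integration.integrable_bound)
  note assms(2)[measurable]
  have [measurable]: "f \<in> borel_measurable borel" using borel_measurable_integrable[OF assms(1)] by simp
  have B0: "0 \<le> B" using assms(3)[of undefined] by linarith
  show "integrable m (\<lambda>x. B * f x)" using assms by simp
  show "AE x in m. norm (f x * c x) \<le> norm (B * f x)"
  proof (rule AE_I2)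
    fix x
    have "\<bar>f x\<bar> * \<bar>c x\<bar> \<le> \<bar>f x\<bar> * B" using assms(3) by (intro mult_left_mono) auto
    then show "norm (f x * c x) \<le> norm (B * f x)" using B0 by (simp add: abs_mult mult.commute)
  qed
qed (use assms borel_measurable_integrable[OF assms(1)] in \<open>simp add: measurable_cong_sets[OF sets_m refl]\<close>)

text \<open>Open sets are reached from test functions through these approximations.\<close>

lemma open_indicator_approx:
  assumes "open U"
  obtains h :: "nat \<Rightarrow> 'a \<Rightarrow> real" where
    "\<And>n. h n \<in> C_c" "\<And>n x. 0 \<le> h n x" "\<And>n x. h n x \<le> indicator U x"
    "\<And>x. incseq (\<lambda>n. h n x)" "\<And>x. x \<in> U \<Longrightarrow> \<exists>n. h n x = 1"
proof -
  obtain W K :: "nat \<Rightarrow> 'a set" where WK: "\<And>n. open (W n)" "incseq W" "\<And>n. compact (K n)"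
      "incseq K" "\<And>n. W n \<subseteq> K n" "(\<Union>n. W n) = UNIV"
    by (rule locally_compact_exhaustion[OF lc]) (rule that; assumption)
  have inc: "incseq (\<lambda>n. U \<inter> W n)" using WK(2) by (auto simp: incseq_def)
  show ?thesis
  proof
    show "hat (U \<inter> W n) n \<in> C_c" for n
    proof -
      have "{x. hat (U \<inter> W n) n x \<noteq> 0} \<subseteq> K n" using WK(5)[of n] hat_eq_0[of _ "U \<inter> W n" n] by blast
      then have "closure {x. hat (U \<inter> W n) n x \<noteq> 0} \<subseteq> K n"
        using WK(3) by (intro closure_minimal compact_imp_closed)
      then have "compact (closure {x. hat (U \<inter> W n) n x \<noteq> 0})" by (rule compact_if_subset[OF WK(3)]) simp
      then show ?thesis using continuous_hat by (simp add: C_c_def)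
    qed
    show "hat (U \<inter> W n) n x \<le> indicator U x" for n x
      using hat_bounds(2)[of "U \<inter> W n" n x] hat_eq_0[of x "U \<inter> W n" n] by (auto simp: indicator_def)
    show "incseq (\<lambda>n. hat (U \<inter> W n) n x)" for x
      using inc by (intro incseq_SucI hat_mono) (auto simp: incseq_Suc_iff)
    show "\<exists>n. hat (U \<inter> W n) n x = 1" if "x \<in> U" for x
      using that inc WK(1,6) assms by (intro hat_eventually_1) auto
  qed (rule hat_bounds)
qed

lemma emeasure_open_le:
  fixes \<rho> :: "'a measure"
  assumes \<rho>: "sets \<rho> = sets borel" and U: "open U"
    and le: "\<And>h. h \<in> C_c \<Longrightarrow> (\<And>x. 0 \<le> h x) \<Longrightarrow> (\<And>x. h x \<le> indicator U x) \<Longrightarrow> (\<integral>\<^sup>+x. ennreal (h x) \<partial>\<rho>) \<le> c"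
  shows "emeasure \<rho> U \<le> c"
proof -
  obtain h :: "nat \<Rightarrow> 'a \<Rightarrow> real" where h:
    "\<And>n. h n \<in> C_c" "\<And>n x. 0 \<le> h n x" "\<And>n x. h n x \<le> indicator U x"
    "\<And>x. incseq (\<lambda>n. h n x)" "\<And>x. x \<in> U \<Longrightarrow> \<exists>n. h n x = 1"
    using open_indicator_approx[OF U] by blast
  note [measurable_cong] = \<rho>
  have [measurable]: "h n \<in> borel_measurable borel" for n using h(1) C_infty_borel C_c_C_infty by blast
  have "emeasure \<rho> U = (\<integral>\<^sup>+x. indicator U x \<partial>\<rho>)" using U \<rho> by simp
  also have "\<dots> \<le> (\<integral>\<^sup>+x. (SUP n. ennreal (h n x)) \<partial>\<rho>)"
  proof (rule nn_integral_mono)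
    fix x show "indicator U x \<le> (SUP n. ennreal (h n x))"
    proof (cases "x \<in> U")
      case True
      then obtain n where "h n x = 1" using h(5) by blast
      then have "1 \<le> (SUP n. ennreal (h n x))" by (intro SUP_upper2[of n]) auto
      with True show ?thesis by simp
    qed auto
  qed
  also have "\<dots> = (SUP n. \<integral>\<^sup>+x. ennreal (h n x) \<partial>\<rho>)"
    using h(4) by (intro nn_integral_monotone_convergence_SUP)
      (auto simp: incseq_def le_fun_def intro!: ennreal_leI)
  also have "\<dots> \<le> c" using h le by (intro SUP_least) blast
  finally show ?thesis .
qed

text \<open>A negative value would persist on a nonempty open set, and every such set has positive measure
  and carries a nonzero test function.\<close>

lemma C_c_pairing_nonneg:
  assumes f: "continuous_on UNIV f" and le: "\<And>h. h \<in> C_c \<Longrightarrow> (\<And>x. 0 \<le> h x) \<Longrightarrow> 0 \<le> (\<integral>x. h x * f x \<partial>m)"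
  shows "0 \<le> f x"
proof (rule ccontr)
  assume neg: "\<not> 0 \<le> f x"
  define U where "U = {y. f y < f x / 2}"
  have U: "open U" "x \<in> U" unfolding U_def using neg f by (auto intro!: open_Collect_less continuous_intros)
  obtain h :: "nat \<Rightarrow> 'a \<Rightarrow> real" where h:
    "\<And>n. h n \<in> C_c" "\<And>n x. 0 \<le> h n x" "\<And>n x. h n x \<le> indicator U x"
    "\<And>x. incseq (\<lambda>n. h n x)" "\<And>x. x \<in> U \<Longrightarrow> \<exists>n. h n x = 1"
    by (rule open_indicator_approx[OF U(1)]) (rule that; assumption)
  obtain n where n: "h n x = 1" using h(5) U(2) by blast
  have [measurable]: "f \<in> borel_measurable borel" using f by (rule borel_measurable_continuous_onI)
  have meas[measurable]: "h n \<in> borel_measurable borel" using h(1) C_infty_borel C_c_C_infty by blast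
  have cont: "continuous_on UNIV (h n)" using h(1) C_infty_continuous C_c_C_infty by blast
  have int: "integrable m (h n)" using h(1) C_c_integrable by blast
  have int2: "integrable m (\<lambda>y. h n y * f y)"
  proof (rule C_c_integrable)
    have "closure {x. h n x * f x \<noteq> 0} \<subseteq> closure {x. h n x \<noteq> 0}" by (rule closure_mono) auto
    moreover have "compact (closure {x. h n x \<noteq> 0})" using h(1)[of n] by (simp add: C_c_def)
    ultimately have "compact (closure {x. h n x * f x \<noteq> 0})" using compact_if_subset closed_closure by blast
    then show "(\<lambda>y. h n y * f y) \<in> C_c" using f cont by (auto simp: C_c_def intro!: continuous_intros)
  qed
  have "h n y * f y \<le> h n y * (f x / 2)" for y
  proof (cases "y \<in> U")
    case True then show ?thesis using h(2)[of n y] by (intro mult_left_mono) (auto simp: U_def)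
  next
    case False then have "h n y = 0" using h(2)[of n y] h(3)[of n y] by simp
    then show ?thesis by simp
  qed
  then have "(\<integral>y. h n y * f y \<partial>m) \<le> (\<integral>y. h n y * (f x / 2) \<partial>m)"
    using int int2 by (intro integral_mono) auto
  also have "\<dots> = (\<integral>y. h n y \<partial>m) * (f x / 2)" by simp
  finally have "0 \<le> (\<integral>y. h n y \<partial>m) * (f x / 2)" using le[of "h n"] h(1,2) by force
  then have "(\<integral>y. h n y \<partial>m) \<le> 0" using neg by (simp add: zero_le_mult_iff)
  then have "(\<integral>y. h n y \<partial>m) = 0" using Bochner_Integration.integral_nonneg[of m "h n"] h(2) by (auto intro: antisym)
  then have "AE y in m. h n y = 0" using int h(2) integral_nonneg_eq_0_iff_AE by blast
  then have "emeasure m {y. h n y \<noteq> 0} = 0" by (subst (asm) AE_iff_measurable[OF _ refl]) auto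
  moreover have "open {y. h n y \<noteq> 0}"
    using cont by (intro open_Collect_neq) (auto intro: continuous_intros)
  moreover have "{y. h n y \<noteq> 0} \<noteq> {}" using n by force
  ultimately show False using full unfolding full_support_def by (metis less_numeral_extra(3))
qed

lemma open_superset_on_finite:
  assumes B: "B \<in> sets borel" and W: "open W" "emeasure m W < \<infinity>" and e: "(e::real) > 0"
  shows "\<exists>U. open U \<and> B \<inter> W \<subseteq> U \<and> U \<subseteq> W \<and> emeasure m U \<le> emeasure m (B \<inter> W) + ennreal e"
proof -
  define M where "M = density m (indicator W)"
  have sM: "sets M = sets borel" by (simp add: M_def)
  have WB[measurable]: "W \<in> sets borel" using W by auto
  have em: "emeasure M A = emeasure m (W \<inter> A)" if "A \<in> sets borel" for A
    using that by (simp add: M_def emeasure_density nn_integral_set_ennreal[symmetric] indicator_inter_arith[symmetric] mult.commute Int_commute)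
  have fin: "finite_measure M"
    using em[of UNIV] W by (intro finite_measureI) (auto simp: M_def emeasure_density)
  obtain C U where CU: "closed C" "open U" "C \<subseteq> B" "B \<subseteq> U" "measure M (U - C) < e"
    using finite_measure_open_closed_approx[OF sM fin B e] by blast
  have [measurable]: "U \<in> sets borel" "C \<in> sets borel" using CU by auto
  have "emeasure m (U \<inter> W) \<le> emeasure m ((B \<inter> W) \<union> (W \<inter> (U - C)))"
    using CU(3,4) B by (intro emeasure_mono) auto
  also have "\<dots> \<le> emeasure m (B \<inter> W) + emeasure m (W \<inter> (U - C))"
    using B by (intro emeasure_subadditive) auto
  also have "emeasure m (W \<inter> (U - C)) = emeasure M (U - C)" by (simp add: em)
  also have "\<dots> \<le> ennreal e"
    using CU(5) finite_measure.emeasure_eq_measure[OF fin] by (simp add: ennreal_leI)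
  finally show ?thesis using CU W by (intro exI[of _ "U \<inter> W"]) auto
qed

text \<open>An open set of small measure around each piece of \<open>N\<close> in the exhaustion, with errors that sum
  to \<open>e\<close>.\<close>

lemma null_set_open_superset:
  assumes N: "N \<in> null_sets m" and e: "(e::real) > 0"
  shows "\<exists>U. open U \<and> N \<subseteq> U \<and> emeasure m U \<le> ennreal e"
proof -
  obtain W K :: "nat \<Rightarrow> 'a set" where WK: "\<And>n. open (W n)" "incseq W" "\<And>n. compact (K n)"
      "incseq K" "\<And>n. W n \<subseteq> K n" "(\<Union>n. W n) = UNIV"
    by (rule locally_compact_exhaustion[OF lc]) (rule that; assumption)
  have NB: "N \<in> sets borel" using N by auto
  have fin: "emeasure m (W n) < \<infinity>" for n
    using emeasure_mono[OF WK(5)[of n], of m] finite_on_compact[OF WK(3)[of n]] WK(3) by (auto simp: borel_compact)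
  have z: "emeasure m (N \<inter> W n) = 0" for n
    using N WK(1) null_set_Int2[of N m "W n"] by (auto simp: null_sets_def)
  have "\<exists>U. open U \<and> N \<inter> W n \<subseteq> U \<and> emeasure m U \<le> ennreal (e * (1/2) ^ Suc n)" for n
    using open_superset_on_finite[OF NB WK(1) fin, of "e * (1/2) ^ Suc n" n] e z[of n] by auto
  then obtain U where U: "\<And>n. open (U n)" "\<And>n. N \<inter> W n \<subseteq> U n" "\<And>n. emeasure m (U n) \<le> ennreal (e * (1/2) ^ Suc n)"
    by metis
  have sums: "(\<lambda>i. e * (1/2) ^ Suc i) sums e"
    using sums_mult[OF power_half_series, of e] by simp
  have "emeasure m (\<Union>n. U n) \<le> (\<Sum>n. emeasure m (U n))"
    using U(1) by (intro emeasure_subadditive_countably) auto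
  also have "\<dots> \<le> (\<Sum>n. ennreal (e * (1/2) ^ Suc n))" using U(3) by (intro suminf_le) auto
  also have "\<dots> = ennreal e" using sums e by (intro suminf_ennreal_eq) auto
  finally have "emeasure m (\<Union>n. U n) \<le> ennreal e" .
  moreover have "N \<subseteq> (\<Union>n. U n)"
  proof
    fix x assume "x \<in> N"
    moreover obtain n where "x \<in> W n" using WK(6) by (metis UNIV_I UN_iff)
    ultimately show "x \<in> (\<Union>n. U n)" using U(2)[of n] by (intro UN_I[of n]) auto
  qed
  ultimately show ?thesis using U(1) by (intro exI[of _ "\<Union>n. U n"] conjI open_UN) auto
qed

text \<open>Test functions reach open sets, and open sets reach the exceptional set \<open>B\<close> by outer regularity, so
  that the measure with density \<open>\<psi>\<close> is at most \<open>e m\<close> on \<open>B\<close>. There \<open>\<psi> > 2e\<close>; the factor \<open>2\<close>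
  makes the two bounds incompatible unless \<open>B\<close> is null.\<close>

lemma AE_le_if_C_c_pairing_le:
  assumes \<psi>[measurable]: "\<psi> \<in> borel_measurable borel" and e: "(e::real) > 0"
    and le: "\<And>h. h \<in> C_c \<Longrightarrow> (\<And>x. 0 \<le> h x) \<Longrightarrow> (\<integral>\<^sup>+x. ennreal (h x) * \<psi> x \<partial>m) \<le> ennreal e * (\<integral>\<^sup>+x. ennreal (h x) \<partial>m)"
  shows "AE x in m. \<psi> x \<le> ennreal (2 * e)"
proof -
  obtain W K :: "nat \<Rightarrow> 'a set" where WK: "\<And>n. open (W n)" "incseq W" "\<And>n. compact (K n)"
      "incseq K" "\<And>n. W n \<subseteq> K n" "(\<Union>n. W n) = UNIV"
    by (rule locally_compact_exhaustion[OF lc]) (rule that; assumption)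
  have fin: "emeasure m (W n) < \<infinity>" for n
    using emeasure_mono[OF WK(5)[of n], of m] finite_on_compact[OF WK(3)[of n]] WK(3) by (auto simp: borel_compact)
  define B where "B = {x. ennreal (2 * e) < \<psi> x}"
  have [measurable]: "B \<in> sets borel" unfolding B_def by measurable
  define \<rho> where "\<rho> = density m \<psi>"
  have s\<rho>: "sets \<rho> = sets borel" by (simp add: \<rho>_def)
  have op: "emeasure \<rho> U \<le> ennreal e * emeasure m U" if "open U" for U
  proof (rule emeasure_open_le[OF s\<rho> that])
    fix h :: "'a \<Rightarrow> real" assume h: "h \<in> C_c" "\<And>x. 0 \<le> h x" "\<And>x. h x \<le> indicator U x"
    have [measurable]: "h \<in> borel_measurable borel" using h(1) C_infty_borel C_c_C_infty by blast
    have [measurable]: "U \<in> sets borel" using that by auto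
    have "(\<integral>\<^sup>+x. ennreal (h x) \<partial>\<rho>) = (\<integral>\<^sup>+x. ennreal (h x) * \<psi> x \<partial>m)"
      by (simp add: \<rho>_def nn_integral_density mult.commute)
    also have "\<dots> \<le> ennreal e * (\<integral>\<^sup>+x. ennreal (h x) \<partial>m)" using le h by blast
    also have "\<dots> \<le> ennreal e * (\<integral>\<^sup>+x. indicator U x \<partial>m)"
      using ennreal_leI[OF h(3)] by (intro mult_left_mono nn_integral_mono) (auto simp: ennreal_indicator)
    also have "\<dots> = ennreal e * emeasure m U" by simp
    finally show "(\<integral>\<^sup>+x. ennreal (h x) \<partial>\<rho>) \<le> ennreal e * emeasure m U" .
  qed
  have null: "emeasure m (B \<inter> W n) = 0" for n
  proof -
    have [measurable]: "W n \<in> sets borel" using WK by auto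
    have fin2: "emeasure m (B \<inter> W n) < \<infinity>"
      using emeasure_mono[of "B \<inter> W n" "W n" m] fin[of n] by auto
    have "emeasure \<rho> (B \<inter> W n) \<le> ennreal e * emeasure m (B \<inter> W n)"
    proof (rule ennreal_le_epsilon)
      fix d :: real assume d: "d > 0"
      obtain U where U: "open U" "B \<inter> W n \<subseteq> U" "emeasure m U \<le> emeasure m (B \<inter> W n) + ennreal (d / e)"
        using open_superset_on_finite[OF _ WK(1) fin, of B "d / e" n] d e by auto
      have "emeasure \<rho> (B \<inter> W n) \<le> emeasure \<rho> U" using U s\<rho> by (intro emeasure_mono) auto
      also have "\<dots> \<le> ennreal e * emeasure m U" using op U by auto
      also have "\<dots> \<le> ennreal e * (emeasure m (B \<inter> W n) + ennreal (d / e))" using U by (intro mult_left_mono) auto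
      also have "\<dots> = ennreal e * emeasure m (B \<inter> W n) + ennreal d"
        using d e by (simp add: distrib_left ennreal_mult[symmetric])
      finally show "emeasure \<rho> (B \<inter> W n) \<le> ennreal e * emeasure m (B \<inter> W n) + ennreal d" .
    qed
    moreover have "ennreal (2 * e) * emeasure m (B \<inter> W n) \<le> emeasure \<rho> (B \<inter> W n)"
    proof -
      have "ennreal (2 * e) * emeasure m (B \<inter> W n) = (\<integral>\<^sup>+x. ennreal (2 * e) * indicator (B \<inter> W n) x \<partial>m)"
        by (simp add: nn_integral_cmult_indicator)
      also have "\<dots> \<le> (\<integral>\<^sup>+x. \<psi> x * indicator (B \<inter> W n) x \<partial>m)"
        by (intro nn_integral_mono) (auto simp: B_def split: split_indicator)
      also have "\<dots> = emeasure \<rho> (B \<inter> W n)" by (simp add: \<rho>_def emeasure_density)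
      finally show ?thesis .
    qed
    ultimately have le2: "ennreal (2 * e) * emeasure m (B \<inter> W n) \<le> ennreal e * emeasure m (B \<inter> W n)" by (rule order_trans[rotated])
    obtain r where r: "r \<ge> 0" "emeasure m (B \<inter> W n) = ennreal r" using fin2 by (cases "emeasure m (B \<inter> W n)") auto
    have "2 * e * r \<le> e * r" using le2 r e by (simp add: ennreal_mult[symmetric])
    then have "r \<le> 0" using e by (simp add: mult_le_0_iff)
    then show ?thesis using r by simp
  qed
  have "emeasure m (\<Union>n. B \<inter> W n) = 0"
    using null WK(1) by (intro emeasure_UN_eq_0) auto
  moreover have "(\<Union>n. B \<inter> W n) = B" using WK(6) by auto
  ultimately show ?thesis by (subst AE_iff_measurable[of B]) (auto simp: B_def not_le)
qed

end

section \<open>The transition kernels of the process\<close>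

lemma space_borel_pt[simp]: "space borel_pt = UNIV"
  by (simp add: borel_pt_def)

lemma openin_top_pt_borel_pt: "openin top_pt U \<Longrightarrow> U \<in> sets borel_pt"
  by (simp add: borel_pt_def)

lemma measurable_Some_pt[measurable]: "Some \<in> borel \<rightarrow>\<^sub>M borel_pt"
  unfolding borel_pt_def
proof (rule measurable_measure_of)
  fix U :: "'a option set" assume "U \<in> {U. openin top_pt U}"
  then have "openin euclidean {x \<in> topspace euclidean. Some x \<in> U}"
    unfolding top_pt_def by (intro openin_continuous_map_preimage[OF continuous_map_Some]) auto
  then have "open (Some -` U)" by (simp add: vimage_def)
  then show "Some -` U \<inter> space borel \<in> sets borel" by simp
qed auto

lemma image_Some_borel_pt:
  assumes "B \<in> sets borel" shows "Some ` B \<in> sets borel_pt"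
proof -
  have all: "range Some \<in> sets (borel_pt :: 'a option measure)"
    by (intro openin_top_pt_borel_pt) (simp add: top_pt_def)
  have "B \<in> sigma_sets UNIV {S. open S}" using assms by (simp add: borel_def)
  then show ?thesis
  proof (induction rule: sigma_sets.induct)
    case (Basic a)
    then show ?case by (intro openin_top_pt_borel_pt) (simp add: top_pt_def)
  next
    case (Compl a)
    have "Some ` (UNIV - a) = range Some - Some ` a" by auto
    with Compl all show ?case by auto
  next
    case (Union a)
    then show ?case by (auto simp: image_UN)
  qed auto
qed

lemma singleton_None_borel_pt: "{None} \<in> sets (borel_pt :: 'a::topological_space option measure)"
proof -
  have "range (Some :: 'a \<Rightarrow> _) \<in> sets borel_pt" by (rule image_Some_borel_pt) simp
  then have "space borel_pt - range (Some :: 'a \<Rightarrow> _) \<in> sets borel_pt" by (rule sets.compl_sets)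
  moreover have "space borel_pt - range (Some :: 'a \<Rightarrow> _) = {None}" by (auto simp: notin_range_Some)
  ultimately show ?thesis by simp
qed

lemma measurable_borel_ptI:
  fixes g :: "'a::topological_space option \<Rightarrow> 'b"
  assumes g: "(\<lambda>x. g (Some x)) \<in> borel \<rightarrow>\<^sub>M N" and n: "g None \<in> space N"
  shows "g \<in> borel_pt \<rightarrow>\<^sub>M N"
proof (rule measurableI)
  show "g y \<in> space N" if "y \<in> space borel_pt" for y
    using measurable_space[OF g] n by (cases y) auto
  fix A assume "A \<in> sets N"
  then have *: "{x. g (Some x) \<in> A} \<in> sets borel" using measurable_sets[OF g, of A] by (simp add: vimage_def)
  have eq: "g -` A \<inter> space borel_pt = Some ` {x. g (Some x) \<in> A} \<union> (if g None \<in> A then {None} else {})"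
  proof (rule set_eqI)
    fix y show "y \<in> g -` A \<inter> space borel_pt \<longleftrightarrow> y \<in> Some ` {x. g (Some x) \<in> A} \<union> (if g None \<in> A then {None} else {})"
      by (cases y) auto
  qed
  show "g -` A \<inter> space borel_pt \<in> sets borel_pt"
    unfolding eq using image_Some_borel_pt[OF *] singleton_None_borel_pt by (intro sets.Un) auto
qed

lemma ext0_simps[simp]: "ext0 f None = 0" "ext0 f (Some x) = f x"
  by (simp_all add: ext0_def)

lemma measurable_ext0[measurable]:
  fixes f :: "'a::topological_space \<Rightarrow> real"
  shows "f \<in> borel_measurable borel \<Longrightarrow> ext0 f \<in> borel_measurable borel_pt"
  by (rule measurable_borel_ptI) auto

lemma measurable_ext0_ennreal[measurable]:
  fixes f :: "'a::topological_space \<Rightarrow> ennreal"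
  shows "f \<in> borel_measurable borel \<Longrightarrow> ext0 f \<in> borel_measurable borel_pt"
  by (rule measurable_borel_ptI) auto

lemma space_natural_filt[simp]: "space (natural_filt X t) = UNIV"
  by (simp add: natural_filt_def)

lemma sets_natural_filt:
  "sets (natural_filt X t) = sigma_sets UNIV {X s -` B | s B. s \<le> t \<and> B \<in> sets borel_pt}"
  by (simp add: natural_filt_def)

lemma measurable_coord: "s \<le> t \<Longrightarrow> X s \<in> natural_filt X t \<rightarrow>\<^sub>M borel_pt"
  by (rule measurableI) (auto simp: sets_natural_filt intro!: sigma_sets.Basic)

locale hunt_space = radon_space m
  for m :: "'a::{metric_space, second_countable_topology} measure" +
  fixes X :: "('w, 'a) coords" and \<theta> :: "ennreal \<Rightarrow> 'w \<Rightarrow> 'w" and P :: "'a option \<Rightarrow> 'w measure"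
  assumes hunt: "hunt_process X \<theta> P" and sym: "m_symmetric m X P"
begin

abbreviation "N \<equiv> natural_filt X \<infinity>"
abbreviation "p \<equiv> trans_op X P"

lemma measurable_P[measurable]: "P \<in> borel_pt \<rightarrow>\<^sub>M prob_algebra N"
  using hunt unfolding hunt_process_def by (elim conjE)

lemma measurable_P_subprob[measurable]: "P \<in> borel_pt \<rightarrow>\<^sub>M subprob_algebra N"
  by (rule measurable_prob_algebraD[OF measurable_P])

lemma sets_P[measurable_cong, simp]: "sets (P x) = sets N" and prob_P: "prob_space (P x)"
  using measurable_space[OF measurable_P, of x] by (auto simp: space_prob_algebra)

lemma space_P[simp]: "space (P x) = UNIV"
  using sets_eq_imp_space_eq[OF sets_P] by simp

lemma measure_P_UNIV[simp]: "measure (P x) UNIV = 1" "emeasure (P x) UNIV = 1"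
  using prob_space.prob_space[OF prob_P[of x]] prob_space.emeasure_space_1[OF prob_P[of x]] by simp_all

lemma measurable_X[measurable]: "X t \<in> N \<rightarrow>\<^sub>M borel_pt"
  by (rule measurable_coord) simp

lemma measurable_X_P[measurable]: "X t \<in> P x \<rightarrow>\<^sub>M borel_pt"
  using measurable_X by (simp add: measurable_cong_sets[OF sets_P refl])

lemma X0: "AE \<omega> in P x. X 0 \<omega> = x"
  using hunt unfolding hunt_process_def by (elim conjE) simp

lemma measurable_nn_trans[measurable]:
  assumes [measurable]: "f \<in> borel_measurable borel"
  shows "nn_trans X P t f \<in> borel_measurable borel"
proof -
  have "(\<lambda>x. P (Some x)) \<in> borel \<rightarrow>\<^sub>M subprob_algebra N" by measurable
  moreover have "(\<lambda>\<omega>. ext0 f (X t \<omega>)) \<in> borel_measurable N" for t by measurable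
  ultimately show ?thesis unfolding nn_trans_def
    by (intro measurable_compose[OF _ nn_integral_measurable_subprob_algebra])
qed

lemma nn_trans_0: "nn_trans X P 0 f x = f x"
proof -
  have "nn_trans X P 0 f x = (\<integral>\<^sup>+\<omega>. f x \<partial>P (Some x))"
    unfolding nn_trans_def using X0[of "Some x"] by (intro nn_integral_cong_AE) auto
  then show ?thesis using prob_space.emeasure_space_1[OF prob_P[of "Some x"]] by simp
qed

lemma nn_trans_symmetric:
  assumes "t \<ge> 0" "f \<in> borel_measurable borel" "g \<in> borel_measurable borel"
  shows "(\<integral>\<^sup>+x. f x * nn_trans X P t g x \<partial>m) = (\<integral>\<^sup>+x. nn_trans X P t f x * g x \<partial>m)"
proof (cases "t = 0")
  case True then show ?thesis by (simp add: nn_trans_0)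
next
  case False
  with assms(1) have "t > 0" by simp
  with sym assms(2,3) show ?thesis unfolding m_symmetric_def by blast
qed

text \<open>By symmetry the left-hand side is \<open>\<integral> f P\<^sub>t1 dm\<close>, and \<open>P\<^sub>t1 \<le> 1\<close>.\<close>

lemma nn_trans_L1_contraction:
  assumes "t \<ge> 0" and [measurable]: "f \<in> borel_measurable borel"
  shows "(\<integral>\<^sup>+x. nn_trans X P t f x \<partial>m) \<le> (\<integral>\<^sup>+x. f x \<partial>m)"
proof -
  have le1: "nn_trans X P t (\<lambda>_. 1) x \<le> 1" for x
  proof -
    have "ext0 (\<lambda>_. 1) y \<le> (1::ennreal)" for y :: "'a option" by (cases y) auto
    then have "nn_trans X P t (\<lambda>_. 1) x \<le> (\<integral>\<^sup>+\<omega>. 1 \<partial>P (Some x))"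
      unfolding nn_trans_def by (intro nn_integral_mono)
    then show ?thesis using prob_space.emeasure_space_1[OF prob_P[of "Some x"]] by simp
  qed
  have "(\<integral>\<^sup>+x. nn_trans X P t f x \<partial>m) = (\<integral>\<^sup>+x. nn_trans X P t (\<lambda>_. 1) x * f x \<partial>m)"
    using nn_trans_symmetric[OF assms(1), of "\<lambda>_. 1" f] by simp
  also have "\<dots> \<le> (\<integral>\<^sup>+x. 1 * f x \<partial>m)" using le1 by (intro nn_integral_mono mult_right_mono) auto
  finally show ?thesis by simp
qed

lemma integrable_ext0:
  assumes [measurable]: "f \<in> borel_measurable borel" and b: "\<And>x. \<bar>f x\<bar> \<le> (M::real)"
  shows "integrable (P y) (\<lambda>\<omega>. ext0 f (X t \<omega>))"
proof -
  interpret prob_space "P y" by (rule prob_P)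
  have "\<bar>ext0 f z\<bar> \<le> \<bar>M\<bar>" for z
  proof (cases z)
    case (Some a) then show ?thesis using b[of a] by simp
  qed simp
  then have "AE \<omega> in P y. norm (ext0 f (X t \<omega>)) \<le> \<bar>M\<bar>" by simp
  then show ?thesis by (rule integrable_const_bound) measurable
qed

lemma measurable_p[measurable]:
  assumes [measurable]: "f \<in> borel_measurable borel"
  shows "p t f \<in> borel_measurable borel"
proof -
  have "(\<lambda>x. P (Some x)) \<in> borel \<rightarrow>\<^sub>M subprob_algebra N" by measurable
  moreover have "(\<lambda>\<omega>. ext0 f (X t \<omega>)) \<in> borel_measurable N" for t by measurable
  ultimately show ?thesis unfolding trans_op_def
    by (intro measurable_compose[OF _ integral_measurable_subprob_algebra])
qed

lemma p_bounded:
  assumes [measurable]: "f \<in> borel_measurable borel" and b: "\<And>x. \<bar>f x\<bar> \<le> (M::real)"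
  shows "\<bar>p t f x\<bar> \<le> M"
proof -
  interpret prob_space "P (Some x)" by (rule prob_P)
  have M: "0 \<le> M" using b[of x] by linarith
  have le: "\<bar>ext0 f z\<bar> \<le> M" for z using b M by (cases z) auto
  have "\<bar>p t f x\<bar> \<le> (\<integral>\<omega>. \<bar>ext0 f (X t \<omega>)\<bar> \<partial>P (Some x))"
    unfolding trans_op_def by (rule integral_abs_bound)
  also have "\<dots> \<le> (\<integral>\<omega>. M \<partial>P (Some x))"
    using le integrable_ext0[OF assms] by (intro integral_mono) auto
  finally show ?thesis by (simp add: prob_space)
qed

lemma p_diff:
  assumes [measurable]: "f \<in> borel_measurable borel" "g \<in> borel_measurable borel"
    and b: "\<And>x. \<bar>f x\<bar> \<le> (M::real)" "\<And>x. \<bar>g x\<bar> \<le> (M'::real)"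
  shows "p t (\<lambda>x. f x - g x) x = p t f x - p t g x"
proof -
  have "ext0 (\<lambda>x. f x - g x) z = ext0 f z - ext0 g z" for z by (cases z) auto
  then show ?thesis unfolding trans_op_def
    using integrable_ext0[OF assms(1) b(1)] integrable_ext0[OF assms(2) b(2)] by simp
qed

lemma p_nonneg: "(\<And>x. 0 \<le> f x) \<Longrightarrow> 0 \<le> p t f x"
proof -
  assume "\<And>x. 0 \<le> f x"
  then have "0 \<le> ext0 f z" for z by (cases z) auto
  then show ?thesis unfolding trans_op_def by (intro Bochner_Integration.integral_nonneg)
qed

lemma p_0: "f \<in> borel_measurable borel \<Longrightarrow> p 0 f x = f x"
proof -
  assume [measurable]: "f \<in> borel_measurable borel"
  interpret prob_space "P (Some x)" by (rule prob_P)
  have "p 0 f x = (\<integral>\<omega>. f x \<partial>P (Some x))"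
    unfolding trans_op_def using X0[of "Some x"] by (intro integral_cong_AE) auto
  then show ?thesis by (simp add: prob_space)
qed

lemma ennreal_p:
  assumes [measurable]: "f \<in> borel_measurable borel" and "\<And>x. 0 \<le> f x" "\<And>x. f x \<le> M"
  shows "ennreal (p t f x) = nn_trans X P t (\<lambda>x. ennreal (f x)) x"
proof -
  have nn: "0 \<le> ext0 f z" for z using assms by (cases z) auto
  have eq: "ext0 (\<lambda>x. ennreal (f x)) z = ennreal (ext0 f z)" for z by (cases z) auto
  have "integrable (P (Some x)) (\<lambda>\<omega>. ext0 f (X t \<omega>))"
    using assms by (intro integrable_ext0[of f M]) auto
  then show ?thesis unfolding trans_op_def nn_trans_def eq using nn by (simp add: nn_integral_eq_integral)
qed

lemma p_L1_contraction:
  assumes t: "t \<ge> 0" and f: "integrable m f" and b: "\<And>x. \<bar>f x\<bar> \<le> M"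
  shows "integrable m (p t f)" "(\<integral>x. \<bar>p t f x\<bar> \<partial>m) \<le> (\<integral>x. \<bar>f x\<bar> \<partial>m)"
proof -
  have [measurable]: "f \<in> borel_measurable borel" using borel_measurable_integrable[OF f] by simp
  have le: "\<bar>p t f x\<bar> \<le> p t (\<lambda>x. \<bar>f x\<bar>) x" for x
  proof -
    have "\<bar>p t f x\<bar> \<le> (\<integral>\<omega>. \<bar>ext0 f (X t \<omega>)\<bar> \<partial>P (Some x))"
      unfolding trans_op_def by (rule integral_abs_bound)
    moreover have "\<bar>ext0 f z\<bar> = ext0 (\<lambda>x. \<bar>f x\<bar>) z" for z by (cases z) auto
    ultimately show ?thesis by (simp add: trans_op_def)
  qed
  have "(\<integral>\<^sup>+x. ennreal \<bar>p t f x\<bar> \<partial>m) \<le> (\<integral>\<^sup>+x. nn_trans X P t (\<lambda>x. ennreal \<bar>f x\<bar>) x \<partial>m)"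
    using le b by (intro nn_integral_mono) (auto simp: ennreal_p[of "\<lambda>x. \<bar>f x\<bar>" M, symmetric] intro!: ennreal_leI)
  also have "\<dots> \<le> (\<integral>\<^sup>+x. ennreal \<bar>f x\<bar> \<partial>m)" using t by (intro nn_trans_L1_contraction) auto
  also have "\<dots> = ennreal (\<integral>x. \<bar>f x\<bar> \<partial>m)" using f by (intro nn_integral_eq_integral) auto
  finally have *: "(\<integral>\<^sup>+x. ennreal \<bar>p t f x\<bar> \<partial>m) \<le> ennreal (\<integral>x. \<bar>f x\<bar> \<partial>m)" .
  show int: "integrable m (p t f)"
    using * by (intro integrableI_bounded) (auto simp: le_less_trans)
  have "ennreal (\<integral>x. \<bar>p t f x\<bar> \<partial>m) \<le> ennreal (\<integral>x. \<bar>f x\<bar> \<partial>m)"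
    using * int by (subst nn_integral_eq_integral[symmetric]) auto
  then show "(\<integral>x. \<bar>p t f x\<bar> \<partial>m) \<le> (\<integral>x. \<bar>f x\<bar> \<partial>m)"
    by (simp add: ennreal_le_iff Bochner_Integration.integral_nonneg)
qed

lemma p_symmetric:
  assumes t: "t \<ge> 0" and h: "integrable m h" "\<And>x. 0 \<le> h x" "\<And>x. h x \<le> M"
    and g: "g \<in> borel_measurable borel" "\<And>x. 0 \<le> g x" "\<And>x. g x \<le> M'"
  shows "(\<integral>x. p t h x * g x \<partial>m) = (\<integral>x. h x * p t g x \<partial>m)"
proof -
  have hb[measurable]: "h \<in> borel_measurable borel" using borel_measurable_integrable[OF h(1)] by simp
  note g(1)[measurable]
  have "ennreal (p t h x * g x) = nn_trans X P t (\<lambda>x. ennreal (h x)) x * ennreal (g x)" for x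
    using h g by (simp add: ennreal_p[symmetric, OF hb h(2,3)] ennreal_mult p_nonneg)
  moreover have "ennreal (h x * p t g x) = ennreal (h x) * nn_trans X P t (\<lambda>x. ennreal (g x)) x" for x
    using h g by (simp add: ennreal_p[symmetric, OF g(1-3)] ennreal_mult p_nonneg)
  moreover have "(\<integral>\<^sup>+x. ennreal (h x) * nn_trans X P t (\<lambda>x. ennreal (g x)) x \<partial>m)
      = (\<integral>\<^sup>+x. nn_trans X P t (\<lambda>x. ennreal (h x)) x * ennreal (g x) \<partial>m)"
    using t by (intro nn_trans_symmetric) auto
  ultimately have "(\<integral>\<^sup>+x. ennreal (p t h x * g x) \<partial>m) = (\<integral>\<^sup>+x. ennreal (h x * p t g x) \<partial>m)" by simp
  moreover have "(\<integral>x. p t h x * g x \<partial>m) = enn2real (\<integral>\<^sup>+x. ennreal (p t h x * g x) \<partial>m)"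
    using h g by (intro integral_eq_nn_integral) (auto simp: p_nonneg intro!: AE_I2)
  moreover have "(\<integral>x. h x * p t g x \<partial>m) = enn2real (\<integral>\<^sup>+x. ennreal (h x * p t g x) \<partial>m)"
    using h g by (intro integral_eq_nn_integral) (auto simp: p_nonneg intro!: AE_I2)
  ultimately show ?thesis by simp
qed

end

locale feller_space = hunt_space +
  assumes feller: "feller_semigroup (trans_op X P)"
begin

lemma p_C_infty: "t \<ge> 0 \<Longrightarrow> f \<in> C_infty \<Longrightarrow> p t f \<in> C_infty"
proof (cases "t = 0")
  case True
  assume "f \<in> C_infty"
  moreover from this have "p t f = f" using True p_0[OF C_infty_borel] by auto
  ultimately show ?thesis by simp
next
  case False
  assume "0 \<le> t" "f \<in> C_infty"
  then show ?thesis using False feller unfolding feller_semigroup_def by (elim conjE) simp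
qed

lemma p_semigroup:
  assumes "s \<ge> 0" "t \<ge> 0" "f \<in> C_infty"
  shows "p (s + t) f x = p s (p t f) x"
proof -
  consider "s = 0" | "t = 0" | "s > 0" "t > 0" using assms by linarith
  then show ?thesis
  proof cases
    case 1 then show ?thesis using p_0[OF C_infty_borel[OF p_C_infty[OF assms(2,3)]]] by simp
  next
    case 2
    have "p 0 f = f" using p_0[OF C_infty_borel[OF assms(3)]] by auto
    then show ?thesis using 2 by simp
  next
    case 3
    have "\<forall>s>0. \<forall>t>0. \<forall>f\<in>C_infty. p (s + t) f = p s (p t f)"
      using feller unfolding feller_semigroup_def by (elim conjE)
    then show ?thesis using 3 assms(3) by simp
  qed
qed

lemma p_near_0:
  assumes f: "f \<in> C_infty" and e: "e > 0"
  shows "\<exists>d>0. \<forall>t x. 0 \<le> t \<and> t \<le> d \<longrightarrow> \<bar>p t f x - f x\<bar> \<le> e"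
proof -
  have "((\<lambda>t. sup_norm (\<lambda>x. p t f x - f x)) \<longlongrightarrow> 0) (at_right 0)"
    using feller f unfolding feller_semigroup_def by (elim conjE) simp
  then have "eventually (\<lambda>t. sup_norm (\<lambda>x. p t f x - f x) < e) (at_right 0)"
    using e by (rule order_tendstoD)
  then obtain b where b: "b > 0" "\<And>t. 0 < t \<Longrightarrow> t < b \<Longrightarrow> sup_norm (\<lambda>x. p t f x - f x) < e"
    unfolding eventually_at_right_field by blast
  have "\<bar>p t f x - f x\<bar> \<le> e" if "0 \<le> t" "t \<le> b / 2" for t x
  proof (cases "t = 0")
    case True then show ?thesis using p_0[OF C_infty_borel[OF f]] e by simp
  next
    case False
    then have "sup_norm (\<lambda>x. p t f x - f x) < e" using that b by (intro b(2)) auto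
    moreover have "\<bar>p t f x - f x\<bar> \<le> sup_norm (\<lambda>x. p t f x - f x)"
      using that by (intro sup_norm_upper C_infty_diff p_C_infty f)
    ultimately show ?thesis by linarith
  qed
  then show ?thesis using b(1) by (intro exI[of _ "b / 2"]) auto
qed

lemma p_time_increment:
  assumes f: "f \<in> C_infty" and s: "s \<ge> 0" "t \<ge> 0" and le: "\<And>x. \<bar>p t f x - f x\<bar> \<le> e"
  shows "\<bar>p (s + t) f x - p s f x\<bar> \<le> e"
proof -
  have pf: "p t f \<in> C_infty" using s f by (intro p_C_infty)
  obtain M where M: "\<And>x. \<bar>f x\<bar> \<le> M" using C_infty_bounded[OF f] by auto
  have [measurable]: "f \<in> borel_measurable borel" using C_infty_borel[OF f] .
  have "p (s + t) f x - p s f x = p s (\<lambda>x. p t f x - f x) x"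
    using p_semigroup[OF s f] M by (subst p_diff[where M=M and M'=M]) (auto simp: p_bounded)
  then show ?thesis using le p_bounded[of "\<lambda>x. p t f x - f x" e s x] by simp
qed

text \<open>Each \<open>P\<^sub>tf\<close> is continuous in space, and the modulus of continuity in time is uniform in space.
  Negative times are read as \<open>0\<close>, so that the function is defined on the whole line.\<close>

lemma p_jointly_continuous:
  assumes f: "f \<in> C_infty"
  shows "continuous_on UNIV (\<lambda>z. p (max (fst z) 0) f (snd z))"
proof (subst continuous_on_iff, intro ballI allI impI)
  fix z :: "real \<times> 'a" and e :: real assume e: "0 < e"
  obtain t x where z: "z = (t, x)" by (cases z)
  obtain d where d: "d > 0" "\<And>t x. 0 \<le> t \<Longrightarrow> t \<le> d \<Longrightarrow> \<bar>p t f x - f x\<bar> \<le> e / 2"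
    using p_near_0[OF f, of "e / 2"] e by auto
  have time: "\<bar>p a f y - p b f y\<bar> \<le> e / 2" if "0 \<le> a" "a \<le> b" "b - a \<le> d" for a b y
    using p_time_increment[OF f that(1), of "b - a" "e / 2" y] d(2)[of "b - a"] that by (simp add: abs_minus_commute)
  have "continuous_on UNIV (p (max t 0) f)" using f by (intro C_infty_continuous p_C_infty) auto
  then obtain d' where d': "d' > 0" "\<And>y. dist y x < d' \<Longrightarrow> dist (p (max t 0) f y) (p (max t 0) f x) < e / 2"
    using e unfolding continuous_on_iff by (metis UNIV_I half_gt_zero)
  have "dist (p (max (fst z') 0) f (snd z')) (p (max (fst z) 0) f (snd z)) < e"
    if "dist z' z < min d d'" for z'
  proof -
    obtain s y where z': "z' = (s, y)" by (cases z')
    have 1: "\<bar>s - t\<bar> < d" "dist y x < d'"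
      using that dist_fst_le[of z' z] dist_snd_le[of z' z] by (auto simp: z z' dist_real_def)
    have "\<bar>p (max s 0) f y - p (max t 0) f y\<bar> \<le> e / 2"
    proof (cases "s \<le> t")
      case True then show ?thesis using 1 by (intro time) auto
    next
      case False
      then have "\<bar>p (max t 0) f y - p (max s 0) f y\<bar> \<le> e / 2" using 1 by (intro time) auto
      then show ?thesis by (simp add: abs_minus_commute)
    qed
    then show ?thesis using d'(2)[OF 1(2)] unfolding z z' dist_real_def fst_conv snd_conv by linarith
  qed
  then show "\<exists>d>0. \<forall>z'\<in>UNIV. dist z' z < d \<longrightarrow>
      dist (p (max (fst z') 0) f (snd z')) (p (max (fst z) 0) f (snd z)) < e"
    using d d' by (intro exI[of _ "min d d'"]) auto
qed

lemma measurable_p_joint: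
  "f \<in> C_infty \<Longrightarrow> (\<lambda>z. p (max (fst z) 0) f (snd z)) \<in> borel_measurable (borel \<Otimes>\<^sub>M borel)"
  unfolding borel_prod by (intro borel_measurable_continuous_onI p_jointly_continuous)

lemma measurable_p_joint'[measurable (raw)]:
  assumes "f \<in> C_infty" "g \<in> M \<rightarrow>\<^sub>M borel" "k \<in> M \<rightarrow>\<^sub>M borel"
  shows "(\<lambda>z. p (max (g z) 0) f (k z)) \<in> borel_measurable M"
  using measurable_compose[OF measurable_Pair[OF assms(2,3)] measurable_p_joint[OF assms(1)]] by simp

text \<open>Scheffe's argument: \<open>P\<^sub>tf\<close> has at most the mass of \<open>f\<close>, so the distance in \<open>L\<^sup>1\<close> is at most
  twice the integral of the positive part of \<open>f - P\<^sub>tf\<close>, which is dominated by \<open>f\<close>.\<close>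

lemma p_L1_near_0:
  assumes f: "f \<in> C_infty" "integrable m f" "\<And>x. 0 \<le> f x"
  shows "((\<lambda>t. \<integral>x. \<bar>p t f x - f x\<bar> \<partial>m) \<longlongrightarrow> 0) (at_right 0)"
proof (rule tendsto_at_right_sequentially[where b=1])
  fix S :: "nat \<Rightarrow> real" assume S: "\<And>n. 0 < S n" "S \<longlonglongrightarrow> 0"
  obtain M where M: "\<And>x. \<bar>f x\<bar> \<le> M" using C_infty_bounded[OF f(1)] by auto
  have [measurable]: "f \<in> borel_measurable borel" using C_infty_borel[OF f(1)] .
  have intp: "integrable m (p (S n) f)" for n using p_L1_contraction(1)[OF _ f(2) M] S(1)[of n] by simp
  have lim: "(\<lambda>n. p (S n) f x) \<longlonglongrightarrow> f x" for x
  proof (rule LIMSEQ_I)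
    fix r :: real assume "0 < r"
    then obtain d where d: "d > 0" "\<And>t x. 0 \<le> t \<Longrightarrow> t \<le> d \<Longrightarrow> \<bar>p t f x - f x\<bar> \<le> r / 2"
      using p_near_0[OF f(1), of "r / 2"] by auto
    have "\<forall>\<^sub>F n in sequentially. S n < d" using S(2) d(1) by (rule order_tendstoD)
    then obtain N where "\<And>n. n \<ge> N \<Longrightarrow> S n < d" by (auto simp: eventually_sequentially)
    then have "norm (p (S n) f x - f x) < r" if "n \<ge> N" for n
      using d(2)[of "S n" x] S(1)[of n] that \<open>0 < r\<close> by fastforce
    then show "\<exists>N. \<forall>n\<ge>N. norm (p (S n) f x - f x) < r" by blast
  qed
  have "(\<lambda>n. \<integral>x. max (f x - p (S n) f x) 0 \<partial>m) \<longlonglongrightarrow> (\<integral>x. 0 \<partial>m)"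
  proof (rule integral_dominated_convergence[where w=f])
    show "AE x in m. (\<lambda>n. max (f x - p (S n) f x) 0) \<longlonglongrightarrow> 0"
    proof (rule AE_I2)
      fix x
      have "(\<lambda>n. max (f x - p (S n) f x) 0) \<longlonglongrightarrow> max (f x - f x) 0"
        by (intro tendsto_max tendsto_diff tendsto_const lim)
      then show "(\<lambda>n. max (f x - p (S n) f x) 0) \<longlonglongrightarrow> 0" by simp
    qed
    show "AE x in m. norm (max (f x - p (S n) f x) 0) \<le> f x" for n
      using f(3) p_nonneg[of f "S n"] by (intro AE_I2) (auto simp: max_def)
  qed (use f in auto)
  then have "(\<lambda>n. 2 * (\<integral>x. max (f x - p (S n) f x) 0 \<partial>m)) \<longlonglongrightarrow> 2 * 0" by (intro tendsto_mult) auto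
  moreover have "(\<integral>x. \<bar>p (S n) f x - f x\<bar> \<partial>m) \<le> 2 * (\<integral>x. max (f x - p (S n) f x) 0 \<partial>m)" for n
  proof -
    have i: "integrable m (\<lambda>x. max (f x - p (S n) f x) 0)"
      using f(2) intp by (intro Bochner_Integration.integrable_max) auto
    have "(\<integral>x. \<bar>p (S n) f x - f x\<bar> \<partial>m) = (\<integral>x. (p (S n) f x - f x) + 2 * max (f x - p (S n) f x) 0 \<partial>m)"
      by (intro Bochner_Integration.integral_cong) (auto simp: max_def)
    also have "\<dots> = ((\<integral>x. p (S n) f x \<partial>m) - (\<integral>x. f x \<partial>m)) + 2 * (\<integral>x. max (f x - p (S n) f x) 0 \<partial>m)"
      using f(2) intp i by simp
    also have "(\<integral>x. p (S n) f x \<partial>m) \<le> (\<integral>x. f x \<partial>m)"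
      using p_L1_contraction(2)[OF _ f(2) M, of "S n"] S(1)[of n] f(3) p_nonneg[of f "S n"] by simp
    finally show ?thesis by simp
  qed
  ultimately show "(\<lambda>n. \<integral>x. \<bar>p (S n) f x - f x\<bar> \<partial>m) \<longlonglongrightarrow> 0"
    by (intro tendsto_sandwich[of "\<lambda>_. 0" "\<lambda>n. \<integral>x. \<bar>p (S n) f x - f x\<bar> \<partial>m" sequentially
          "\<lambda>n. 2 * (\<integral>x. max (f x - p (S n) f x) 0 \<partial>m)"] always_eventually allI) auto
qed simp

end

section \<open>Dirichlet forms and sets of zero capacity\<close>

lemma L2_mult_integrable:
  assumes "f \<in> L2 M" "g \<in> L2 M" shows "integrable M (\<lambda>x. f x * g x)"
proof -
  have [measurable]: "f \<in> borel_measurable M" "g \<in> borel_measurable M" using assms by (auto simp: L2_def)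
  have "integrable M (\<lambda>x. (f x)\<^sup>2 + (g x)\<^sup>2)" using assms by (auto simp: L2_def)
  then show ?thesis
  proof (rule Bochner_Integration.integrable_bound)
    have "\<bar>a * b\<bar> \<le> a\<^sup>2 + b\<^sup>2" for a b :: real
    proof -
      have "2 * \<bar>a\<bar> * \<bar>b\<bar> \<le> a\<^sup>2 + b\<^sup>2" using sum_squares_bound[of "\<bar>a\<bar>" "\<bar>b\<bar>"] by simp
      moreover have "0 \<le> \<bar>a\<bar> * \<bar>b\<bar>" by simp
      ultimately show ?thesis unfolding abs_mult by linarith
    qed
    then show "AE x in M. norm (f x * g x) \<le> norm ((f x)\<^sup>2 + (g x)\<^sup>2)" by simp
  qed measurable
qed

locale form_space = radon_space m
  for m :: "'a::{metric_space, second_countable_topology} measure" +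
  fixes F :: "('a \<Rightarrow> real) set" and E :: "'a bilin"
  assumes dir: "dirichlet_form m F E"
begin

lemma dirichlet_form_parts:
  shows "F \<subseteq> L2 m" and "(\<lambda>_. 0) \<in> F"
    and "\<forall>f\<in>F. \<forall>g\<in>F. \<forall>a b. (\<lambda>x. a * f x + b * g x) \<in> F"
    and "\<forall>f\<in>F. \<forall>g\<in>F. E f g = E g f"
    and "\<forall>f\<in>F. \<forall>g\<in>F. \<forall>h\<in>F. \<forall>a b. E (\<lambda>x. a * f x + b * g x) h = a * E f h + b * E g h"
    and "\<forall>f\<in>F. E f f \<ge> 0"
    and "\<forall>u. (\<forall>n. u n \<in> F) \<and>
          (\<forall>\<epsilon>>0. \<exists>N. \<forall>i\<ge>N. \<forall>j\<ge>N.
             E1 m E (\<lambda>x. u i x - u j x) (\<lambda>x. u i x - u j x) < \<epsilon>) \<longrightarrow>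
          (\<exists>v\<in>F. (\<lambda>n::nat. E1 m E (\<lambda>x. u n x - v x) (\<lambda>x. u n x - v x)) \<longlonglongrightarrow> 0)"
    and "\<forall>f\<in>F. (\<lambda>x. min (max (f x) 0) 1) \<in> F \<and>
        E (\<lambda>x. min (max (f x) 0) 1) (\<lambda>x. min (max (f x) 0) 1) \<le> E f f"
  using dir unfolding dirichlet_form_def by - ((elim conjE, assumption)+)

lemma F_L2: "f \<in> F \<Longrightarrow> f \<in> L2 m"
  using dirichlet_form_parts(1) by (rule subsetD)

lemma F_borel: "f \<in> F \<Longrightarrow> f \<in> borel_measurable borel"
  using F_L2[of f] by (simp add: L2_def measurable_cong_sets[OF sets_m refl])

lemma F_mult_integrable: "f \<in> F \<Longrightarrow> g \<in> F \<Longrightarrow> integrable m (\<lambda>x. f x * g x)"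
  by (intro L2_mult_integrable F_L2)

lemma F_lincomb: "f \<in> F \<Longrightarrow> g \<in> F \<Longrightarrow> (\<lambda>x. a * f x + b * g x) \<in> F"
  using dirichlet_form_parts(3) by blast

lemma F_diff: "f \<in> F \<Longrightarrow> g \<in> F \<Longrightarrow> (\<lambda>x. f x - g x) \<in> F"
  using F_lincomb[of f g 1 "-1"] by simp

lemma F_add: "f \<in> F \<Longrightarrow> g \<in> F \<Longrightarrow> (\<lambda>x. f x + g x) \<in> F"
  using F_lincomb[of f g 1 1] by simp

lemma F_scale: "f \<in> F \<Longrightarrow> (\<lambda>x. c * f x) \<in> F"
  using F_lincomb[of f f c 0] by simp

lemma E_sym: "f \<in> F \<Longrightarrow> g \<in> F \<Longrightarrow> E f g = E g f"
  using dirichlet_form_parts(4) by blast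

lemma E_lincomb:
  "f \<in> F \<Longrightarrow> g \<in> F \<Longrightarrow> h \<in> F \<Longrightarrow> E (\<lambda>x. a * f x + b * g x) h = a * E f h + b * E g h"
  using dirichlet_form_parts(5) by blast

lemma E_nonneg: "f \<in> F \<Longrightarrow> 0 \<le> E f f"
  using dirichlet_form_parts(6) by blast

lemma unit_contraction:
  assumes "f \<in> F"
  shows "(\<lambda>x. min (max (f x) 0) 1) \<in> F"
    and "E (\<lambda>x. min (max (f x) 0) 1) (\<lambda>x. min (max (f x) 0) 1) \<le> E f f"
  using dirichlet_form_parts(8) assms by blast+

lemma E1_closed:
  assumes "\<And>n. u n \<in> F"
    and "\<And>e. e > 0 \<Longrightarrow> \<exists>N. \<forall>i\<ge>N. \<forall>j\<ge>N. E1 m E (\<lambda>x. u i x - u j x) (\<lambda>x. u i x - u j x) < e"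
  shows "\<exists>v\<in>F. (\<lambda>n::nat. E1 m E (\<lambda>x. u n x - v x) (\<lambda>x. u n x - v x)) \<longlonglongrightarrow> 0"
proof -
  have "(\<forall>n. u n \<in> F) \<and> (\<forall>e>0. \<exists>N. \<forall>i\<ge>N. \<forall>j\<ge>N.
      E1 m E (\<lambda>x. u i x - u j x) (\<lambda>x. u i x - u j x) < e)" using assms by blast
  then show ?thesis by (rule dirichlet_form_parts(7)[rule_format])
qed

lemma E1_sym: "f \<in> F \<Longrightarrow> g \<in> F \<Longrightarrow> E1 m E f g = E1 m E g f"
  by (simp add: E1_def E_sym mult.commute)

lemma E1_lincomb:
  assumes "f \<in> F" "g \<in> F" "h \<in> F"
  shows "E1 m E (\<lambda>x. a * f x + b * g x) h = a * E1 m E f h + b * E1 m E g h"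
proof -
  have "(\<integral>x. (a * f x + b * g x) * h x \<partial>m) = (\<integral>x. a * (f x * h x) + b * (g x * h x) \<partial>m)"
    by (simp add: algebra_simps)
  also have "\<dots> = a * (\<integral>x. f x * h x \<partial>m) + b * (\<integral>x. g x * h x \<partial>m)"
    using F_mult_integrable assms by simp
  finally show ?thesis using E_lincomb[OF assms, of a b] by (simp add: E1_def algebra_simps)
qed

lemma E1_diff: "f \<in> F \<Longrightarrow> g \<in> F \<Longrightarrow> h \<in> F \<Longrightarrow> E1 m E (\<lambda>x. f x - g x) h = E1 m E f h - E1 m E g h"
  using E1_lincomb[of f g h 1 "-1"] by simp

lemma E1_scale: "f \<in> F \<Longrightarrow> E1 m E (\<lambda>x. c * f x) (\<lambda>x. c * f x) = c\<^sup>2 * E1 m E f f"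
  using E1_lincomb[of f f "\<lambda>x. c * f x" c 0] E1_lincomb[of f f f c 0]
    E1_sym[of f "\<lambda>x. c * f x"] F_scale[of f c] by (simp add: power2_eq_square)

lemma L2_norm_le_E1: "f \<in> F \<Longrightarrow> (\<integral>x. (f x)\<^sup>2 \<partial>m) \<le> E1 m E f f"
  by (simp add: E1_def E_nonneg power2_eq_square)

lemma E1_nonneg: "f \<in> F \<Longrightarrow> 0 \<le> E1 m E f f"
  by (rule order_trans[OF Bochner_Integration.integral_nonneg L2_norm_le_E1]) simp_all

lemma E1_quadratic:
  assumes f: "f \<in> F" and g: "g \<in> F"
  shows "E1 m E (\<lambda>x. a * f x + b * g x) (\<lambda>x. a * f x + b * g x)
    = a\<^sup>2 * E1 m E f f + 2 * a * b * E1 m E f g + b\<^sup>2 * E1 m E g g"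
proof -
  let ?h = "\<lambda>x. a * f x + b * g x"
  have h: "?h \<in> F" using F_lincomb[OF f g] .
  have "E1 m E ?h ?h = a * E1 m E f ?h + b * E1 m E g ?h" using E1_lincomb[OF f g h] .
  also have "E1 m E f ?h = a * E1 m E f f + b * E1 m E f g"
    using E1_sym[OF f h] E1_lincomb[OF f g f, of a b] E1_sym[OF f g] by simp
  also have "E1 m E g ?h = a * E1 m E f g + b * E1 m E g g"
    using E1_sym[OF g h] E1_lincomb[OF f g g, of a b] by simp
  finally show ?thesis by (simp add: algebra_simps power2_eq_square)
qed

lemma E1_Cauchy_Schwarz:
  assumes f: "f \<in> F" and g: "g \<in> F"
  shows "(E1 m E f g)\<^sup>2 \<le> E1 m E f f * E1 m E g g"
proof -
  define A B C where "A = E1 m E f f" "B = E1 m E f g" "C = E1 m E g g"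
  have q: "0 \<le> a\<^sup>2 * A + 2 * a * b * B + b\<^sup>2 * C" for a b
    using E1_quadratic[OF f g, of a b] E1_nonneg[OF F_lincomb[OF f g], of a b] by (simp add: A_B_C_def)
  have AC: "0 \<le> A" "0 \<le> C" using E1_nonneg f g by (auto simp: A_B_C_def)
  have "B\<^sup>2 \<le> A * C"
  proof (cases "C = 0")
    case True
    have "B = 0"
    proof (rule ccontr)
      assume "B \<noteq> 0"
      have "0 \<le> A + 2 * (- (A + 1) / (2 * B)) * B" using q[of 1 "- (A + 1) / (2 * B)"] True by simp
      also have "\<dots> = -1" using \<open>B \<noteq> 0\<close> by (simp add: field_simps)
      finally show False by simp
    qed
    then show ?thesis using True by simp
  next
    case False
    then have "C > 0" using AC by simp
    have "0 \<le> C\<^sup>2 * A + 2 * C * (- B) * B + (- B)\<^sup>2 * C" using q[of C "- B"] .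
    also have "\<dots> = C * (A * C - B\<^sup>2)" by (simp add: power2_eq_square algebra_simps)
    finally show ?thesis using \<open>C > 0\<close> by (simp add: zero_le_mult_iff)
  qed
  then show ?thesis by (simp add: A_B_C_def)
qed

lemma cap_zeroD:
  assumes "cap m F E N = 0" "(e::real) > 0"
  obtains A u where "open A" "N \<subseteq> A" "u \<in> F" "AE x in m. x \<in> A \<longrightarrow> 1 \<le> u x" "E1 m E u u < e"
proof -
  have "cap m F E N < ennreal e" using assms by simp
  then obtain A where A: "open A" "N \<subseteq> A" "cap_open m F E A < ennreal e"
    unfolding cap_def INF_less_iff by blast
  then obtain u where u: "u \<in> F" "AE x in m. x \<in> A \<longrightarrow> 1 \<le> u x" "ennreal (E1 m E u u) < ennreal e"
    unfolding cap_open_def INF_less_iff by blast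
  then show ?thesis using A that[of A u] assms(2) by (simp add: ennreal_less_iff E1_nonneg)
qed

lemma cap_zeroI:
  assumes "\<And>e::real. e > 0 \<Longrightarrow> \<exists>A u. open A \<and> N \<subseteq> A \<and> u \<in> F \<and> (AE x in m. x \<in> A \<longrightarrow> 1 \<le> u x) \<and> E1 m E u u \<le> e"
  shows "cap m F E N = 0"
proof -
  have "cap m F E N \<le> 0"
  proof (rule ennreal_le_epsilon)
    fix e :: real assume "0 < e"
    obtain A u where A: "open A" "N \<subseteq> A" "u \<in> F" "AE x in m. x \<in> A \<longrightarrow> 1 \<le> u x" "E1 m E u u \<le> e"
      using assms[OF \<open>e > 0\<close>] by blast
    have "cap m F E N \<le> cap_open m F E A" unfolding cap_def using A by (intro INF_lower) auto
    also have "\<dots> \<le> ennreal (E1 m E u u)" unfolding cap_open_def using A by (intro INF_lower) auto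
    also have "\<dots> \<le> ennreal e" using A by (intro ennreal_leI)
    finally show "cap m F E N \<le> 0 + ennreal e" by simp
  qed
  then show ?thesis by simp
qed

lemma cap_zero_mono: "cap m F E N = 0 \<Longrightarrow> M \<subseteq> N \<Longrightarrow> cap m F E M = 0"
proof -
  assume N: "cap m F E N = 0" and "M \<subseteq> N"
  have "cap m F E M \<le> cap m F E N"
    unfolding cap_def using \<open>M \<subseteq> N\<close> by (intro INF_superset_mono) auto
  with N show ?thesis by simp
qed

lemma cap_empty: "cap m F E {} = 0"
proof (rule cap_zeroI)
  fix e :: real assume "e > 0"
  note z = dirichlet_form_parts(2)
  have "E (\<lambda>_. 0) (\<lambda>_. 0) = 0" using E_lincomb[OF z z z, of 0 0] by simp
  then show "\<exists>A u. open A \<and> {} \<subseteq> A \<and> u \<in> F \<and> (AE x in m. x \<in> A \<longrightarrow> 1 \<le> u x) \<and> E1 m E u u \<le> e"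
    using z \<open>e > 0\<close> by (intro exI[of _ "{}"] exI[of _ "\<lambda>_. 0"]) (auto simp: E1_def)
qed

text \<open>If \<open>1 \<le> u\<close> on \<open>A\<close>, then \<open>m(A) \<le> \<integral> u\<^sup>2 dm \<le> \<E>\<^sub>1(u, u)\<close>.\<close>

lemma cap_zero_null:
  assumes "cap m F E N = 0" shows "\<exists>B\<in>null_sets m. N \<subseteq> B"
proof -
  have "\<exists>A. open A \<and> N \<subseteq> A \<and> emeasure m A \<le> ennreal (1 / Suc n)" for n
  proof -
    obtain A u where A: "open A" "N \<subseteq> A" "u \<in> F" "AE x in m. x \<in> A \<longrightarrow> 1 \<le> u x" "E1 m E u u < 1 / Suc n"
      using cap_zeroD[OF assms, of "1 / Suc n"] by auto
    have [measurable]: "u \<in> borel_measurable borel" "A \<in> sets borel" using A F_borel by auto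
    have int: "integrable m (\<lambda>x. (u x)\<^sup>2)" using F_L2[OF A(3)] by (simp add: L2_def)
    have "emeasure m A = (\<integral>\<^sup>+x. indicator A x \<partial>m)" by simp
    also have "\<dots> \<le> (\<integral>\<^sup>+x. ennreal ((u x)\<^sup>2) \<partial>m)"
    proof (rule nn_integral_mono_AE)
      show "AE x in m. indicator A x \<le> ennreal ((u x)\<^sup>2)"
        using A(4)
      proof eventually_elim
        case (elim x)
        show ?case
        proof (cases "x \<in> A")
          case True
          then have "1 \<le> (u x)\<^sup>2" using elim by (simp add: one_le_power)
          then show ?thesis by (auto simp: ennreal_1[symmetric] simp del: ennreal_1 intro!: ennreal_leI split: split_indicator)
        qed simp
      qed
    qed
    also have "\<dots> = ennreal (\<integral>x. (u x)\<^sup>2 \<partial>m)" using int by (intro nn_integral_eq_integral) auto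
    also have "\<dots> \<le> ennreal (1 / Suc n)" using L2_norm_le_E1[OF A(3)] A(5) by (intro ennreal_leI) linarith
    finally show ?thesis using A by blast
  qed
  then obtain A where A: "\<And>n. open (A n)" "\<And>n. N \<subseteq> A n" "\<And>n. emeasure m (A n) \<le> ennreal (1 / Suc n)" by metis
  have [measurable]: "(\<Inter>n. A n) \<in> sets borel" using A(1) by (intro sets.countable_INT'') auto
  have "emeasure m (\<Inter>n. A n) \<le> 0"
  proof (rule ennreal_le_epsilon)
    fix e :: real assume "0 < e"
    obtain n where n: "1 / Suc n < e" using nat_approx_posE[OF \<open>e > 0\<close>] by auto
    have "emeasure m (\<Inter>n. A n) \<le> emeasure m (A n)" using A(1) by (intro emeasure_mono) auto
    also have "\<dots> \<le> ennreal e" using A(3)[of n] ennreal_leI[of "1 / Suc n" e] n by (auto intro: order_trans)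
    finally show "emeasure m (\<Inter>n. A n) \<le> 0 + ennreal e" by simp
  qed
  then have "(\<Inter>n. A n) \<in> null_sets m" by (simp add: null_sets_def)
  moreover have "N \<subseteq> (\<Inter>n. A n)" using A(2) by (intro INT_greatest)
  ultimately show ?thesis by (rule bexI[rotated])
qed

lemma E1_unit_contraction:
  assumes w: "w \<in> F"
  shows "E1 m E (\<lambda>x. min (max (w x) 0) 1) (\<lambda>x. min (max (w x) 0) 1) \<le> E1 m E w w"
proof -
  let ?c = "\<lambda>x. min (max (w x) 0) (1::real)"
  have "(\<integral>x. ?c x * ?c x \<partial>m) \<le> (\<integral>x. w x * w x \<partial>m)"
    using F_mult_integrable[OF w w] F_mult_integrable[OF unit_contraction(1)[OF w] unit_contraction(1)[OF w]]
  proof (intro integral_mono)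
    fix x show "?c x * ?c x \<le> w x * w x"
      unfolding power2_eq_square[symmetric] abs_le_square_iff[symmetric] by auto
  qed auto
  then show ?thesis unfolding E1_def using unit_contraction(2)[OF w] by linarith
qed

text \<open>Sum the truncations to \<open>[0,1]\<close> of the two competitors; truncation keeps the sum at least \<open>1\<close> on
  the union, and the parallelogram law bounds its energy.\<close>

lemma cap_zero_Un:
  assumes "cap m F E M = 0" "cap m F E N = 0" shows "cap m F E (M \<union> N) = 0"
proof (rule cap_zeroI)
  fix e :: real assume "e > 0"
  let ?c = "\<lambda>u x. min (max (u x) 0) (1::real)"
  obtain A u where A: "open A" "M \<subseteq> A" "u \<in> F" "AE x in m. x \<in> A \<longrightarrow> 1 \<le> u x" "E1 m E u u < e / 4"
    using cap_zeroD[OF assms(1), of "e / 4"] \<open>e > 0\<close> by auto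
  obtain B v where B: "open B" "N \<subseteq> B" "v \<in> F" "AE x in m. x \<in> B \<longrightarrow> 1 \<le> v x" "E1 m E v v < e / 4"
    using cap_zeroD[OF assms(2), of "e / 4"] \<open>e > 0\<close> by auto
  note contr = unit_contraction(1) E1_unit_contraction
  define w where "w x = ?c u x + ?c v x" for x
  have wF: "w \<in> F" unfolding w_def using contr A B by (intro F_add) auto
  have "0 \<le> E1 m E (\<lambda>x. 1 * ?c u x + (-1) * ?c v x) (\<lambda>x. 1 * ?c u x + (-1) * ?c v x)"
    by (intro E1_nonneg F_lincomb contr A B)
  then have "E1 m E w w \<le> 2 * E1 m E (?c u) (?c u) + 2 * E1 m E (?c v) (?c v)"
    using E1_quadratic[OF contr(1)[OF A(3)] contr(1)[OF B(3)], of 1 1]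
      E1_quadratic[OF contr(1)[OF A(3)] contr(1)[OF B(3)], of 1 "-1"] by (simp add: w_def[abs_def])
  also have "\<dots> \<le> e" using contr(2)[OF A(3)] contr(2)[OF B(3)] A(5) B(5) by linarith
  finally have le: "E1 m E w w \<le> e" .
  have "AE x in m. x \<in> A \<union> B \<longrightarrow> 1 \<le> w x"
    using A(4) B(4) by eventually_elim (auto simp: w_def)
  then show "\<exists>C u. open C \<and> M \<union> N \<subseteq> C \<and> u \<in> F \<and> (AE x in m. x \<in> C \<longrightarrow> 1 \<le> u x) \<and> E1 m E u u \<le> e"
    using A B wF le by (intro exI[of _ "A \<union> B"] exI[of _ w]) auto
qed

end

section \<open>The resolvent of a Feller process\<close>

text \<open>The resolvent is written with the exponential law of rate \<open>\<alpha>\<close>, so that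
  \<open>\<alpha> R\<^sub>\<alpha> h\<close> is an average of \<open>P\<^sub>t h\<close> over a probability measure.\<close>

abbreviation expo :: "real \<Rightarrow> real measure" where
  "expo \<alpha> \<equiv> density lborel (exponential_density \<alpha>)"

lemma AE_expo_pos: "AE t in expo \<alpha>. 0 < t"
proof -
  have "AE t in lborel. t \<noteq> (0::real)" by (rule AE_lborel_singleton)
  then have "AE t in lborel. 0 < ennreal (exponential_density \<alpha> t) \<longrightarrow> 0 < t"
    by eventually_elim (auto simp: exponential_density_def)
  then show ?thesis by (subst AE_density) auto
qed

lemma expo_tail:
  assumes "\<alpha> > 0" "t \<ge> 0" shows "measure (expo \<alpha>) {t<..} = exp (- \<alpha> * t)"
proof -
  interpret prob_space "expo \<alpha>" using assms(1) by (rule prob_space_exponential_density)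
  have "distributed (expo \<alpha>) lborel (\<lambda>x. x) (exponential_density \<alpha>)"
    unfolding distributed_def by (auto simp: exponential_density_nonneg assms distr_id2)
  from exponential_distributedD_gt[OF this assms(2,1)] show ?thesis
    by (simp add: greaterThan_def mult.commute)
qed

lemma expo_memoryless:
  fixes k :: "real \<Rightarrow> real"
  assumes [measurable]: "k \<in> borel_measurable borel" and a: "\<alpha> > 0" and t: "t \<ge> 0"
  shows "(\<integral>s. k (s + t) \<partial>expo \<alpha>) = exp (\<alpha> * t) * (\<integral>s. indicator {t..} s * k s \<partial>expo \<alpha>)"
proof -
  have nn: "0 \<le> exponential_density \<alpha> s" for s using a by (rule exponential_density_nonneg)
  have "(\<integral>s. k (s + t) \<partial>expo \<alpha>) = (\<integral>s. exponential_density \<alpha> s * k (s + t) \<partial>lborel)"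
    using nn by (subst integral_density) auto
  also have "\<dots> = (\<integral>s. exponential_density \<alpha> (s - t) * k s \<partial>lborel)"
    using lborel_integral_real_affine[of 1 "\<lambda>s. exponential_density \<alpha> (s - t) * k s" t] by (simp add: add.commute)
  also have "\<dots> = (\<integral>s. exp (\<alpha> * t) * (exponential_density \<alpha> s * (indicator {t..} s * k s)) \<partial>lborel)"
    using t by (intro Bochner_Integration.integral_cong)
      (auto simp: exponential_density_def exp_add[symmetric] exp_minus field_simps split: split_indicator)
  also have "\<dots> = exp (\<alpha> * t) * (\<integral>s. indicator {t..} s * k s \<partial>expo \<alpha>)"
    using nn by (subst integral_density) auto
  finally show ?thesis .
qed

lemma expo_head:
  assumes a: "\<alpha> > 0" and t: "t \<ge> 0"
  shows "(\<integral>s. indicator {..<t} s * (1::real) \<partial>expo \<alpha>) = 1 - exp (- \<alpha> * t)"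
proof -
  interpret prob_space "expo \<alpha>" using a by (rule prob_space_exponential_density)
  have [simp]: "prob UNIV = 1" using prob_space by simp
  have "AE s in lborel. s \<noteq> t" by (rule AE_lborel_singleton)
  then have ne: "AE s in expo \<alpha>. s \<noteq> t" by (subst AE_density) auto
  have "(\<integral>s. indicator {..<t} s * (1::real) \<partial>expo \<alpha>) = (\<integral>s. (1::real) - indicator {t<..} s \<partial>expo \<alpha>)"
    using ne by (intro integral_cong_AE) (auto split: split_indicator)
  also have "\<dots> = 1 - measure (expo \<alpha>) {t<..}"
    by (subst Bochner_Integration.integral_diff) (auto simp: prob_space emeasure_eq_measure less_top[symmetric])
  finally show ?thesis using expo_tail[OF a t] by simp
qed

text \<open>The density of the exponential law at \<open>0\<close>, tested against a function continuous from the
  right at \<open>0\<close>.\<close>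

lemma expo_average_near_0:
  fixes c :: "real \<Rightarrow> real"
  assumes [measurable]: "c \<in> borel_measurable borel" and b: "\<And>s. \<bar>c s\<bar> \<le> B" and a: "\<alpha> > 0"
    and lim: "(c \<longlongrightarrow> c 0) (at_right 0)"
  shows "((\<lambda>t. (1 / t) * (\<integral>s. indicator {..<t} s * c s \<partial>expo \<alpha>)) \<longlongrightarrow> \<alpha> * c 0) (at_right 0)"
proof -
  interpret prob_space "expo \<alpha>" using a by (rule prob_space_exponential_density)
  have [simp]: "prob UNIV = 1" using prob_space by simp
  have lim1: "((\<lambda>t. (1 - exp (- \<alpha> * t)) / t) \<longlongrightarrow> \<alpha>) (at_right 0)"
  proof -
    have "((\<lambda>t. exp (- \<alpha> * t)) has_real_derivative - \<alpha>) (at 0)"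
      by (auto intro!: derivative_eq_intros)
    then have "((\<lambda>t. (exp (- \<alpha> * t) - 1) / t) \<longlongrightarrow> - \<alpha>) (at_right 0)"
      unfolding has_field_derivative_def by (auto simp: DERIV_def has_field_derivative_def[symmetric] intro: filterlim_at_split[THEN iffD1, THEN conjunct2])
    then have "((\<lambda>t. - ((exp (- \<alpha> * t) - 1) / t)) \<longlongrightarrow> - (- \<alpha>)) (at_right 0)" by (intro tendsto_minus)
    then show ?thesis by (simp add: minus_divide_left)
  qed
  have int: "integrable (expo \<alpha>) (\<lambda>s. indicator {..<t} s * f s)"
    if "f \<in> borel_measurable borel" "\<And>s. \<bar>f s\<bar> \<le> C" for f :: "real \<Rightarrow> real" and t C
  proof -
    have [measurable]: "f \<in> borel_measurable borel" by fact
    have "\<bar>indicator {..<t} s * f s\<bar> \<le> C" for s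
      using that(2)[of s] by (auto split: split_indicator intro: order_trans[OF abs_ge_zero])
    then show ?thesis by (intro integrable_const_bound[of _ C]) auto
  qed
  have mass: "(\<integral>s. indicator {..<t} s * (1::real) \<partial>expo \<alpha>) = 1 - exp (- \<alpha> * t)" if "t > 0" for t
    using expo_head[OF a, of t] that by simp
  have l1: "((\<lambda>t. (1 / t) * (\<integral>s. indicator {..<t} s * c s \<partial>expo \<alpha>) - c 0 * ((1 - exp (- \<alpha> * t)) / t)) \<longlongrightarrow> 0) (at_right 0)"
  proof (rule tendstoI)
    fix e :: real assume "e > 0"
    define d where "d = e / (2 * \<alpha>)"
    have d: "d > 0" using \<open>e > 0\<close> a by (simp add: d_def)
    have "\<forall>\<^sub>F s in at_right 0. dist (c s) (c 0) < d" using lim d by (rule tendstoD)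
    then obtain b where b0: "b > 0" "\<And>s. 0 < s \<Longrightarrow> s < b \<Longrightarrow> dist (c s) (c 0) < d"
      unfolding eventually_at_right_field by blast
    have "dist ((1 / t) * (\<integral>s. indicator {..<t} s * c s \<partial>expo \<alpha>) - c 0 * ((1 - exp (- \<alpha> * t)) / t)) 0 < e"
      if t: "0 < t" "t < b" for t
    proof -
      have "(\<integral>s. indicator {..<t} s * c s \<partial>expo \<alpha>) - c 0 * (1 - exp (- \<alpha> * t))
          = (\<integral>s. indicator {..<t} s * (c s - c 0) \<partial>expo \<alpha>)"
      proof -
        have "(\<integral>s. indicator {..<t} s * (c s - c 0) \<partial>expo \<alpha>)
            = (\<integral>s. indicator {..<t} s * c s - c 0 * (indicator {..<t} s * (1::real)) \<partial>expo \<alpha>)"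
          by (intro Bochner_Integration.integral_cong) (auto simp: algebra_simps)
        also have "\<dots> = (\<integral>s. indicator {..<t} s * c s \<partial>expo \<alpha>) - c 0 * (\<integral>s. indicator {..<t} s * (1::real) \<partial>expo \<alpha>)"
          using int[of c B] b int[of "\<lambda>_. 1" 1]
          by (subst Bochner_Integration.integral_diff) (auto intro!: integrable_mult_right simp del: mult_1_right)
        finally show ?thesis using mass t by simp
      qed
      moreover have "\<bar>\<integral>s. indicator {..<t} s * (c s - c 0) \<partial>expo \<alpha>\<bar> \<le> (\<integral>s. d * (indicator {..<t} s * (1::real)) \<partial>expo \<alpha>)"
      proof (rule order_trans[OF integral_abs_bound])
        have "\<bar>c s - c 0\<bar> \<le> 2 * B" for s using b[of s] b[of 0] by linarith
        then have i: "integrable (expo \<alpha>) (\<lambda>s. \<bar>indicator {..<t} s * (c s - c 0)\<bar>)"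
          using int[of "\<lambda>s. c s - c 0" "2 * B" t] by (intro integrable_abs) auto
        show "(\<integral>s. \<bar>indicator {..<t} s * (c s - c 0)\<bar> \<partial>expo \<alpha>) \<le> (\<integral>s. d * (indicator {..<t} s * (1::real)) \<partial>expo \<alpha>)"
        proof (rule integral_mono_AE[OF i])
          show "integrable (expo \<alpha>) (\<lambda>s. d * (indicator {..<t} s * (1::real)))"
            using int[of "\<lambda>_. 1" 1 t] by (intro integrable_mult_right) auto
          show "AE s in expo \<alpha>. \<bar>indicator {..<t} s * (c s - c 0)\<bar> \<le> d * (indicator {..<t} s * (1::real))"
            using AE_expo_pos
          proof eventually_elim
            case (elim s)
            then show ?case using b0(2)[of s] t by (auto simp: dist_real_def split: split_indicator)
          qed
        qed
      qed
      moreover have "(\<integral>s. d * (indicator {..<t} s * (1::real)) \<partial>expo \<alpha>) \<le> d * (\<alpha> * t)"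
      proof -
        have "1 - exp (- \<alpha> * t) \<le> \<alpha> * t" using exp_ge_add_one_self[of "- \<alpha> * t"] by simp
        then show ?thesis using mass[OF t(1)] d by (subst integral_mult_right_zero) (auto intro: mult_left_mono)
      qed
      ultimately have "\<bar>(\<integral>s. indicator {..<t} s * c s \<partial>expo \<alpha>) - c 0 * (1 - exp (- \<alpha> * t))\<bar> \<le> d * (\<alpha> * t)" by linarith
      then have "\<bar>(\<integral>s. indicator {..<t} s * c s \<partial>expo \<alpha>) - c 0 * (1 - exp (- \<alpha> * t))\<bar> / t \<le> d * \<alpha>"
        using t by (simp add: field_simps)
      also have "d * \<alpha> < e" using \<open>e > 0\<close> a by (simp add: d_def)
      finally have "\<bar>((\<integral>s. indicator {..<t} s * c s \<partial>expo \<alpha>) - c 0 * (1 - exp (- \<alpha> * t))) / t\<bar> < e" using t by simp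
      moreover have "(a - c 0 * y) / t = (1 / t) * a - c 0 * (y / t)" for a y
        using t by (simp add: field_simps)
      ultimately show ?thesis by (simp only: dist_real_def diff_0_right)
    qed
    then show "\<forall>\<^sub>F t in at_right 0. dist ((1 / t) * (\<integral>s. indicator {..<t} s * c s \<partial>expo \<alpha>) - c 0 * ((1 - exp (- \<alpha> * t)) / t)) 0 < e"
      unfolding eventually_at_right_field using b0(1) by blast
  qed
  have l2: "((\<lambda>t. c 0 * ((1 - exp (- \<alpha> * t)) / t)) \<longlongrightarrow> c 0 * \<alpha>) (at_right 0)"
    using lim1 by (intro tendsto_mult tendsto_const)
  from tendsto_add[OF l1 l2] show ?thesis by (simp add: mult.commute)
qed

locale feller_form = form_space m F E + feller_space m X \<theta> P
  for m :: "'a::{metric_space, second_countable_topology} measure"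
    and F E and X :: "('w, 'a) coords" and \<theta> P +
  assumes assoc: "associated m F E X P"
begin

text \<open>Fubini's theorem for the pairing of a time average of the semigroup with a bounded function. The
  times are distributed as \<open>\<tau>\<close> under a probability measure \<open>\<kappa>\<close>, which covers both \<open>\<alpha> R\<^sub>\<alpha>h\<close> and
  its image under \<open>P\<^sub>t\<close>.\<close>

lemma p_average:
  assumes h: "h \<in> C_infty" "integrable m h"
    and \<kappa>: "prob_space \<kappa>" "sets \<kappa> = sets (borel :: real measure)"
    and \<tau>[measurable]: "\<tau> \<in> borel_measurable borel" and \<tau>0: "\<And>s. 0 \<le> \<tau> s"
    and g[measurable]: "g \<in> borel_measurable borel" and B: "\<And>x. \<bar>g x\<bar> \<le> B"
  shows "integrable m (\<lambda>x. (\<integral>s. p (\<tau> s) h x \<partial>\<kappa>) * g x)"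
    and "(\<integral>x. (\<integral>s. p (\<tau> s) h x \<partial>\<kappa>) * g x \<partial>m) = (\<integral>s. (\<integral>x. p (\<tau> s) h x * g x \<partial>m) \<partial>\<kappa>)"
    and "(\<lambda>s. \<integral>x. p (\<tau> s) h x * g x \<partial>m) \<in> borel_measurable borel"
    and "\<And>s. \<bar>\<integral>x. p (\<tau> s) h x * g x \<partial>m\<bar> \<le> B * (\<integral>x. \<bar>h x\<bar> \<partial>m)"
proof -
  interpret \<kappa>: prob_space \<kappa> by fact
  interpret m: sigma_finite_measure m by (rule sigma_finite_m)
  interpret pair_sigma_finite \<kappa> m ..
  note [measurable_cong] = \<kappa>(2)
  obtain M where M: "\<And>x. \<bar>h x\<bar> \<le> M" using C_infty_bounded[OF h(1)] by auto
  have hb[measurable]: "h \<in> borel_measurable borel" using C_infty_borel[OF h(1)] .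
  have B0: "0 \<le> B" using B[of undefined] by linarith
  have mx: "p (\<tau> s) h = p (max (\<tau> s) 0) h" for s using \<tau>0[of s] by simp
  have meas: "(\<lambda>(s, x). p (\<tau> s) h x * g x) \<in> borel_measurable (borel \<Otimes>\<^sub>M borel)"
    unfolding mx split_beta using h(1) by measurable
  then have meas'[measurable]: "(\<lambda>(s, x). p (\<tau> s) h x * g x) \<in> borel_measurable (\<kappa> \<Otimes>\<^sub>M m)"
    by (simp add: measurable_cong_sets[OF sets_pair_measure_cong[OF \<kappa>(2) sets_m] refl])
  have int: "integrable m (\<lambda>x. p (\<tau> s) h x * g x)" for s
    by (rule integrable_bounded_mult[OF p_L1_contraction(1)[OF \<tau>0 h(2) M] g B])
  have bound: "(\<integral>x. norm (p (\<tau> s) h x * g x) \<partial>m) \<le> B * (\<integral>x. \<bar>h x\<bar> \<partial>m)" for s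
  proof -
    have "(\<integral>x. norm (p (\<tau> s) h x * g x) \<partial>m) \<le> (\<integral>x. B * \<bar>p (\<tau> s) h x\<bar> \<partial>m)"
      using int p_L1_contraction(1)[OF \<tau>0 h(2) M] B
      by (intro integral_mono integrable_mult_right integrable_norm integrable_abs)
        (auto simp: abs_mult mult.commute intro!: mult_right_mono)
    also have "\<dots> \<le> B * (\<integral>x. \<bar>h x\<bar> \<partial>m)"
      using p_L1_contraction(2)[OF \<tau>0 h(2) M] B0 by (simp add: mult_left_mono)
    finally show ?thesis .
  qed
  have I: "integrable (\<kappa> \<Otimes>\<^sub>M m) (\<lambda>(s, x). p (\<tau> s) h x * g x)"
  proof (rule Fubini_integrable[OF meas'])
    have "(\<lambda>s. \<integral>x. norm (case (s, x) of (s, x) \<Rightarrow> p (\<tau> s) h x * g x) \<partial>m) \<in> borel_measurable \<kappa>"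
      using meas' by measurable
    then show "integrable \<kappa> (\<lambda>s. \<integral>x. norm (case (s, x) of (s, x) \<Rightarrow> p (\<tau> s) h x * g x) \<partial>m)"
      using bound by (intro \<kappa>.integrable_const_bound[of _ "B * (\<integral>x. \<bar>h x\<bar> \<partial>m)"]) auto
  qed (use int in simp)
  show "integrable m (\<lambda>x. (\<integral>s. p (\<tau> s) h x \<partial>\<kappa>) * g x)"
    using integrable_snd[OF I] by simp
  show "(\<integral>x. (\<integral>s. p (\<tau> s) h x \<partial>\<kappa>) * g x \<partial>m) = (\<integral>s. (\<integral>x. p (\<tau> s) h x * g x \<partial>m) \<partial>\<kappa>)"
    using Fubini_integral[OF I] by simp
  show "(\<lambda>s. \<integral>x. p (\<tau> s) h x * g x \<partial>m) \<in> borel_measurable borel"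
    using m.borel_measurable_lebesgue_integral[of "\<lambda>s x. p (\<tau> s) h x * g x" borel] meas
    by (simp add: measurable_cong_sets[OF sets_pair_measure_cong[OF refl sets_m] refl])
  show "\<bar>\<integral>x. p (\<tau> s) h x * g x \<partial>m\<bar> \<le> B * (\<integral>x. \<bar>h x\<bar> \<partial>m)" for s
    using integral_abs_bound[of m "\<lambda>x. p (\<tau> s) h x * g x"] bound[of s] unfolding real_norm_def
    by (rule order_trans)
qed

definition R :: "real \<Rightarrow> ('a \<Rightarrow> real) \<Rightarrow> 'a \<Rightarrow> real" where
  "R \<alpha> h x = (1 / \<alpha>) * (\<integral>s. p (max s 0) h x \<partial>expo \<alpha>)"

definition test_fn :: "('a \<Rightarrow> real) \<Rightarrow> bool" where
  "test_fn h \<longleftrightarrow> h \<in> C_infty \<and> integrable m h \<and> (\<forall>x. 0 \<le> h x)"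

lemma test_fnD: "test_fn h \<Longrightarrow> h \<in> C_infty" "test_fn h \<Longrightarrow> integrable m h" "test_fn h \<Longrightarrow> 0 \<le> h x"
  by (auto simp: test_fn_def)

lemma test_fn_C_c: "h \<in> C_c \<Longrightarrow> (\<And>x. 0 \<le> h x) \<Longrightarrow> test_fn h"
  by (auto simp: test_fn_def C_c_C_infty C_c_integrable)

lemma test_fn_p: "test_fn h \<Longrightarrow> t \<ge> 0 \<Longrightarrow> test_fn (p t h)"
  using C_infty_bounded[of h] p_L1_contraction(1)[of t h] unfolding test_fn_def
  by (metis p_C_infty p_nonneg)

lemma p_integrable_expo:
  assumes "h \<in> C_infty" "\<alpha> > 0" and [measurable]: "\<tau> \<in> borel_measurable borel"
  shows "integrable (expo \<alpha>) (\<lambda>s. p (max (\<tau> s) 0) h x)"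
proof -
  interpret prob_space "expo \<alpha>" using assms(2) by (rule prob_space_exponential_density)
  obtain M where M: "\<And>x. \<bar>h x\<bar> \<le> M" using C_infty_bounded[OF assms(1)] by auto
  have "AE s in expo \<alpha>. norm (p (max (\<tau> s) 0) h x) \<le> M"
    using p_bounded[OF C_infty_borel[OF assms(1)] M] by simp
  then show ?thesis by (rule integrable_const_bound) (use assms(1) in measurable)
qed

lemma R_nonneg: "test_fn h \<Longrightarrow> \<alpha> > 0 \<Longrightarrow> 0 \<le> R \<alpha> h x"
  unfolding R_def using p_nonneg[of h] test_fnD(3)[of h] by simp

lemma R_le:
  assumes "h \<in> C_infty" "\<alpha> > 0" "\<And>x. h x \<le> M" "\<And>x. 0 \<le> h x" shows "R \<alpha> h x \<le> M / \<alpha>"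
proof -
  interpret prob_space "expo \<alpha>" using assms(2) by (rule prob_space_exponential_density)
  have "\<bar>p t h x\<bar> \<le> M" for t by (rule p_bounded[OF C_infty_borel[OF assms(1)]]) (use assms in auto)
  then have "p t h x \<le> M" for t by (meson abs_le_D1)
  then have "(\<integral>s. p (max s 0) h x \<partial>expo \<alpha>) \<le> (\<integral>s. M \<partial>expo \<alpha>)"
    using p_integrable_expo[OF assms(1,2), of "\<lambda>s. s" x] by (intro integral_mono) auto
  also have "\<dots> = M" using prob_space by simp
  finally show ?thesis using assms(2) by (simp add: R_def divide_right_mono)
qed

lemma R_continuous:
  assumes "h \<in> C_infty" "\<alpha> > 0" shows "continuous_on UNIV (R \<alpha> h)"
  unfolding continuous_on_sequentially
proof (intro ballI allI impI, elim conjE)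
  fix x :: 'a and S :: "nat \<Rightarrow> 'a" assume S: "S \<longlonglongrightarrow> x"
  interpret prob_space "expo \<alpha>" using assms(2) by (rule prob_space_exponential_density)
  obtain M where M: "\<And>x. \<bar>h x\<bar> \<le> M" using C_infty_bounded[OF assms(1)] by auto
  have "(\<lambda>n. \<integral>s. p (max s 0) h (S n) \<partial>expo \<alpha>) \<longlonglongrightarrow> (\<integral>s. p (max s 0) h x \<partial>expo \<alpha>)"
  proof (rule integral_dominated_convergence[where w="\<lambda>_. M"])
    show "AE s in expo \<alpha>. (\<lambda>n. p (max s 0) h (S n)) \<longlonglongrightarrow> p (max s 0) h x"
    proof (rule AE_I2)
      fix s :: real
      have "continuous_on UNIV (p (max s 0) h)" using assms by (intro C_infty_continuous p_C_infty) auto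
      then show "(\<lambda>n. p (max s 0) h (S n)) \<longlonglongrightarrow> p (max s 0) h x"
        using S by (intro continuous_on_tendsto_compose[of UNIV "p (max s 0) h"]) auto
    qed
    show "AE s in expo \<alpha>. norm (p (max s 0) h (S n)) \<le> M" for n
      using p_bounded[OF C_infty_borel[OF assms(1)] M] by simp
  qed (use p_integrable_expo[OF assms, of "\<lambda>s. s"] in auto)
  then show "(R \<alpha> h \<circ> S) \<longlonglongrightarrow> R \<alpha> h x" unfolding R_def o_def by (intro tendsto_mult tendsto_const)
qed

lemma R_borel[measurable]: "h \<in> C_infty \<Longrightarrow> \<alpha> > 0 \<Longrightarrow> R \<alpha> h \<in> borel_measurable borel"
  by (intro borel_measurable_continuous_onI R_continuous)

lemma R_pairing:
  assumes h: "test_fn h" and a: "\<alpha> > 0" and g: "g \<in> borel_measurable borel" and B: "\<And>x. \<bar>g x\<bar> \<le> B"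
  shows "integrable m (\<lambda>x. R \<alpha> h x * g x)"
    and "\<alpha> * (\<integral>x. R \<alpha> h x * g x \<partial>m) = (\<integral>s. (\<integral>x. p (max s 0) h x * g x \<partial>m) \<partial>expo \<alpha>)"
proof -
  note av = p_average[OF test_fnD(1,2)[OF h] prob_space_exponential_density[OF a], of "\<lambda>s. max s 0" g B]
  have "integrable m (\<lambda>x. (1 / \<alpha>) * ((\<integral>s. p (max s 0) h x \<partial>expo \<alpha>) * g x))"
    using av(1) g B by (intro integrable_mult_right) auto
  then show "integrable m (\<lambda>x. R \<alpha> h x * g x)" by (simp add: R_def mult.assoc)
  have "(\<integral>x. R \<alpha> h x * g x \<partial>m) = (\<integral>x. (1 / \<alpha>) * ((\<integral>s. p (max s 0) h x \<partial>expo \<alpha>) * g x) \<partial>m)"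
    by (simp add: R_def mult.assoc)
  also have "\<dots> = (1 / \<alpha>) * (\<integral>s. (\<integral>x. p (max s 0) h x * g x \<partial>m) \<partial>expo \<alpha>)"
    using av(2) g B by (subst integral_mult_right_zero) auto
  finally show "\<alpha> * (\<integral>x. R \<alpha> h x * g x \<partial>m) = (\<integral>s. (\<integral>x. p (max s 0) h x * g x \<partial>m) \<partial>expo \<alpha>)"
    using a by simp
qed

lemma R_L2:
  assumes h: "test_fn h" and a: "\<alpha> > 0" shows "R \<alpha> h \<in> L2 m"
proof -
  obtain M where M: "\<And>x. \<bar>h x\<bar> \<le> M" using C_infty_bounded[OF test_fnD(1)[OF h]] by auto
  have "\<bar>R \<alpha> h x\<bar> \<le> M / \<alpha>" for x
    using R_nonneg[OF h a, of x] R_le[OF test_fnD(1)[OF h] a, of M x] M test_fnD(3)[OF h] by (simp add: abs_le_iff)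
  then have "integrable m (\<lambda>x. R \<alpha> h x * R \<alpha> h x)"
    using R_borel[OF test_fnD(1)[OF h] a] by (intro R_pairing(1)[OF h a]) auto
  then show ?thesis using R_borel[OF test_fnD(1)[OF h] a] unfolding L2_def by (simp add: power2_eq_square)
qed

lemma p_R:
  assumes h: "h \<in> C_infty" and a: "\<alpha> > 0" and t: "t \<ge> 0"
  shows "p t (R \<alpha> h) x = (1 / \<alpha>) * (\<integral>s. p (max s 0 + t) h x \<partial>expo \<alpha>)"
proof -
  interpret prob_space "expo \<alpha>" using a by (rule prob_space_exponential_density)
  interpret Q: prob_space "P (Some x)" by (rule prob_P)
  interpret pair_sigma_finite "P (Some x)" "expo \<alpha>" ..
  interpret pair: prob_space "P (Some x) \<Otimes>\<^sub>M expo \<alpha>" by (rule prob_space_pair) unfold_locales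
  obtain M where M: "\<And>x. \<bar>h x\<bar> \<le> M" using C_infty_bounded[OF h] by auto
  have M0: "0 \<le> M" using M[of x] by linarith
  have bd: "\<bar>p s h y\<bar> \<le> M" for s y using p_bounded[OF C_infty_borel[OF h] M] .
  have z: "ext0 (R \<alpha> h) z = (1 / \<alpha>) * (\<integral>s. ext0 (p (max s 0) h) z \<partial>expo \<alpha>)" for z
    by (cases z) (auto simp: R_def)
  have the_meas: "the \<in> borel_pt \<rightarrow>\<^sub>M (borel :: 'a measure)" by (rule measurable_borel_ptI) auto
  have eq: "ext0 (p s h) z = (if z = None then 0 else p s h (the z))" for s z by (cases z) auto
  have [measurable]: "Measurable.pred borel_pt (\<lambda>z. z = (None :: 'a option))"
    using singleton_None_borel_pt by (simp add: pred_def)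
  have [measurable]: "(\<lambda>z. the (X t (fst z))) \<in> (P (Some x) \<Otimes>\<^sub>M expo \<alpha>) \<rightarrow>\<^sub>M borel"
    using the_meas by measurable
  have meas: "(\<lambda>(\<omega>, s). ext0 (p (max s 0) h) (X t \<omega>)) \<in> borel_measurable (P (Some x) \<Otimes>\<^sub>M expo \<alpha>)"
    unfolding eq split_beta using h by measurable
  have bd': "\<bar>ext0 (p s h) z\<bar> \<le> M" for s z using bd M0 by (cases z) auto
  have I: "integrable (P (Some x) \<Otimes>\<^sub>M expo \<alpha>) (\<lambda>(\<omega>, s). ext0 (p (max s 0) h) (X t \<omega>))"
    by (rule pair.integrable_const_bound[OF _ meas, of M]) (use bd' in auto)
  have "p t (R \<alpha> h) x = (1 / \<alpha>) * (\<integral>\<omega>. \<integral>s. ext0 (p (max s 0) h) (X t \<omega>) \<partial>expo \<alpha> \<partial>P (Some x))"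
    unfolding trans_op_def z by simp
  also have "(\<integral>\<omega>. \<integral>s. ext0 (p (max s 0) h) (X t \<omega>) \<partial>expo \<alpha> \<partial>P (Some x)) = (\<integral>s. \<integral>\<omega>. ext0 (p (max s 0) h) (X t \<omega>) \<partial>P (Some x) \<partial>expo \<alpha>)"
    using Fubini_integral[OF I] by simp
  also have "\<dots> = (\<integral>s. p t (p (max s 0) h) x \<partial>expo \<alpha>)" by (simp add: trans_op_def)
  also have "\<dots> = (\<integral>s. p (max s 0 + t) h x \<partial>expo \<alpha>)"
  proof -
    have "p t (p (max s 0) h) x = p (max s 0 + t) h x" for s
      using p_semigroup[OF t _ h, of "max s 0" x] by (simp add: add.commute)
    then show ?thesis by simp
  qed
  finally show ?thesis .
qed

text \<open>The identity \<open>(\<alpha> - L) R\<^sub>\<alpha>h = h\<close> for the generator \<open>L\<close>, in weak form. With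
  \<open>c(s) = \<langle>P\<^sub>sh, g\<rangle>\<close>, both \<open>\<langle>R\<^sub>\<alpha>h, g\<rangle>\<close> and \<open>\<langle>P\<^sub>tR\<^sub>\<alpha>h, g\<rangle>\<close> are exponential averages of \<open>c\<close>, the
  latter of \<open>c(\<cdot> + t)\<close>; memorylessness reduces the difference quotient to the average of \<open>c\<close> over
  \<open>[0,t)\<close>, and \<open>c\<close> is continuous at \<open>0\<close>.\<close>

lemma R_difference_quotient:
  assumes h: "test_fn h" and a: "\<alpha> > 0" and g[measurable]: "g \<in> borel_measurable borel" and B: "\<And>x. \<bar>g x\<bar> \<le> B"
  shows "((\<lambda>t. (1 / t) * (\<integral>x. (R \<alpha> h x - p t (R \<alpha> h) x) * g x \<partial>m)) \<longlongrightarrow>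
     (\<integral>x. h x * g x \<partial>m) - \<alpha> * (\<integral>x. R \<alpha> h x * g x \<partial>m)) (at_right 0)"
proof -
  interpret prob_space "expo \<alpha>" using a by (rule prob_space_exponential_density)
  note hC = test_fnD(1)[OF h]
  have [measurable]: "h \<in> borel_measurable borel" using C_infty_borel[OF hC] .
  note av = p_average[OF test_fnD(1,2)[OF h] prob_space_exponential_density[OF a]]
  define c where "c s = (\<integral>x. p (max s 0) h x * g x \<partial>m)" for s
  define D where "D = B * (\<integral>x. \<bar>h x\<bar> \<partial>m)"
  have cm[measurable]: "c \<in> borel_measurable borel" unfolding c_def using av(3)[of "\<lambda>s. max s 0" g B] B by simp
  have cb: "\<bar>c s\<bar> \<le> D" for s unfolding c_def D_def using av(4)[of "\<lambda>s. max s 0" g B] B by simp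
  have c0: "c 0 = (\<integral>x. h x * g x \<partial>m)" unfolding c_def using p_0[OF C_infty_borel[OF hC]] by simp
  have lim: "(c \<longlongrightarrow> c 0) (at_right 0)"
  proof -
    have le: "\<bar>c s - c 0\<bar> \<le> B * (\<integral>x. \<bar>p s h x - h x\<bar> \<partial>m)" if s: "0 < s" for s
    proof -
      obtain M where M: "\<And>x. \<bar>h x\<bar> \<le> M" using C_infty_bounded[OF hC] by auto
      have i: "integrable m (p s h)" "integrable m h" using p_L1_contraction(1)[OF _ test_fnD(2)[OF h] M, of s] s test_fnD(2)[OF h] by auto
      note ig = integrable_bounded_mult[OF _ g B]
      have "c s - c 0 = (\<integral>x. p s h x * g x - h x * g x \<partial>m)"
        using s c0 ig i by (simp add: c_def)
      also have "\<bar>\<dots>\<bar> \<le> (\<integral>x. \<bar>p s h x * g x - h x * g x\<bar> \<partial>m)" by (rule integral_abs_bound)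
      also have "\<dots> \<le> (\<integral>x. B * \<bar>p s h x - h x\<bar> \<partial>m)"
      proof (rule integral_mono)
        fix x show "\<bar>p s h x * g x - h x * g x\<bar> \<le> B * \<bar>p s h x - h x\<bar>"
        proof -
          have "p s h x * g x - h x * g x = (p s h x - h x) * g x" by (simp add: left_diff_distrib)
          moreover have "\<bar>p s h x - h x\<bar> * \<bar>g x\<bar> \<le> \<bar>p s h x - h x\<bar> * B" using B by (intro mult_left_mono) auto
          ultimately show ?thesis by (simp add: abs_mult mult.commute)
        qed
      qed (use ig i in auto)
      finally show ?thesis by simp
    qed
    have "((\<lambda>s. B * (\<integral>x. \<bar>p s h x - h x\<bar> \<partial>m)) \<longlongrightarrow> B * 0) (at_right 0)"
      using p_L1_near_0[OF test_fnD(1,2)[OF h] test_fnD(3)[OF h]] by (intro tendsto_mult tendsto_const)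
    then have "((\<lambda>s. c s - c 0) \<longlongrightarrow> 0) (at_right 0)"
      using le by (intro Lim_null_comparison[of "\<lambda>s. c s - c 0" "\<lambda>s. B * (\<integral>x. \<bar>p s h x - h x\<bar> \<partial>m)"])
        (auto simp: eventually_at_right_field intro: exI[of _ 1])
    then show ?thesis by (simp add: LIM_zero_iff)
  qed
  define C where "C = (\<integral>s. c s \<partial>expo \<alpha>)"
  have ci: "integrable (expo \<alpha>) (\<lambda>s. indicator A s * c s)" if "A \<in> sets borel" for A
  proof -
    have "\<bar>indicator A s * c s\<bar> \<le> D" for s
      using cb[of s] by (auto split: split_indicator intro: order_trans[OF abs_ge_zero])
    then show ?thesis using that by (intro integrable_const_bound[of _ D]) auto
  qed
  have CR: "C = \<alpha> * (\<integral>x. R \<alpha> h x * g x \<partial>m)" using R_pairing(2)[OF h a g B] by (simp add: C_def c_def)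
  have quot: "(1 / t) * (\<integral>x. (R \<alpha> h x - p t (R \<alpha> h) x) * g x \<partial>m)
      = (1 / \<alpha>) * (C * ((1 - exp (\<alpha> * t)) / t) + exp (\<alpha> * t) * ((1 / t) * (\<integral>s. indicator {..<t} s * c s \<partial>expo \<alpha>)))"
    if t: "t > 0" for t
  proof -
    have av': "integrable m (\<lambda>x. (\<integral>s. p (max s 0 + t) h x \<partial>expo \<alpha>) * g x)"
      "(\<integral>x. (\<integral>s. p (max s 0 + t) h x \<partial>expo \<alpha>) * g x \<partial>m) = (\<integral>s. (\<integral>x. p (max s 0 + t) h x * g x \<partial>m) \<partial>expo \<alpha>)"
      using av(1,2)[of "\<lambda>s. max s 0 + t" g B] B t by auto
    have pR: "p t (R \<alpha> h) x * g x = (1 / \<alpha>) * ((\<integral>s. p (max s 0 + t) h x \<partial>expo \<alpha>) * g x)" for x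
      using p_R[OF hC a, of t x] t by simp
    have ipR: "integrable m (\<lambda>x. p t (R \<alpha> h) x * g x)" unfolding pR using av'(1) by (rule integrable_mult_right)
    have "(\<integral>x. p t (R \<alpha> h) x * g x \<partial>m) = (1 / \<alpha>) * (\<integral>s. (\<integral>x. p (max s 0 + t) h x * g x \<partial>m) \<partial>expo \<alpha>)"
      unfolding pR using av'(2) by simp
    also have "(\<integral>s. (\<integral>x. p (max s 0 + t) h x * g x \<partial>m) \<partial>expo \<alpha>) = (\<integral>s. c (s + t) \<partial>expo \<alpha>)"
    proof (rule integral_cong_AE)
      show "AE s in expo \<alpha>. (\<integral>x. p (max s 0 + t) h x * g x \<partial>m) = c (s + t)"
        using AE_expo_pos by eventually_elim (use t in \<open>simp add: c_def\<close>)
      show "(\<lambda>s. \<integral>x. p (max s 0 + t) h x * g x \<partial>m) \<in> borel_measurable (expo \<alpha>)"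
        using av(3)[of "\<lambda>s. max s 0 + t" g B] B t by simp
    qed measurable
    also have "\<dots> = exp (\<alpha> * t) * (\<integral>s. indicator {t..} s * c s \<partial>expo \<alpha>)"
      using expo_memoryless[OF cm a, of t] t by simp
    also have "(\<integral>s. indicator {t..} s * c s \<partial>expo \<alpha>) = C - (\<integral>s. indicator {..<t} s * c s \<partial>expo \<alpha>)"
    proof -
      have "(\<integral>s. indicator {t..} s * c s \<partial>expo \<alpha>) = (\<integral>s. indicator UNIV s * c s - indicator {..<t} s * c s \<partial>expo \<alpha>)"
        by (intro Bochner_Integration.integral_cong) (auto split: split_indicator)
      also have "\<dots> = (\<integral>s. indicator UNIV s * c s \<partial>expo \<alpha>) - (\<integral>s. indicator {..<t} s * c s \<partial>expo \<alpha>)"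
        by (intro Bochner_Integration.integral_diff ci) auto
      finally show ?thesis by (simp add: C_def)
    qed
    finally have 1: "(\<integral>x. p t (R \<alpha> h) x * g x \<partial>m) = (1 / \<alpha>) * (exp (\<alpha> * t) * (C - (\<integral>s. indicator {..<t} s * c s \<partial>expo \<alpha>)))" .
    have "(\<integral>x. (R \<alpha> h x - p t (R \<alpha> h) x) * g x \<partial>m) = (\<integral>x. R \<alpha> h x * g x \<partial>m) - (\<integral>x. p t (R \<alpha> h) x * g x \<partial>m)"
      using R_pairing(1)[OF h a g B] ipR by (simp add: left_diff_distrib)
    also have "\<dots> = (1 / \<alpha>) * (C - exp (\<alpha> * t) * (C - (\<integral>s. indicator {..<t} s * c s \<partial>expo \<alpha>)))"
      unfolding 1 CR using a by (simp add: right_diff_distrib)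
    finally have 2: "(\<integral>x. (R \<alpha> h x - p t (R \<alpha> h) x) * g x \<partial>m) =
      (1 / \<alpha>) * (C - exp (\<alpha> * t) * (C - (\<integral>s. indicator {..<t} s * c s \<partial>expo \<alpha>)))" .
    have "(1 / t) * ((1 / \<alpha>) * (C - e * (C - i))) = (1 / \<alpha>) * (C * ((1 - e) / t) + e * ((1 / t) * i))" for e i
      using t a by (simp add: field_simps)
    then show ?thesis unfolding 2 .
  qed
  have lim1: "((\<lambda>t. (1 - exp (\<alpha> * t)) / t) \<longlongrightarrow> - \<alpha>) (at_right 0)"
  proof -
    have "((\<lambda>t. exp (\<alpha> * t)) has_real_derivative \<alpha>) (at 0)"
      by (auto intro!: derivative_eq_intros)
    then have "((\<lambda>t. (exp (\<alpha> * t) - 1) / t) \<longlongrightarrow> \<alpha>) (at_right 0)"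
      by (auto simp: DERIV_def intro: filterlim_at_split[THEN iffD1, THEN conjunct2])
    then have "((\<lambda>t. - ((exp (\<alpha> * t) - 1) / t)) \<longlongrightarrow> - \<alpha>) (at_right 0)" by (intro tendsto_minus)
    then show ?thesis by (simp add: minus_divide_left)
  qed
  have "((\<lambda>t. (1 / \<alpha>) * (C * ((1 - exp (\<alpha> * t)) / t) + exp (\<alpha> * t) * ((1 / t) * (\<integral>s. indicator {..<t} s * c s \<partial>expo \<alpha>))))
      \<longlongrightarrow> (1 / \<alpha>) * (C * (- \<alpha>) + exp (\<alpha> * 0) * (\<alpha> * c 0))) (at_right 0)"
    by (intro tendsto_mult tendsto_add tendsto_const tendsto_exp tendsto_ident_at lim1 expo_average_near_0[OF cm cb a lim])
  then have "((\<lambda>t. (1 / t) * (\<integral>x. (R \<alpha> h x - p t (R \<alpha> h) x) * g x \<partial>m)) \<longlongrightarrow> (1 / \<alpha>) * (C * (- \<alpha>) + exp (\<alpha> * 0) * (\<alpha> * c 0))) (at_right 0)"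
    by (rule Lim_transform_eventually) (rule eventually_mono[OF eventually_at_right_less quot[symmetric]])
  moreover have "(1 / \<alpha>) * (C * (- \<alpha>) + exp (\<alpha> * 0) * (\<alpha> * c 0)) = c 0 - C" using a by (simp add: field_simps)
  ultimately show ?thesis by (simp add: c0 CR)
qed

lemma R_in_F: "test_fn h \<Longrightarrow> \<alpha> > 0 \<Longrightarrow> R \<alpha> h \<in> F"
proof -
  assume h: "test_fn h" and a: "\<alpha> > 0"
  obtain M where M: "\<And>x. \<bar>h x\<bar> \<le> M" using C_infty_bounded[OF test_fnD(1)[OF h]] by auto
  have "\<bar>R \<alpha> h x\<bar> \<le> M / \<alpha>" for x
    using R_nonneg[OF h a, of x] R_le[OF test_fnD(1)[OF h] a, of M x] M test_fnD(3)[OF h] by (simp add: abs_le_iff)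
  from R_difference_quotient[OF h a R_borel[OF test_fnD(1)[OF h] a] this]
  have "\<exists>l. ((\<lambda>t. (1 / t) * (\<integral>x. (R \<alpha> h x - p t (R \<alpha> h) x) * R \<alpha> h x \<partial>m)) \<longlongrightarrow> l) (at_right 0)" by blast
  moreover have "F = {f \<in> L2 m. \<exists>l. ((\<lambda>t. (1 / t) * (\<integral>x. (f x - p t f x) * f x \<partial>m)) \<longlongrightarrow> l) (at_right 0)}"
    using assoc unfolding associated_def by (elim conjE)
  ultimately show ?thesis using R_L2[OF h a] by simp
qed

lemma E_limit: "f \<in> F \<Longrightarrow> g \<in> F \<Longrightarrow>
    ((\<lambda>t. (1 / t) * (\<integral>x. (f x - p t f x) * g x \<partial>m)) \<longlongrightarrow> E f g) (at_right 0)"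
  using assoc unfolding associated_def by (elim conjE) blast

text \<open>The same difference quotient defines the form of the process; limits are unique.\<close>

lemma E1_R:
  assumes h: "test_fn h" and a: "\<alpha> > 0" and g: "g \<in> F" and B: "\<And>x. \<bar>g x\<bar> \<le> B"
  shows "E1 m E (R \<alpha> h) g = (\<integral>x. h x * g x \<partial>m) - (\<alpha> - 1) * (\<integral>x. R \<alpha> h x * g x \<partial>m)"
proof -
  have "E (R \<alpha> h) g = (\<integral>x. h x * g x \<partial>m) - \<alpha> * (\<integral>x. R \<alpha> h x * g x \<partial>m)"
    by (rule tendsto_unique[OF _ E_limit[OF R_in_F[OF h a] g] R_difference_quotient[OF h a F_borel[OF g] B]])
      (simp add: trivial_limit_at_right_real)
  then show ?thesis by (simp add: E1_def algebra_simps)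
qed

end

section \<open>Continuous potentials of finite measures\<close>

locale continuous_potential = feller_form m F E X \<theta> P
  for m :: "'a::{metric_space, second_countable_topology} measure"
    and F E and X :: "('w, 'a) coords" and \<theta> P +
  fixes \<mu> :: "'a measure" and u :: "'a \<Rightarrow> real"
  assumes sets_\<mu>[measurable_cong, simp]: "sets \<mu> = sets borel"
    and finite_\<mu>: "emeasure \<mu> UNIV < \<infinity>"
    and u_C_infty: "u \<in> C_infty" and U1: "is_U1 m F E \<mu> u"
begin

lemma space_\<mu>[simp]: "space \<mu> = UNIV"
  using sets_eq_imp_space_eq[OF sets_\<mu>] by simp

lemma finite_measure_\<mu>: "finite_measure \<mu>"
  using finite_\<mu> by (intro finite_measureI) auto

lemma u_F: "u \<in> F"
  using U1 unfolding is_U1_def by blast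

lemma u_borel[measurable]: "u \<in> borel_measurable borel"
  using u_C_infty by (rule C_infty_borel)

text \<open>A continuous function is its own quasi-continuous version.\<close>

lemma potential_formula:
  assumes "f \<in> F" "continuous_on UNIV f"
  shows "integrable \<mu> f" "E1 m E f u = (\<integral>x. f x \<partial>\<mu>)"
proof -
  have "quasi_continuous m F E f"
    unfolding quasi_continuous_def
  proof (intro allI impI exI conjI)
    show "cap m F E {} < ennreal e" if "e > 0" for e using that by (simp add: cap_empty)
  qed (use assms(2) in auto)
  moreover have "f \<in> borel_measurable borel" using assms(2) by (rule borel_measurable_continuous_onI)
  ultimately show "integrable \<mu> f" "E1 m E f u = (\<integral>x. f x \<partial>\<mu>)"
    using U1 assms(1) unfolding is_U1_def by auto
qed

lemma integral_R_\<mu>: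
  assumes h: "test_fn h" and a: "\<alpha> > 0"
  shows "integrable \<mu> (R \<alpha> h)"
    "(\<integral>x. R \<alpha> h x \<partial>\<mu>) = (\<integral>x. h x * u x \<partial>m) - (\<alpha> - 1) * (\<integral>x. R \<alpha> h x * u x \<partial>m)"
proof -
  obtain M where M: "\<And>x. \<bar>u x\<bar> \<le> M" using C_infty_bounded[OF u_C_infty] by auto
  note f = potential_formula[OF R_in_F[OF h a] R_continuous[OF test_fnD(1)[OF h] a]]
  show "integrable \<mu> (R \<alpha> h)" by (rule f)
  show "(\<integral>x. R \<alpha> h x \<partial>\<mu>) = (\<integral>x. h x * u x \<partial>m) - (\<alpha> - 1) * (\<integral>x. R \<alpha> h x * u x \<partial>m)"
    using f(2) E1_R[OF h a u_F M] by simp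
qed

text \<open>\<open>\<langle>h, u\<rangle> = \<E>\<^sub>1(R\<^sub>1h, u) = \<integral> R\<^sub>1h d\<mu>\<close> is nonnegative for nonnegative test functions \<open>h\<close>.\<close>

lemma u_nonneg: "0 \<le> u x"
proof (rule C_c_pairing_nonneg)
  show "continuous_on UNIV u" using u_C_infty by (rule C_infty_continuous)
  fix h :: "'a \<Rightarrow> real" assume "h \<in> C_c" "\<And>x. 0 \<le> h x"
  then have h: "test_fn h" by (rule test_fn_C_c)
  have "0 \<le> (\<integral>x. R 1 h x \<partial>\<mu>)" using R_nonneg[OF h, of 1] by (intro Bochner_Integration.integral_nonneg) auto
  then show "0 \<le> (\<integral>x. h x * u x \<partial>m)" using integral_R_\<mu>(2)[OF h, of 1] by simp
qed

text \<open>\<open>R\<^sub>1(h - e\<^sup>-\<^sup>t P\<^sub>t h) = \<integral>\<^sub>0\<^sup>t e\<^sup>-\<^sup>s P\<^sub>s h ds\<close>.\<close>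

definition J :: "real \<Rightarrow> ('a \<Rightarrow> real) \<Rightarrow> 'a \<Rightarrow> real" where
  "J t h x = (\<integral>s. indicator {..<t} s * p (max s 0) h x \<partial>expo 1)"

lemma J_eq:
  assumes h: "test_fn h" and t: "t \<ge> 0"
  shows "J t h x = R 1 h x - exp (- t) * R 1 (p t h) x"
proof -
  interpret prob_space "expo 1" by (rule prob_space_exponential_density) simp
  note hC = test_fnD(1)[OF h]
  obtain M where M: "\<And>x. \<bar>h x\<bar> \<le> M" using C_infty_bounded[OF hC] by auto
  define c where "c s = p (max s 0) h x" for s
  have cm[measurable]: "c \<in> borel_measurable borel" unfolding c_def using hC by measurable
  have cb: "\<bar>c s\<bar> \<le> M" for s unfolding c_def using p_bounded[OF C_infty_borel[OF hC] M] .
  have ci: "integrable (expo 1) (\<lambda>s. indicator A s * c s)" if "A \<in> sets borel" for A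
  proof -
    have "\<bar>indicator A s * c s\<bar> \<le> M" for s
      using cb[of s] by (auto split: split_indicator intro: order_trans[OF abs_ge_zero])
    then show ?thesis using that by (intro integrable_const_bound[of _ M]) auto
  qed
  have "R 1 (p t h) x = (\<integral>s. c (s + t) \<partial>expo 1)"
    unfolding R_def mult_1 div_by_1
  proof (intro integral_cong_AE)
    show "AE s in expo 1. p (max s 0) (p t h) x = c (s + t)"
      using AE_expo_pos by eventually_elim (use t p_semigroup[OF _ t hC] in \<open>simp add: c_def\<close>)
    show "(\<lambda>s. p (max s 0) (p t h) x) \<in> borel_measurable (expo 1)"
      using p_C_infty[OF t hC] by measurable
  qed measurable
  also have "\<dots> = exp t * (\<integral>s. indicator {t..} s * c s \<partial>expo 1)"
    using expo_memoryless[OF cm _ t, of 1] by simp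
  finally have "exp (- t) * R 1 (p t h) x = (\<integral>s. indicator {t..} s * c s \<partial>expo 1)"
    by (simp add: exp_minus)
  moreover have "(\<integral>s. indicator {t..} s * c s \<partial>expo 1) + J t h x = R 1 h x"
  proof -
    have "(\<integral>s. indicator {t..} s * c s \<partial>expo 1) + J t h x
        = (\<integral>s. indicator {t..} s * c s + indicator {..<t} s * c s \<partial>expo 1)"
      using ci[of "{t..}"] ci[of "{..<t}"] by (simp add: J_def c_def)
    also have "\<dots> = (\<integral>s. c s \<partial>expo 1)"
      by (intro Bochner_Integration.integral_cong) (auto split: split_indicator)
    finally show ?thesis by (simp add: R_def c_def)
  qed
  ultimately show ?thesis by simp
qed

lemma J_nonneg: "test_fn h \<Longrightarrow> 0 \<le> J t h x"
  unfolding J_def using test_fnD(3)[of h] by (intro Bochner_Integration.integral_nonneg) (simp add: p_nonneg)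

lemma integral_J_\<mu>:
  assumes h: "test_fn h" and t: "t \<ge> 0"
  shows "integrable \<mu> (J t h)" "(\<integral>x. J t h x \<partial>\<mu>) = (\<integral>x. h x * (u x - exp (- t) * p t u x) \<partial>m)"
proof -
  obtain M where M: "\<And>x. \<bar>u x\<bar> \<le> M" using C_infty_bounded[OF u_C_infty] by auto
  obtain M' where M': "\<And>x. \<bar>h x\<bar> \<le> M'" using C_infty_bounded[OF test_fnD(1)[OF h]] by auto
  have J: "J t h = (\<lambda>x. R 1 h x - exp (- t) * R 1 (p t h) x)" using J_eq[OF h t] by auto
  have g: "test_fn (p t h)" using h t by (rule test_fn_p)
  note i = integral_R_\<mu>[OF h, of 1] integral_R_\<mu>[OF g, of 1]
  show "integrable \<mu> (J t h)" unfolding J using i by auto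
  have "(\<integral>x. J t h x \<partial>\<mu>) = (\<integral>x. h x * u x \<partial>m) - exp (- t) * (\<integral>x. p t h x * u x \<partial>m)"
    unfolding J using i by simp
  also have "(\<integral>x. p t h x * u x \<partial>m) = (\<integral>x. h x * p t u x \<partial>m)"
    by (rule p_symmetric[OF t test_fnD(2)[OF h] test_fnD(3)[OF h] _ u_borel u_nonneg]) (use M M' abs_le_D1 in blast)+
  also have "(\<integral>x. h x * u x \<partial>m) - exp (- t) * (\<integral>x. h x * p t u x \<partial>m) = (\<integral>x. h x * u x - exp (- t) * (h x * p t u x) \<partial>m)"
    using integrable_bounded_mult[OF test_fnD(2)[OF h] u_borel M]
      integrable_bounded_mult[OF test_fnD(2)[OF h] measurable_p[OF u_borel] p_bounded[OF u_borel M]] by simp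
  finally show "(\<integral>x. J t h x \<partial>\<mu>) = (\<integral>x. h x * (u x - exp (- t) * p t u x) \<partial>m)"
    by (simp add: algebra_simps)
qed

text \<open>\<open>\<langle>h, u - e\<^sup>-\<^sup>tP\<^sub>tu\<rangle>\<close> is the \<open>\<mu>\<close>-integral of the nonnegative function \<open>J t h\<close>.\<close>

lemma u_excessive:
  assumes t: "t \<ge> 0" shows "exp (- t) * p t u x \<le> u x"
proof -
  have "0 \<le> u x - exp (- t) * p t u x"
  proof (rule C_c_pairing_nonneg)
    show "continuous_on UNIV (\<lambda>x. u x - exp (- t) * p t u x)"
      using u_C_infty p_C_infty[OF t u_C_infty] by (intro continuous_intros C_infty_continuous)
    fix h :: "'a \<Rightarrow> real" assume "h \<in> C_c" "\<And>x. 0 \<le> h x"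
    then have h: "test_fn h" by (rule test_fn_C_c)
    show "0 \<le> (\<integral>x. h x * (u x - exp (- t) * p t u x) \<partial>m)"
      unfolding integral_J_\<mu>(2)[OF h t, symmetric] using J_nonneg[OF h] by (intro Bochner_Integration.integral_nonneg)
  qed
  then show ?thesis by simp
qed

lemma J_le:
  assumes h: "test_fn h" and M: "\<And>x. \<bar>h x\<bar> \<le> M" and t: "t > 0"
  shows "J t h x \<le> M * t"
proof -
  note hC = test_fnD(1)[OF h]
  have M0: "0 \<le> M" using M[of undefined] by linarith
  interpret e: prob_space "expo 1" by (rule prob_space_exponential_density) simp
  have i1: "integrable (expo 1) (\<lambda>s. indicator {..<t} s * (1::real))" by (intro e.integrable_const_bound[of _ 1]) auto
  have "J t h x \<le> (\<integral>s. M * (indicator {..<t} s * 1) \<partial>expo 1)"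
    unfolding J_def
  proof (rule integral_mono)
    show "integrable (expo 1) (\<lambda>s. M * (indicator {..<t} s * 1))" using i1 by (rule integrable_mult_right)
    show "integrable (expo 1) (\<lambda>s. indicator {..<t} s * p (max s 0) h x)"
    proof (rule e.integrable_const_bound[of _ M])
      have "\<bar>indicator {..<t} s * p (max s 0) h x\<bar> \<le> M" for s
        using p_bounded[OF C_infty_borel[OF hC] M, of "max s 0" x] M0 by (auto split: split_indicator)
      then show "AE s in expo 1. norm (indicator {..<t} s * p (max s 0) h x) \<le> M" by simp
      show "(\<lambda>s. indicator {..<t} s * p (max s 0) h x) \<in> borel_measurable (expo 1)" using hC by measurable
    qed
    show "indicator {..<t} s * p (max s 0) h x \<le> M * (indicator {..<t} s * 1)" for s
      using p_bounded[OF C_infty_borel[OF hC] M, of "max s 0" x] by (auto split: split_indicator)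
  qed
  also have "\<dots> = M * (1 - exp (- t))" using expo_head[of 1 "t"] t by (subst integral_mult_right_zero) simp
  also have "\<dots> \<le> M * t" using exp_ge_add_one_self[of "- t"] M0 by (intro mult_left_mono) auto
  finally show ?thesis .
qed

lemma J_quotient_tendsto:
  assumes h: "test_fn h"
  shows "((\<lambda>t. (1 / t) * J t h x) \<longlongrightarrow> h x) (at_right 0)"
proof -
  note hC = test_fnD(1)[OF h]
  obtain M where M: "\<And>x. \<bar>h x\<bar> \<le> M" using C_infty_bounded[OF hC] by auto
  have "((\<lambda>s. p (max s 0) h x) \<longlongrightarrow> p (max 0 0) h x) (at_right 0)"
  proof -
    have "continuous_on UNIV (\<lambda>s. (\<lambda>z. p (max (fst z) 0) h (snd z)) (s, x))"
      by (rule continuous_on_compose2[OF p_jointly_continuous[OF hC]]) (auto intro!: continuous_intros)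
    then have "continuous_on UNIV (\<lambda>s. p (max s 0) h x)" by simp
    then have "((\<lambda>s. p (max s 0) h x) \<longlongrightarrow> p (max 0 0) h x) (at 0)"
      unfolding continuous_on_def by (elim ballE[of _ _ 0]) simp_all
    then show ?thesis by (rule tendsto_mono[OF at_le, rotated]) simp
  qed
  from expo_average_near_0[of "\<lambda>s. p (max s 0) h x" M 1, OF _ _ _ this]
  show ?thesis using hC p_bounded[OF C_infty_borel[OF hC] M] p_0[OF C_infty_borel[OF hC], of x] by (simp add: J_def)
qed

text \<open>As \<open>u - e\<^sup>-\<^sup>tP\<^sub>tu\<close> is nonnegative, \<open>h\<close> may be replaced by the larger function \<open>v\<close>. The correction
  term bounds \<open>(1 - e\<^sup>-\<^sup>t) P\<^sub>tu\<close> by \<open>(e\<^sup>t - 1) u\<close>.\<close>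

lemma J_energy_bound:
  assumes h: "test_fn h" and v: "v \<in> F" and le: "AE x in m. h x \<le> v x" and t: "t > 0"
  shows "(1 / t) * (\<integral>x. J t h x \<partial>\<mu>)
    \<le> (1 / t) * (\<integral>x. (u x - p t u x) * v x \<partial>m) + ((exp t - 1) / t) * (\<integral>x. u x * v x \<partial>m)"
proof -
  note vm[measurable] = F_borel[OF v]
  have v0: "AE x in m. 0 \<le> v x" using le by eventually_elim (use test_fnD(3)[OF h] order_trans in blast)
  have t0: "t \<ge> 0" using t by simp
  have pu: "0 \<le> p t u x" "p t u x \<le> exp t * u x" for x
  proof -
    show "0 \<le> p t u x" using u_nonneg by (rule p_nonneg)
    show "p t u x \<le> exp t * u x" using u_excessive[OF t0, of x] by (simp add: exp_minus field_simps)
  qed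
  have puL2: "p t u \<in> L2 m"
  proof -
    have "integrable m (\<lambda>x. (exp t)\<^sup>2 * (u x)\<^sup>2)" using F_L2[OF u_F] by (simp add: L2_def)
    then have "integrable m (\<lambda>x. (p t u x)\<^sup>2)"
    proof (rule Bochner_Integration.integrable_bound)
      show "AE x in m. norm ((p t u x)\<^sup>2) \<le> norm ((exp t)\<^sup>2 * (u x)\<^sup>2)"
      proof (rule AE_I2)
        fix x have "(p t u x)\<^sup>2 \<le> (exp t * u x)\<^sup>2" using pu[of x] by (intro power_mono)
        then show "norm ((p t u x)\<^sup>2) \<le> norm ((exp t)\<^sup>2 * (u x)\<^sup>2)" by (simp add: power_mult_distrib)
      qed
    qed measurable
    then show ?thesis by (simp add: L2_def)
  qed
  have iu: "integrable m (\<lambda>x. u x * v x)" using F_mult_integrable[OF u_F v] .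
  have ip: "integrable m (\<lambda>x. p t u x * v x)" using L2_mult_integrable[OF puL2 F_L2[OF v]] .
  have "(\<integral>x. J t h x \<partial>\<mu>) = (\<integral>x. h x * (u x - exp (- t) * p t u x) \<partial>m)" by (rule integral_J_\<mu>(2)[OF h t0])
  also have "\<dots> \<le> (\<integral>x. (u x - p t u x) * v x + (exp t - 1) * (u x * v x) \<partial>m)"
  proof (rule integral_mono_AE)
    obtain B where B: "\<And>x. \<bar>u x\<bar> \<le> B" using C_infty_bounded[OF u_C_infty] by auto
    have "integrable m (\<lambda>x. h x * u x - exp (- t) * (h x * p t u x))"
      using integrable_bounded_mult[OF test_fnD(2)[OF h] u_borel B]
        integrable_bounded_mult[OF test_fnD(2)[OF h] measurable_p[OF u_borel] p_bounded[OF u_borel B]] by simp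
    then show "integrable m (\<lambda>x. h x * (u x - exp (- t) * p t u x))" by (simp add: algebra_simps)
    show "integrable m (\<lambda>x. (u x - p t u x) * v x + (exp t - 1) * (u x * v x))"
      using iu ip by (simp add: left_diff_distrib)
    show "AE x in m. h x * (u x - exp (- t) * p t u x) \<le> (u x - p t u x) * v x + (exp t - 1) * (u x * v x)"
      using le v0
    proof eventually_elim
      case (elim x)
      have "h x * (u x - exp (- t) * p t u x) \<le> v x * (u x - exp (- t) * p t u x)"
        using elim u_excessive[OF t0, of x] by (intro mult_right_mono) auto
      also have "\<dots> = (u x - p t u x) * v x + v x * ((1 - exp (- t)) * p t u x)"
        by (simp add: algebra_simps)
      also have "v x * ((1 - exp (- t)) * p t u x) \<le> v x * ((1 - exp (- t)) * (exp t * u x))"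
        using elim pu[of x] t by (intro mult_left_mono) auto
      also have "v x * ((1 - exp (- t)) * (exp t * u x)) = (exp t - 1) * (u x * v x)"
        by (simp add: algebra_simps exp_minus_inverse)
      finally show ?case by simp
    qed
  qed
  also have "\<dots> = (\<integral>x. (u x - p t u x) * v x \<partial>m) + (exp t - 1) * (\<integral>x. u x * v x \<partial>m)"
    using iu ip by (simp add: left_diff_distrib)
  finally have "(\<integral>x. J t h x \<partial>\<mu>) / t
      \<le> ((\<integral>x. (u x - p t u x) * v x \<partial>m) + (exp t - 1) * (\<integral>x. u x * v x \<partial>m)) / t"
    using t by (intro divide_right_mono) auto
  then show ?thesis by (simp add: add_divide_distrib)
qed

text \<open>Divide \<open>\<integral> J t h d\<mu>\<close> by \<open>t\<close> and let \<open>t \<down> 0\<close>: the quotient tends to \<open>\<integral> h d\<mu>\<close> because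
  \<open>J t h / t \<rightarrow> h\<close> boundedly and \<open>\<mu>\<close> is finite, and its upper bound tends to \<open>\<E>\<^sub>1(u, v)\<close> because \<open>\<E>\<close> is
  the form of the process.\<close>

lemma integral_le_energy:
  assumes hc: "h \<in> C_c" and h0: "\<And>x. 0 \<le> h x" and v: "v \<in> F" and le: "AE x in m. h x \<le> v x"
  shows "(\<integral>x. h x \<partial>\<mu>) \<le> E1 m E v u"
proof -
  have h: "test_fn h" using hc h0 by (rule test_fn_C_c)
  interpret \<mu>: finite_measure \<mu> by (rule finite_measure_\<mu>)
  obtain M where M: "\<And>x. \<bar>h x\<bar> \<le> M" using C_infty_bounded[OF test_fnD(1)[OF h]] by auto
  have [measurable]: "h \<in> borel_measurable borel" using C_infty_borel[OF test_fnD(1)[OF h]] .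
  define S :: "nat \<Rightarrow> real" where "S n = 1 / real (Suc n)" for n
  have S0: "S n > 0" for n by (simp add: S_def)
  have "S \<longlonglongrightarrow> 0" unfolding S_def using LIMSEQ_inverse_real_of_nat by (simp only: inverse_eq_divide)
  then have S: "filterlim S (at_right 0) sequentially"
    using S0 by (intro tendsto_imp_filterlim_at_right) auto
  define V where "V = (\<integral>x. u x * v x \<partial>m)"
  define Q where "Q t = (1 / t) * (\<integral>x. (u x - p t u x) * v x \<partial>m)" for t
  have "(\<lambda>n. \<integral>x. (1 / S n) * J (S n) h x \<partial>\<mu>) \<longlonglongrightarrow> (\<integral>x. h x \<partial>\<mu>)"
  proof (rule integral_dominated_convergence[where w="\<lambda>_. M"])
    show "AE x in \<mu>. (\<lambda>n. (1 / S n) * J (S n) h x) \<longlonglongrightarrow> h x"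
      using filterlim_compose[OF J_quotient_tendsto[OF h] S] by simp
    show "AE x in \<mu>. norm ((1 / S n) * J (S n) h x) \<le> M" for n
      using J_le[OF h M S0] J_nonneg[OF h] S0[of n] by (intro AE_I2) (simp add: field_simps)
    show "(\<lambda>x. 1 / S n * J (S n) h x) \<in> borel_measurable \<mu>" for n
      using integral_J_\<mu>(1)[OF h, of "S n"] S0[of n] by (intro borel_measurable_times) auto
  qed auto
  then have lim1: "(\<lambda>n. (1 / S n) * (\<integral>x. J (S n) h x \<partial>\<mu>)) \<longlonglongrightarrow> (\<integral>x. h x \<partial>\<mu>)" by simp
  have "((\<lambda>t. (exp t - 1) / t) \<longlongrightarrow> (1::real)) (at_right 0)"
  proof -
    have "(exp has_real_derivative 1) (at (0::real))"
      by (auto intro!: derivative_eq_intros)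
    then show ?thesis
      by (auto simp: DERIV_def intro: filterlim_at_split[THEN iffD1, THEN conjunct2])
  qed
  moreover have "(Q \<longlongrightarrow> E u v) (at_right 0)" unfolding Q_def using E_limit[OF u_F v] .
  ultimately have "((\<lambda>t. Q t + ((exp t - 1) / t) * V) \<longlongrightarrow> E u v + 1 * V) (at_right 0)"
    by (intro tendsto_add tendsto_mult tendsto_const)
  then have lim2: "(\<lambda>n. Q (S n) + ((exp (S n) - 1) / S n) * V) \<longlonglongrightarrow> E u v + 1 * V"
    using S by (rule filterlim_compose)
  have "(\<integral>x. h x \<partial>\<mu>) \<le> E u v + 1 * V"
    using J_energy_bound[OF h v le S0, folded V_def Q_def] by (intro LIMSEQ_le[OF lim1 lim2]) auto
  also have "\<dots> = E1 m E u v" by (simp add: E1_def V_def)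
  also have "\<dots> = E1 m E v u" by (rule E1_sym[OF u_F v])
  finally show ?thesis .
qed

lemma measure_open_le_energy:
  assumes A: "open A" and v: "v \<in> F" and one: "AE x in m. x \<in> A \<longrightarrow> 1 \<le> v x"
  shows "emeasure \<mu> A \<le> ennreal (sqrt (E1 m E v v * E1 m E u u))"
proof (rule emeasure_open_le[OF sets_\<mu> A])
  fix h :: "'a \<Rightarrow> real" assume h: "h \<in> C_c" "\<And>x. 0 \<le> h x" "\<And>x. h x \<le> indicator A x"
  let ?w = "\<lambda>x. min (max (v x) 0) (1::real)"
  have wF: "?w \<in> F" by (rule unit_contraction(1)[OF v])
  have le: "AE x in m. h x \<le> ?w x"
    using one
  proof eventually_elim
    case (elim x)
    show ?case using elim h(2)[of x] h(3)[of x] by (cases "x \<in> A") auto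
  qed
  have [measurable]: "h \<in> borel_measurable borel" using C_infty_borel[OF C_c_C_infty[OF h(1)]] .
  have int: "integrable \<mu> h"
  proof -
    interpret finite_measure \<mu> by (rule finite_measure_\<mu>)
    have "\<bar>h x\<bar> \<le> 1" for x using h(2)[of x] h(3)[of x] by (auto split: split_indicator_asm)
    then show ?thesis by (intro integrable_const_bound[of _ 1]) auto
  qed
  have "(\<integral>x. h x \<partial>\<mu>) \<le> E1 m E ?w u" by (rule integral_le_energy[OF h(1,2) wF le])
  also have "\<dots> \<le> sqrt ((E1 m E ?w u)\<^sup>2)" by simp
  also have "\<dots> \<le> sqrt (E1 m E ?w ?w * E1 m E u u)" by (intro real_sqrt_le_mono E1_Cauchy_Schwarz wF u_F)
  also have "\<dots> \<le> sqrt (E1 m E v v * E1 m E u u)"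
    by (intro real_sqrt_le_mono mult_right_mono E1_unit_contraction E1_nonneg u_F v)
  finally have *: "(\<integral>x. h x \<partial>\<mu>) \<le> sqrt (E1 m E v v * E1 m E u u)" .
  have "(\<integral>\<^sup>+x. ennreal (h x) \<partial>\<mu>) = ennreal (\<integral>x. h x \<partial>\<mu>)" using int h(2) by (intro nn_integral_eq_integral) auto
  also have "\<dots> \<le> ennreal (sqrt (E1 m E v v * E1 m E u u))" using * by (rule ennreal_leI)
  finally show "(\<integral>\<^sup>+x. ennreal (h x) \<partial>\<mu>) \<le> ennreal (sqrt (E1 m E v v * E1 m E u u))" .
qed

text \<open>Sets of zero capacity are null by the energy bound for open sets. As \<open>\<mu>\<close> is finite, every
  exhaustion by compact sets whose interiors cover the space is a nest.\<close>

lemma smooth: "\<mu> \<in> smooth_measures m F E"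
proof -
  have zero: "emeasure \<mu> B = 0" if B: "B \<in> sets borel" "cap m F E B = 0" for B
  proof -
    define K where "K = E1 m E u u + 1"
    have K: "K > 0" using E1_nonneg[OF u_F] by (simp add: K_def)
    have "emeasure \<mu> B \<le> 0"
    proof (rule ennreal_le_epsilon)
      fix e :: real assume e: "0 < e"
      obtain A v where A: "open A" "B \<subseteq> A" "v \<in> F" "AE x in m. x \<in> A \<longrightarrow> 1 \<le> v x" "E1 m E v v < e\<^sup>2 / K"
        using cap_zeroD[OF B(2), of "e\<^sup>2 / K"] e K by auto
      have "emeasure \<mu> B \<le> emeasure \<mu> A" using A by (intro emeasure_mono) auto
      also have "\<dots> \<le> ennreal (sqrt (E1 m E v v * E1 m E u u))" using A by (intro measure_open_le_energy)
      also have "\<dots> \<le> ennreal (sqrt (e\<^sup>2 / K * K))"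
        using A(5) e K E1_nonneg[OF u_F] E1_nonneg[OF A(3)]
        by (intro ennreal_leI real_sqrt_le_mono mult_mono) (auto simp: K_def)
      also have "sqrt (e\<^sup>2 / K * K) = e" using e K by simp
      finally show "emeasure \<mu> B \<le> 0 + ennreal e" by simp
    qed
    then show ?thesis by simp
  qed
  obtain W K :: "nat \<Rightarrow> 'a set" where WK: "\<And>n. open (W n)" "incseq W" "\<And>n. compact (K n)"
      "incseq K" "\<And>n. W n \<subseteq> K n" "(\<Union>n. W n) = UNIV"
    by (rule locally_compact_exhaustion[OF lc]) (rule that; assumption)
  have "(\<lambda>k. cap m F E (C - K k)) \<longlonglongrightarrow> 0" if C: "compact C" for C
  proof -
    obtain n where n: "C \<subseteq> W n" using compact_subset_incseq[OF C WK(1) WK(2)] WK(6) by auto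
    have "C - K k = {}" if "k \<ge> n" for k
      using n WK(2,5) that unfolding incseq_def by blast
    then have "cap m F E (C - K k) = 0" if "k \<ge> n" for k using that by (metis cap_empty)
    then have "\<forall>\<^sub>F k in sequentially. cap m F E (C - K k) = 0"
      unfolding eventually_sequentially by blast
    then show ?thesis by (rule tendsto_eventually)
  qed
  then have nest: "compact_nest m F E K" using WK by (simp add: compact_nest_def)
  have "emeasure \<mu> (K k) < \<infinity>" for k
    using emeasure_mono[of "K k" UNIV \<mu>] finite_\<mu> by auto
  then show ?thesis using zero nest unfolding smooth_measures_def by auto
qed

text \<open>Under the exponential law of rate \<open>\<alpha>\<close>, times are small with high probability. With
  \<open>c(s) = \<langle>h, P\<^sub>su\<rangle>\<close> the integral on the left is \<open>\<langle>h, u\<rangle>\<close> minus the average of \<open>c\<close>, plus \<open>1/\<alpha>\<close> times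
  that average. Strong continuity at \<open>u \<in> C\<^sub>\<infinity>\<close> controls the times up to \<open>d\<close>, and the bound \<open>M\<close> of
  \<open>u\<close> controls the rest.\<close>

lemma integral_R_\<mu>_small:
  assumes e: "e > 0"
  shows "\<exists>\<alpha>0\<ge>1. \<forall>\<alpha>\<ge>\<alpha>0. \<forall>h. test_fn h \<longrightarrow> (\<integral>x. R \<alpha> h x \<partial>\<mu>) \<le> e * (\<integral>x. h x \<partial>m)"
proof -
  obtain M0 where M0: "\<And>x. \<bar>u x\<bar> \<le> M0" using C_infty_bounded[OF u_C_infty] by auto
  define M where "M = max M0 1"
  have M: "\<And>x. \<bar>u x\<bar> \<le> M" "M > 0" using M0 by (auto simp: M_def le_max_iff_disj)
  have uM: "u x \<le> M" for x using M(1)[of x] by simp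
  obtain d where d: "d > 0" "\<And>t x. 0 \<le> t \<Longrightarrow> t \<le> d \<Longrightarrow> \<bar>p t u x - u x\<bar> \<le> e / 3"
    using p_near_0[OF u_C_infty, of "e / 3"] e by auto
  \<comment> \<open>The last two terms make \<open>M / \<alpha>\<close> and \<open>M e\<^sup>-\<^sup>\<alpha>\<^sup>d\<close> at most \<open>e / 3\<close> for \<open>\<alpha> \<ge> \<alpha>0\<close>.\<close>
  define \<alpha>0 where "\<alpha>0 = max 1 (max (3 * M / e) (3 * M / (e * d)))"
  have "(\<integral>x. R \<alpha> h x \<partial>\<mu>) \<le> e * (\<integral>x. h x \<partial>m)" if \<alpha>: "\<alpha> \<ge> \<alpha>0" and h: "test_fn h" for \<alpha> h
  proof -
    have a: "\<alpha> > 0" using \<alpha> by (simp add: \<alpha>0_def)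
    interpret prob_space "expo \<alpha>" using a by (rule prob_space_exponential_density)
    have [simp]: "prob UNIV = 1" using prob_space by simp
    have a1: "M / \<alpha> \<le> e / 3"
    proof -
      have "3 * M / e \<le> \<alpha>" using \<alpha> by (simp add: \<alpha>0_def)
      then show ?thesis using a e by (simp add: field_simps)
    qed
    have a2: "M * exp (- \<alpha> * d) \<le> e / 3"
    proof -
      have "3 * M / (e * d) \<le> \<alpha>" using \<alpha> by (simp add: \<alpha>0_def)
      then have "M \<le> e / 3 * (\<alpha> * d)" using e d by (simp add: field_simps)
      also have "\<dots> \<le> e / 3 * exp (\<alpha> * d)" using e exp_ge_add_one_self[of "\<alpha> * d"] by (intro mult_left_mono) linarith+
      finally have "M * exp (- \<alpha> * d) \<le> e / 3 * exp (\<alpha> * d) * exp (- \<alpha> * d)" by (intro mult_right_mono) auto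
      then show ?thesis by (simp add: exp_minus field_simps)
    qed
    define I where "I = (\<integral>x. h x \<partial>m)"
    have I0: "0 \<le> I" unfolding I_def using test_fnD(3)[OF h] by (intro Bochner_Integration.integral_nonneg)
    define c where "c s = (\<integral>x. p (max s 0) h x * u x \<partial>m)" for s
    obtain M' where M': "\<And>x. \<bar>h x\<bar> \<le> M'" using C_infty_bounded[OF test_fnD(1)[OF h]] by auto
    have ceq: "c s = (\<integral>x. h x * p (max s 0) u x \<partial>m)" for s
      unfolding c_def
      by (rule p_symmetric[OF _ test_fnD(2)[OF h] test_fnD(3)[OF h] _ u_borel u_nonneg]) (use M M' abs_le_D1 in \<open>auto\<close>)
    note ih = integrable_bounded_mult[OF test_fnD(2)[OF h] u_borel M(1)]
    note ihp = integrable_bounded_mult[OF test_fnD(2)[OF h] measurable_p[OF u_borel] p_bounded[OF u_borel M(1)]]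
    have av: "c \<in> borel_measurable borel" "\<And>s. \<bar>c s\<bar> \<le> M * (\<integral>x. \<bar>h x\<bar> \<partial>m)"
      unfolding c_def using p_average(3,4)[OF test_fnD(1,2)[OF h] prob_space_exponential_density[OF a], of "\<lambda>s. max s 0" u M] M by auto
    note [measurable] = av(1)
    have habs: "(\<integral>x. \<bar>h x\<bar> \<partial>m) = I" unfolding I_def using test_fnD(3)[OF h] by simp
    have ci: "integrable (expo \<alpha>) c" using av(2) habs by (intro integrable_const_bound[of _ "M * I"]) auto
    have diff: "(\<integral>x. h x * u x \<partial>m) - c s \<le> I * (e / 3) + (M * I) * indicator {d<..} s" for s
    proof -
      have "(\<integral>x. h x * u x \<partial>m) - c s = (\<integral>x. h x * u x - h x * p (max s 0) u x \<partial>m)"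
        unfolding ceq using ih ihp by simp
      also have "\<dots> \<le> (\<integral>x. h x * (e / 3 + M * indicator {d<..} s) \<partial>m)"
      proof (rule integral_mono)
        fix x
        have "u x - p (max s 0) u x \<le> e / 3 + M * indicator {d<..} s"
        proof (cases "s \<le> d")
          case True
          then have "\<bar>p (max s 0) u x - u x\<bar> \<le> e / 3" using d by (intro d(2)) auto
          then have "u x - p (max s 0) u x \<le> e / 3" by linarith
          then show ?thesis using True by simp
        next
          case False
          have "0 \<le> p (max s 0) u x" using u_nonneg by (rule p_nonneg)
          then show ?thesis using False uM[of x] e by simp
        qed
        then have "h x * (u x - p (max s 0) u x) \<le> h x * (e / 3 + M * indicator {d<..} s)"
          using test_fnD(3)[OF h] by (intro mult_left_mono)
        then show "h x * u x - h x * p (max s 0) u x \<le> h x * (e / 3 + M * indicator {d<..} s)"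
          by (simp add: right_diff_distrib)
      qed (use ih ihp test_fnD(2)[OF h] in auto)
      also have "\<dots> = I * (e / 3 + M * indicator {d<..} s)" by (simp add: I_def)
      finally show ?thesis by (simp add: algebra_simps)
    qed
    have ind: "integrable (expo \<alpha>) (\<lambda>s. indicator {d<..} s :: real)" by (intro integrable_const_bound[of _ 1]) auto
    have D: "(\<integral>x. h x * u x \<partial>m) - (\<integral>s. c s \<partial>expo \<alpha>) \<le> I * (e / 3) + (M * I) * exp (- \<alpha> * d)"
    proof -
      have "(\<integral>x. h x * u x \<partial>m) - (\<integral>s. c s \<partial>expo \<alpha>) = (\<integral>s. (\<integral>x. h x * u x \<partial>m) - c s \<partial>expo \<alpha>)"
        using ci by simp
      also have "\<dots> \<le> (\<integral>s. I * (e / 3) + (M * I) * indicator {d<..} s \<partial>expo \<alpha>)"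
        using diff ci ind by (intro integral_mono) auto
      also have "\<dots> = I * (e / 3) + (M * I) * measure (expo \<alpha>) {d<..}" using ind by simp
      finally show ?thesis using expo_tail[OF a, of d] d by simp
    qed
    have C: "(\<integral>s. c s \<partial>expo \<alpha>) \<le> M * I"
    proof -
      have "(\<integral>s. c s \<partial>expo \<alpha>) \<le> (\<integral>s. M * I \<partial>expo \<alpha>)"
        using av(2) habs ci by (intro integral_mono) (auto simp: abs_le_iff)
      then show ?thesis by simp
    qed
    have "\<alpha> * (\<integral>x. R \<alpha> h x * u x \<partial>m) = (\<integral>s. c s \<partial>expo \<alpha>)" unfolding c_def by (rule R_pairing(2)[OF h a u_borel M(1)])
    then have Req: "(\<integral>x. R \<alpha> h x * u x \<partial>m) = (\<integral>s. c s \<partial>expo \<alpha>) / \<alpha>" using a by (simp add: field_simps)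
    have "(\<integral>x. R \<alpha> h x \<partial>\<mu>) = ((\<integral>x. h x * u x \<partial>m) - (\<integral>s. c s \<partial>expo \<alpha>)) + (\<integral>s. c s \<partial>expo \<alpha>) / \<alpha>"
      unfolding integral_R_\<mu>(2)[OF h a] Req using a by (simp add: field_simps)
    also have "\<dots> \<le> (I * (e / 3) + (M * I) * exp (- \<alpha> * d)) + M * I / \<alpha>"
      using D C a by (intro add_mono divide_right_mono) auto
    also have "\<dots> = I * (e / 3 + M * exp (- \<alpha> * d) + M / \<alpha>)" by (simp add: algebra_simps)
    also have "\<dots> \<le> I * (e / 3 + e / 3 + e / 3)" using I0 a1 a2 by (intro mult_left_mono add_mono) auto
    finally show ?thesis by (simp add: I_def mult.commute)
  qed
  then show ?thesis by (intro exI[of _ \<alpha>0]) (auto simp: \<alpha>0_def)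
qed

end

section \<open>Null sets are not hit from outside a set of zero capacity\<close>

text \<open>The Cauchy--Schwarz inequality with the weights \<open>2\<^sup>-\<^sup>j\<close>, whose sum is at most \<open>2\<close>.\<close>

lemma square_sum_le_weighted:
  fixes a :: "nat \<Rightarrow> real"
  shows "(\<Sum>j<k. a j)\<^sup>2 \<le> 2 * (\<Sum>j<k. 2 ^ j * (a j)\<^sup>2)"
proof -
  have "(\<Sum>j<k. a j)\<^sup>2 = (\<Sum>j<k. sqrt ((1/2) ^ j) * (sqrt (2 ^ j) * a j))\<^sup>2"
  proof -
    have "sqrt ((1/2) ^ j) * sqrt (2 ^ j) = 1" for j
      by (simp add: real_sqrt_mult[symmetric] power_mult_distrib[symmetric])
    then have eq: "sqrt ((1/2) ^ j) * (sqrt (2 ^ j) * a j) = a j" for j by (metis mult.assoc mult_1)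
    show ?thesis by (simp only: eq)
  qed
  also have "\<dots> \<le> (\<Sum>j<k. (sqrt ((1/2) ^ j))\<^sup>2) * (\<Sum>j<k. (sqrt (2 ^ j) * a j)\<^sup>2)"
    by (rule Cauchy_Schwarz_ineq_sum)
  also have "(\<Sum>j<k. (sqrt ((1/2) ^ j))\<^sup>2) = (\<Sum>j<k. (1/2) ^ j)" by simp
  also have "(\<Sum>j<k. (sqrt (2 ^ j) * a j)\<^sup>2) = (\<Sum>j<k. 2 ^ j * (a j)\<^sup>2)" by (simp add: power_mult_distrib)
  also have "(\<Sum>j<k. (1/2) ^ j) * (\<Sum>j<k. 2 ^ j * (a j)\<^sup>2) \<le> 2 * (\<Sum>j<k. 2 ^ j * (a j)\<^sup>2)"
  proof (rule mult_right_mono)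
    have "(\<Sum>j<k. (1/2::real) ^ j) = 2 - 2 * (1/2) ^ k" by (simp add: sum_gp_strict)
    then show "(\<Sum>j<k. (1/2::real) ^ j) \<le> 2" by simp
  qed (auto intro: sum_nonneg)
  finally show ?thesis .
qed

context radon_space
begin

lemma C_c_add:
  fixes f g :: "'a \<Rightarrow> real"
  assumes "f \<in> C_c" "g \<in> C_c" shows "(\<lambda>x. f x + g x) \<in> C_c"
proof -
  have "{x. f x + g x \<noteq> 0} \<subseteq> closure {x. f x \<noteq> 0} \<union> closure {x. g x \<noteq> 0}"
  proof
    fix x assume "x \<in> {x. f x + g x \<noteq> 0}"
    then have "x \<in> {x. f x \<noteq> 0} \<or> x \<in> {x. g x \<noteq> 0}" by auto
    then show "x \<in> closure {x. f x \<noteq> 0} \<union> closure {x. g x \<noteq> 0}" 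
      using subsetD[OF closure_subset, of x "{x. f x \<noteq> 0}"] subsetD[OF closure_subset, of x "{x. g x \<noteq> 0}"] by blast
  qed
  then have "closure {x. f x + g x \<noteq> 0} \<subseteq> closure {x. f x \<noteq> 0} \<union> closure {x. g x \<noteq> 0}"
    by (intro closure_minimal) auto
  moreover have "compact (closure {x. f x \<noteq> 0} \<union> closure {x. g x \<noteq> 0})"
    using assms by (auto simp: C_c_def)
  ultimately have "compact (closure {x. f x + g x \<noteq> 0})" using compact_if_subset closed_closure by blast
  then show ?thesis using assms by (auto simp: C_c_def intro!: continuous_intros)
qed

lemma C_c_sum:
  fixes f :: "nat \<Rightarrow> 'a \<Rightarrow> real"
  assumes "\<And>j. f j \<in> C_c" shows "(\<lambda>x. \<Sum>j<k. f j x) \<in> C_c"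
proof (induction k)
  case 0 then show ?case by (simp add: C_c_def)
next
  case (Suc k) then show ?case using C_c_add[OF Suc assms[of k]] by simp
qed

text \<open>Cover \<open>B\<close> by open sets \<open>U\<^sub>j\<close> with \<open>m(U\<^sub>j) \<le> 4\<^sup>-\<^sup>j\<close>. The limit of the \<open>H\<^sub>k\<close> is the number of indices
  \<open>j\<close> with \<open>x \<in> U\<^sub>j\<close>, which is infinite on \<open>B\<close> and square integrable.\<close>

lemma C_c_blow_up_on_null_set:
  assumes B: "B \<in> null_sets m"
  obtains H :: "nat \<Rightarrow> 'a \<Rightarrow> real" where
    "\<And>k. H k \<in> C_c" "\<And>k x. 0 \<le> H k x" "\<And>x. incseq (\<lambda>k. H k x)"
    "\<And>k. (\<integral>x. (H k x)\<^sup>2 \<partial>m) \<le> 4" "\<And>x c. x \<in> B \<Longrightarrow> \<exists>k. c < H k x"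
proof -
  have "\<forall>j. \<exists>U. open U \<and> B \<subseteq> U \<and> emeasure m U \<le> ennreal ((1/4) ^ j)"
    using null_set_open_superset[OF B] by simp
  then obtain U where U: "\<And>j. open (U j)" "\<And>j. B \<subseteq> U j" "\<And>j. emeasure m (U j) \<le> ennreal ((1/4) ^ j)"
    by metis
  have "\<exists>h :: nat \<Rightarrow> 'a \<Rightarrow> real. (\<forall>n. h n \<in> C_c) \<and> (\<forall>n x. 0 \<le> h n x) \<and> (\<forall>n x. h n x \<le> indicator (U j) x) \<and>
      (\<forall>x. incseq (\<lambda>n. h n x)) \<and> (\<forall>x\<in>U j. \<exists>n. h n x = 1)" for j
  proof -
    obtain h :: "nat \<Rightarrow> 'a \<Rightarrow> real" where h:
      "\<And>n. h n \<in> C_c" "\<And>n x. 0 \<le> h n x" "\<And>n x. h n x \<le> indicator (U j) x"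
      "\<And>x. incseq (\<lambda>n. h n x)" "\<And>x. x \<in> U j \<Longrightarrow> \<exists>n. h n x = 1"
      by (rule open_indicator_approx[OF U(1)[of j]]) (rule that; assumption)
    then show ?thesis by (intro exI[of _ h]) simp
  qed
  then obtain h :: "nat \<Rightarrow> nat \<Rightarrow> 'a \<Rightarrow> real" where h:
    "\<And>j n. h j n \<in> C_c" "\<And>j n x. 0 \<le> h j n x" "\<And>j n x. h j n x \<le> indicator (U j) x"
    "\<And>j x. incseq (\<lambda>n. h j n x)" "\<And>j x. x \<in> U j \<Longrightarrow> \<exists>n. h j n x = 1" by metis
  define H where "H k x = (\<Sum>j<k. h j k x)" for k x
  have C: "H k \<in> C_c" for k unfolding H_def using h(1) by (rule C_c_sum)
  have nn: "0 \<le> H k x" for k x unfolding H_def using h(2) by (rule sum_nonneg)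
  have [measurable]: "H k \<in> borel_measurable borel" for k using C C_c_C_infty C_infty_borel by blast
  have mono: "incseq (\<lambda>k. H k x)" for x
  proof (rule incseq_SucI)
    fix k
    have "H k x \<le> (\<Sum>j<k. h j (Suc k) x)" unfolding H_def using h(4) by (intro sum_mono) (simp add: incseq_Suc_iff)
    also have "\<dots> \<le> H (Suc k) x" unfolding H_def using h(2) by simp
    finally show "H k x \<le> H (Suc k) x" .
  qed
  have sq: "(\<integral>x. (H k x)\<^sup>2 \<partial>m) \<le> 4" for k
  proof -
    have Ufin: "emeasure m (U j) < \<infinity>" for j using U(3)[of j] by (auto intro: le_less_trans)
    have Ub[measurable]: "U j \<in> sets borel" for j using U(1) by auto
    have iU: "integrable m (\<lambda>x. indicator (U j) x :: real)" for j using Ufin[of j] by (intro integrable_real_indicator) auto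
    have mU: "measure m (U j) \<le> (1/4) ^ j" for j
      using U(3)[of j] Ufin[of j] by (simp add: emeasure_eq_ennreal_measure ennreal_le_iff)
    have pt: "(H k x)\<^sup>2 \<le> 2 * (\<Sum>j<k. 2 ^ j * indicator (U j) x)" for x
    proof -
      have "(h j k x)\<^sup>2 \<le> indicator (U j) x" for j
        using h(2)[of j k x] h(3)[of j k x] by (auto simp: power_le_one split: split_indicator_asm split_indicator)
      then have "(\<Sum>j<k. 2 ^ j * (h j k x)\<^sup>2) \<le> (\<Sum>j<k. 2 ^ j * indicator (U j) x)"
        by (intro sum_mono mult_left_mono) auto
      then show ?thesis using square_sum_le_weighted[of "\<lambda>j. h j k x" k] unfolding H_def by linarith
    qed
    have "(\<integral>x. (H k x)\<^sup>2 \<partial>m) \<le> (\<integral>x. 2 * (\<Sum>j<k. 2 ^ j * indicator (U j) x) \<partial>m)"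
    proof (rule integral_mono')
      show "integrable m (\<lambda>x. 2 * (\<Sum>j<k. 2 ^ j * indicator (U j) x :: real))"
        by (intro integrable_mult_right Bochner_Integration.integrable_sum iU)
      show "0 \<le> 2 * (\<Sum>j<k. 2 ^ j * indicator (U j) x :: real)" for x
        by (intro mult_nonneg_nonneg sum_nonneg) auto
    qed (rule pt)
    also have "\<dots> = 2 * (\<Sum>j<k. \<integral>x. 2 ^ j * indicator (U j) x \<partial>m)"
      by (simp only: integral_mult_right_zero, subst Bochner_Integration.integral_sum)
        (auto intro!: integrable_mult_right iU simp del: sum_mult_indicator)
    also have "\<dots> = 2 * (\<Sum>j<k. 2 ^ j * measure m (U j))" by simp
    also have "\<dots> \<le> 2 * (\<Sum>j<k. 2 ^ j * (1/4) ^ j)" using mU by (intro mult_left_mono sum_mono) auto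
    also have "(\<Sum>j<k. 2 ^ j * (1/4) ^ j) = (\<Sum>j<k. (1/2::real) ^ j)" by (simp add: power_mult_distrib[symmetric])
    also have "\<dots> = 2 - 2 * (1/2) ^ k" by (simp add: sum_gp_strict)
    finally show ?thesis by (simp add: order_trans)
  qed
  have unb: "\<exists>k. c < H k x" if x: "x \<in> B" for x c
  proof -
    obtain N :: nat where N: "c < real N" using reals_Archimedean2 by blast
    have "\<exists>n. h j n x = 1" for j using h(5) U(2) x by blast
    then obtain n where n: "\<And>j. h j (n j) x = 1" by metis
    define k where "k = Max (insert N (n ` {..<N}))"
    have k: "N \<le> k" "\<And>j. j < N \<Longrightarrow> n j \<le> k" unfolding k_def by (intro Max_ge; simp)+
    have "real N = (\<Sum>j<N. h j (n j) x)" using n by simp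
    also have "\<dots> \<le> (\<Sum>j<N. h j k x)" using h(4) k(2) by (intro sum_mono) (simp add: incseq_def)
    also have "\<dots> \<le> (\<Sum>j<k. h j k x)" using k(1) h(2) by (intro sum_mono2) auto
    finally show ?thesis using N by (intro exI[of _ k]) (simp add: H_def)
  qed
  show ?thesis using C nn mono sq unb by (rule that)
qed

end

context feller_form
begin

lemma p_mono:
  assumes "f \<in> C_infty" "g \<in> C_infty" "\<And>x. f x \<le> g x" shows "p t f x \<le> p t g x"
proof -
  obtain M where M: "\<And>x. \<bar>f x\<bar> \<le> M" using C_infty_bounded[OF assms(1)] by auto
  obtain M' where M': "\<And>x. \<bar>g x\<bar> \<le> M'" using C_infty_bounded[OF assms(2)] by auto
  have "0 \<le> p t (\<lambda>x. g x - f x) x" using assms(3) by (intro p_nonneg) simp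
  then show ?thesis using p_diff[OF C_infty_borel[OF assms(2)] C_infty_borel[OF assms(1)] M' M, of t x] by simp
qed

lemma R_mono:
  assumes "f \<in> C_infty" "g \<in> C_infty" "\<And>x. f x \<le> g x" "\<alpha> > 0" shows "R \<alpha> f x \<le> R \<alpha> g x"
  unfolding R_def using p_integrable_expo[OF assms(1,4), of "\<lambda>s. s" x] p_integrable_expo[OF assms(2,4), of "\<lambda>s. s" x] assms
  by (intro mult_left_mono integral_mono p_mono) auto

text \<open>With \<open>d = R\<^sub>1f - R\<^sub>1g\<close> one has \<open>\<E>\<^sub>1(d, d) = \<langle>f - g, d\<rangle>\<close>, and \<open>\<integral> d\<^sup>2 dm \<le> \<E>\<^sub>1(d, d)\<close>.\<close>

lemma E1_R_diff_le:
  assumes f: "test_fn f" and g: "test_fn g" and L2: "integrable m (\<lambda>x. (f x - g x)\<^sup>2)"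
  shows "E1 m E (\<lambda>x. R 1 f x - R 1 g x) (\<lambda>x. R 1 f x - R 1 g x) \<le> (\<integral>x. (f x - g x)\<^sup>2 \<partial>m)"
proof -
  define d where "d x = R 1 f x - R 1 g x" for x
  have RF: "R 1 f \<in> F" "R 1 g \<in> F" using f g by (auto intro: R_in_F)
  have dF: "d \<in> F" unfolding d_def[abs_def] using RF by (rule F_diff)
  obtain M where M: "\<And>x. \<bar>f x\<bar> \<le> M" using C_infty_bounded[OF test_fnD(1)[OF f]] by auto
  obtain M' where M': "\<And>x. \<bar>g x\<bar> \<le> M'" using C_infty_bounded[OF test_fnD(1)[OF g]] by auto
  have bd: "\<bar>d x\<bar> \<le> M + M'" for x
  proof -
    have "f y \<le> M" "g y \<le> M'" for y using M[of y] M'[of y] by auto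
    then have "R 1 f x \<le> M" "R 1 g x \<le> M'"
      using R_le[OF test_fnD(1)[OF f], of 1 M x] R_le[OF test_fnD(1)[OF g], of 1 M' x] test_fnD(3)[OF f] test_fnD(3)[OF g] by auto
    then show ?thesis using R_nonneg[OF f, of 1 x] R_nonneg[OF g, of 1 x] unfolding d_def by linarith
  qed
  have "E1 m E d d = E1 m E (R 1 f) d - E1 m E (R 1 g) d"
    unfolding d_def[abs_def] using E1_diff[OF RF F_diff[OF RF]] .
  also have "\<dots> = (\<integral>x. f x * d x \<partial>m) - (\<integral>x. g x * d x \<partial>m)"
    using E1_R[OF f _ dF bd, of 1] E1_R[OF g _ dF bd, of 1] by simp
  also have "\<dots> = (\<integral>x. (f x - g x) * d x \<partial>m)"
    using R_pairing(1)
    by (simp add: left_diff_distrib integrable_bounded_mult[OF test_fnD(2)[OF f] F_borel[OF dF] bd]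
        integrable_bounded_mult[OF test_fnD(2)[OF g] F_borel[OF dF] bd])
  also have "\<dots> \<le> (\<integral>x. (1/2) * (f x - g x)\<^sup>2 + (1/2) * (d x)\<^sup>2 \<partial>m)"
  proof (rule integral_mono)
    show "integrable m (\<lambda>x. (f x - g x) * d x)"
      using integrable_bounded_mult[OF test_fnD(2)[OF f] F_borel[OF dF] bd]
        integrable_bounded_mult[OF test_fnD(2)[OF g] F_borel[OF dF] bd] by (simp add: left_diff_distrib)
    show "integrable m (\<lambda>x. (1/2) * (f x - g x)\<^sup>2 + (1/2) * (d x)\<^sup>2)"
      using L2 F_L2[OF dF] by (simp add: L2_def)
    show "(f x - g x) * d x \<le> (1/2) * (f x - g x)\<^sup>2 + (1/2) * (d x)\<^sup>2" for x
      using sum_squares_bound[of "f x - g x" "d x"] unfolding mult.assoc by linarith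
  qed
  also have "\<dots> = (1/2) * (\<integral>x. (f x - g x)\<^sup>2 \<partial>m) + (1/2) * (\<integral>x. (d x)\<^sup>2 \<partial>m)"
    using L2 F_L2[OF dF] by (simp add: L2_def)
  also have "\<dots> \<le> (1/2) * (\<integral>x. (f x - g x)\<^sup>2 \<partial>m) + (1/2) * E1 m E d d"
    using L2_norm_le_E1[OF dF] by simp
  finally show ?thesis by (simp add: d_def[abs_def])
qed

text \<open>Monotonicity and boundedness in \<open>L\<^sup>2\<close> make the \<open>H\<^sub>k\<close> a Cauchy sequence there, so the continuous
  functions \<open>R\<^sub>1H\<^sub>k\<close> converge in energy to some \<open>w \<in> F\<close>, which dominates all of them. Then \<open>w / c\<close>
  competes for the capacity of the open set where some \<open>R\<^sub>1H\<^sub>k\<close> exceeds \<open>c\<close>.\<close>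

lemma cap_resolvents_blow_up:
  assumes Hg: "\<And>k. test_fn (H k)" and inc: "\<And>x. incseq (\<lambda>k. H k x)"
    and sq: "\<And>k. (\<integral>x. (H k x)\<^sup>2 \<partial>m) \<le> C"
  shows "cap m F E {x. \<forall>c. \<exists>k. c < R 1 (H k) x} = 0"
proof -
  have HC: "H k \<in> C_infty" for k using Hg by (rule test_fnD)
  have Hm: "H k x \<le> H l x" if "k \<le> l" for k l x using inc that by (auto simp: incseq_def)
  have [measurable]: "H k \<in> borel_measurable borel" for k using HC by (rule C_infty_borel)
  define v where "v k = R 1 (H k)" for k
  have vF: "v k \<in> F" for k unfolding v_def using R_in_F[OF Hg] by simp
  have vm: "v k x \<le> v l x" if "k \<le> l" for k l x
    unfolding v_def using R_mono[OF HC HC Hm[OF that], of 1] by simp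
  have vc: "continuous_on UNIV (v k)" for k unfolding v_def using R_continuous[OF HC] by simp
  define q where "q k = (\<integral>x. (H k x)\<^sup>2 \<partial>m)" for k
  have sqi: "integrable m (\<lambda>x. H k x * H l x)" for k l
  proof -
    obtain M where M: "\<And>x. \<bar>H l x\<bar> \<le> M" using C_infty_bounded[OF HC[of l]] by auto
    show ?thesis by (rule integrable_bounded_mult[OF test_fnD(2)[OF Hg] _ M]) measurable
  qed
  have sqi': "integrable m (\<lambda>x. (H k x)\<^sup>2)" for k using sqi[of k k] by (simp add: power2_eq_square)
  have di: "integrable m (\<lambda>x. (H l x - H k x)\<^sup>2)" for k l
    using sqi sqi'[of k] sqi'[of l] by (simp add: power2_diff mult.assoc)
  have dle: "(\<integral>x. (H l x - H k x)\<^sup>2 \<partial>m) \<le> q l - q k" if "k \<le> l" for k l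
  proof -
    have "(\<integral>x. (H l x - H k x)\<^sup>2 \<partial>m) \<le> (\<integral>x. (H l x)\<^sup>2 - (H k x)\<^sup>2 \<partial>m)"
    proof (rule integral_mono[OF di])
      show "(H l x - H k x)\<^sup>2 \<le> (H l x)\<^sup>2 - (H k x)\<^sup>2" for x
      proof -
        have "0 \<le> H k x * (H l x - H k x)" using Hm[OF that, of x] test_fnD(3)[OF Hg] by simp
        then show ?thesis by (simp add: power2_eq_square algebra_simps)
      qed
    qed (use sqi' in auto)
    then show ?thesis using sqi' by (simp add: q_def)
  qed
  have qinc: "incseq q"
  proof (unfold incseq_def, intro allI impI)
    fix k l :: nat assume "k \<le> l"
    then have "0 \<le> q l - q k" using dle by (intro order_trans[OF Bochner_Integration.integral_nonneg dle]) auto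
    then show "q k \<le> q l" by simp
  qed
  obtain L where "q \<longlonglongrightarrow> L"
    using incseq_convergent[OF qinc, of C] sq unfolding q_def by metis
  then have "Cauchy q" by (rule LIMSEQ_imp_Cauchy)
  have "\<exists>w\<in>F. (\<lambda>n. E1 m E (\<lambda>x. v n x - w x) (\<lambda>x. v n x - w x)) \<longlonglongrightarrow> 0"
  proof (rule E1_closed[OF vF])
    fix e :: real assume "e > 0"
    then obtain N where N: "\<And>i j. i \<ge> N \<Longrightarrow> j \<ge> N \<Longrightarrow> norm (q i - q j) < e"
      using CauchyD[OF \<open>Cauchy q\<close>] by blast
    have "E1 m E (\<lambda>x. v i x - v j x) (\<lambda>x. v i x - v j x) < e" if ij: "i \<ge> N" "j \<ge> N" for i j
    proof -
      have "E1 m E (\<lambda>x. v i x - v j x) (\<lambda>x. v i x - v j x) \<le> (\<integral>x. (H i x - H j x)\<^sup>2 \<partial>m)"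
        unfolding v_def by (rule E1_R_diff_le[OF Hg Hg di])
      also have "\<dots> \<le> \<bar>q i - q j\<bar>"
      proof (cases "i \<le> j")
        case True
        have "(\<integral>x. (H i x - H j x)\<^sup>2 \<partial>m) = (\<integral>x. (H j x - H i x)\<^sup>2 \<partial>m)" by (simp add: power2_commute)
        then show ?thesis using dle[OF True] by linarith
      next
        case False then show ?thesis using dle[of j i] by linarith
      qed
      also have "\<dots> < e" using N[OF ij] by simp
      finally show ?thesis .
    qed
    then show "\<exists>N. \<forall>i\<ge>N. \<forall>j\<ge>N. E1 m E (\<lambda>x. v i x - v j x) (\<lambda>x. v i x - v j x) < e" by blast
  qed
  then obtain w where w: "w \<in> F" "(\<lambda>n. E1 m E (\<lambda>x. v n x - w x) (\<lambda>x. v n x - w x)) \<longlonglongrightarrow> 0" by blast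
  note [measurable] = F_borel[OF w(1)] F_borel[OF vF]
  have vw: "AE x in m. v k x \<le> w x" for k
  proof -
    let ?f = "\<lambda>x. (max (v k x - w x) 0)\<^sup>2"
    have il: "integrable m (\<lambda>x. (v l x - w x)\<^sup>2)" for l using F_L2[OF F_diff[OF vF w(1)]] by (simp add: L2_def)
    have fi: "integrable m ?f"
      by (rule Bochner_Integration.integrable_bound[OF il[of k]]) (auto simp: max_def)
    have "(\<integral>x. ?f x \<partial>m) \<le> 0"
    proof (rule LIMSEQ_le_const[OF w(2)], intro exI[of _ k] allI impI)
      fix l assume l: "k \<le> l"
      have "(\<integral>x. ?f x \<partial>m) \<le> (\<integral>x. (v l x - w x)\<^sup>2 \<partial>m)"
      proof (rule integral_mono[OF fi il])
        fix x
        have "\<bar>max (v k x - w x) 0\<bar> \<le> \<bar>v l x - w x\<bar>" using vm[OF l, of x] by (auto simp: max_def)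
        then show "?f x \<le> (v l x - w x)\<^sup>2" by (rule abs_le_square_iff[THEN iffD1])
      qed
      also have "\<dots> \<le> E1 m E (\<lambda>x. v l x - w x) (\<lambda>x. v l x - w x)" by (rule L2_norm_le_E1[OF F_diff[OF vF w(1)]])
      finally show "(\<integral>x. ?f x \<partial>m) \<le> E1 m E (\<lambda>x. v l x - w x) (\<lambda>x. v l x - w x)" .
    qed
    then have "(\<integral>x. ?f x \<partial>m) = 0" by (intro antisym Bochner_Integration.integral_nonneg) auto
    then have "AE x in m. ?f x = 0" using fi by (subst (asm) integral_nonneg_eq_0_iff_AE) auto
    then show ?thesis by eventually_elim (auto simp: max_def split: if_splits)
  qed
  define Z where "Z = {x. \<forall>c. \<exists>k. c < v k x}"
  have "cap m F E Z = 0"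
  proof (rule cap_zeroI)
    fix e :: real assume e: "e > 0"
    \<comment> \<open>This \<open>c\<close> satisfies both \<open>c \<ge> 1\<close> and \<open>\<E>\<^sub>1(w, w) \<le> e c\<close>, hence \<open>\<E>\<^sub>1(w, w) / c\<^sup>2 \<le> e\<close>.\<close>
    define c where "c = E1 m E w w / e + 1"
    have c1: "c \<ge> 1" using E1_nonneg[OF w(1)] e by (simp add: c_def)
    define A where "A = (\<Union>k. {x. c < v k x})"
    have "open A" unfolding A_def using vc by (intro open_UN ballI open_Collect_less) (auto intro: continuous_intros)
    moreover have "Z \<subseteq> A" by (auto simp: Z_def A_def)
    moreover have "(\<lambda>x. (1 / c) * w x) \<in> F" using w(1) by (rule F_scale)
    moreover have "AE x in m. x \<in> A \<longrightarrow> 1 \<le> (1 / c) * w x"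
    proof -
      have "AE x in m. \<forall>k. v k x \<le> w x" using vw by (simp add: AE_all_countable)
      then show ?thesis
      proof eventually_elim
        case (elim x)
        show ?case
        proof
          assume "x \<in> A"
          then obtain k where "c < v k x" by (auto simp: A_def)
          also have "v k x \<le> w x" using elim by simp
          finally show "1 \<le> (1 / c) * w x" using c1 by simp
        qed
      qed
    qed
    moreover have "E1 m E (\<lambda>x. (1 / c) * w x) (\<lambda>x. (1 / c) * w x) \<le> e"
    proof -
      have "E1 m E (\<lambda>x. (1 / c) * w x) (\<lambda>x. (1 / c) * w x) = (1 / c)\<^sup>2 * E1 m E w w" by (rule E1_scale[OF w(1)])
      also have "E1 m E w w \<le> e * c" using e by (simp add: c_def field_simps)
      also have "(1 / c)\<^sup>2 * (e * c) = e / c" using c1 by (simp add: power2_eq_square field_simps)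
      also have "\<dots> \<le> e" using c1 e by (simp add: field_simps)
      finally show ?thesis by (simp add: mult_left_mono)
    qed
    ultimately show "\<exists>A u. open A \<and> Z \<subseteq> A \<and> u \<in> F \<and> (AE x in m. x \<in> A \<longrightarrow> 1 \<le> u x) \<and> E1 m E u u \<le> e" by blast
  qed
  then show ?thesis by (simp add: Z_def v_def)
qed

text \<open>If \<open>R\<^sub>1H(x)\<close> is finite for the limit \<open>H\<close> of functions blowing up on \<open>B\<close>, then so is
  \<open>E\<^sub>x[H(X\<^sub>t)]\<close> for almost every \<open>t\<close>.\<close>

lemma null_set_not_hit:
  assumes B: "B \<in> null_sets m"
  obtains Z where "cap m F E Z = 0"
    "\<And>x. x \<notin> Z \<Longrightarrow> AE t in expo 1. AE \<omega> in P (Some x). X (ennreal t) \<omega> \<notin> Some ` B"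
proof -
  obtain H :: "nat \<Rightarrow> 'a \<Rightarrow> real" where H:
    "\<And>k. H k \<in> C_c" "\<And>k x. 0 \<le> H k x" "\<And>x. incseq (\<lambda>k. H k x)"
    "\<And>k. (\<integral>x. (H k x)\<^sup>2 \<partial>m) \<le> 4" "\<And>x c. x \<in> B \<Longrightarrow> \<exists>k. c < H k x"
    by (rule C_c_blow_up_on_null_set[OF B]) (rule that; assumption)
  have HC: "H k \<in> C_infty" for k using H(1) by (rule C_c_C_infty)
  have Hg: "test_fn (H k)" for k using H(1,2) by (rule test_fn_C_c)
  have Hm: "H k x \<le> H l x" if "k \<le> l" for k l x using H(3) that by (auto simp: incseq_def)
  have [measurable]: "H k \<in> borel_measurable borel" for k using HC by (rule C_infty_borel)
  define Z where "Z = {x. \<forall>c. \<exists>k. c < R 1 (H k) x}"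
  have "cap m F E Z = 0" unfolding Z_def by (rule cap_resolvents_blow_up[OF Hg H(3,4)])
  moreover have "AE t in expo 1. AE \<omega> in P (Some x). X (ennreal t) \<omega> \<notin> Some ` B" if x: "x \<notin> Z" for x
  proof -
    interpret e: prob_space "expo 1" by (rule prob_space_exponential_density) simp
    obtain c where c: "\<And>k. R 1 (H k) x \<le> c" using x by (auto simp: Z_def not_less)
    have em: "ennreal (p t (H k) x) = nn_trans X P t (\<lambda>x. ennreal (H k x)) x" for t k
    proof -
      obtain M where "\<And>x. \<bar>H k x\<bar> \<le> M" using C_infty_bounded[OF HC] by auto
      then have "H k y \<le> M" for y by (meson abs_le_D1)
      then show ?thesis using H(2) by (intro ennreal_p) auto
    qed
    have incp: "incseq (\<lambda>k t. ennreal (p (max t 0) (H k) x))"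
      by (intro incseq_SucI le_funI ennreal_leI p_mono HC Hm) simp
    have "(\<integral>\<^sup>+t. (SUP k. ennreal (p (max t 0) (H k) x)) \<partial>expo 1) = (SUP k. \<integral>\<^sup>+t. ennreal (p (max t 0) (H k) x) \<partial>expo 1)"
      using HC by (intro nn_integral_monotone_convergence_SUP incp) measurable
    also have "\<dots> \<le> ennreal c"
    proof (rule SUP_least)
      fix k
      have "(\<integral>\<^sup>+t. ennreal (p (max t 0) (H k) x) \<partial>expo 1) = ennreal (\<integral>t. p (max t 0) (H k) x \<partial>expo 1)"
        using p_integrable_expo[OF HC, of 1 "\<lambda>s. s"] p_nonneg[of "H k", OF H(2)] by (intro nn_integral_eq_integral) auto
      also have "\<dots> = ennreal (R 1 (H k) x)" by (simp add: R_def)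
      also have "\<dots> \<le> ennreal c" using c by (rule ennreal_leI)
      finally show "(\<integral>\<^sup>+t. ennreal (p (max t 0) (H k) x) \<partial>expo 1) \<le> ennreal c" .
    qed
    finally have "(\<integral>\<^sup>+t. (SUP k. ennreal (p (max t 0) (H k) x)) \<partial>expo 1) \<noteq> \<infinity>"
      using ennreal_less_top[of c] by (auto simp: top_unique)
    then have "AE t in expo 1. (SUP k. ennreal (p (max t 0) (H k) x)) \<noteq> \<infinity>"
      using HC by (intro nn_integral_PInf_AE) measurable
    then show ?thesis using AE_expo_pos
    proof eventually_elim
      case (elim t)
      have mono: "incseq (\<lambda>k \<omega>. ext0 (\<lambda>x. ennreal (H k x)) (X (ennreal t) \<omega>))"
      proof (intro incseq_SucI le_funI)
        fix k \<omega>
        show "ext0 (\<lambda>x. ennreal (H k x)) (X (ennreal t) \<omega>) \<le> ext0 (\<lambda>x. ennreal (H (Suc k) x)) (X (ennreal t) \<omega>)"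
          using Hm[of k "Suc k"] by (cases "X (ennreal t) \<omega>") (auto intro: ennreal_leI)
      qed
      have "(\<integral>\<^sup>+\<omega>. (SUP k. ext0 (\<lambda>x. ennreal (H k x)) (X (ennreal t) \<omega>)) \<partial>P (Some x))
          = (SUP k. \<integral>\<^sup>+\<omega>. ext0 (\<lambda>x. ennreal (H k x)) (X (ennreal t) \<omega>) \<partial>P (Some x))"
        by (intro nn_integral_monotone_convergence_SUP mono) measurable
      also have "\<dots> = (SUP k. ennreal (p (max t 0) (H k) x))" using elim by (simp add: em nn_trans_def)
      finally have "(\<integral>\<^sup>+\<omega>. (SUP k. ext0 (\<lambda>x. ennreal (H k x)) (X (ennreal t) \<omega>)) \<partial>P (Some x)) \<noteq> \<infinity>" using elim by simp
      then have "AE \<omega> in P (Some x). (SUP k. ext0 (\<lambda>x. ennreal (H k x)) (X (ennreal t) \<omega>)) \<noteq> \<infinity>"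
        by (intro nn_integral_PInf_AE) measurable
      then show ?case
      proof eventually_elim
        case (elim \<omega>)
        show ?case
        proof
          assume "X (ennreal t) \<omega> \<in> Some ` B"
          then obtain y where y: "y \<in> B" "X (ennreal t) \<omega> = Some y" by auto
          have "(SUP k. ennreal (H k y)) = top"
          proof (rule ennreal_SUP_eq_top)
            fix n :: nat
            obtain k where "real n < H k y" using H(5)[OF y(1)] by blast
            then show "\<exists>k\<in>UNIV. of_nat n \<le> ennreal (H k y)"
              by (intro bexI[of _ k]) (auto simp: ennreal_of_nat_eq_real_of_nat intro!: ennreal_leI)
          qed
          then show False using elim y by simp
        qed
      qed
    qed
  qed
  ultimately show ?thesis by (rule that)
qed

end

section \<open>The Markov property for path functionals\<close>

context hunt_space
begin

lemma natural_filt_mono: "s \<le> t \<Longrightarrow> sets (natural_filt X s) \<subseteq> sets (natural_filt X t)"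
  unfolding sets_natural_filt by (rule sigma_sets_mono') (auto intro: order_trans)

lemma space_aug_filt[simp]: "space (aug_filt X P t) = UNIV"
  by (simp add: aug_filt_def)

lemma sets_aug_filt: "sets (aug_filt X P t) = sigma_sets UNIV {\<Lambda>. \<forall>\<nu>\<in>space (prob_algebra borel_pt). \<exists>\<Lambda>'\<in>sets (natural_filt X t).
     (\<Lambda> - \<Lambda>') \<union> (\<Lambda>' - \<Lambda>) \<in> null_sets (completion (\<nu> \<bind> P))}"
  by (simp add: aug_filt_def)

lemma filtration_aug_filt: "filtration UNIV (aug_filt X P)"
proof
  fix s t :: ennreal assume "s \<le> t"
  then show "sets (aug_filt X P s) \<subseteq> sets (aug_filt X P t)"
    unfolding sets_aug_filt using natural_filt_mono[of s t] by (intro sigma_sets_mono') blast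
qed simp

lemma natural_filt_in_aug_filt: "\<Lambda> \<in> sets (natural_filt X t) \<Longrightarrow> \<Lambda> \<in> sets (aug_filt X P t)"
  unfolding sets_aug_filt by (intro sigma_sets.Basic CollectI ballI bexI[of _ \<Lambda>]) auto

lemma sets_bind_P: "\<nu> \<in> space (prob_algebra borel_pt) \<Longrightarrow> sets (\<nu> \<bind> P) = sets N"
  by (rule sets_bind'[OF _ measurable_P])

lemma space_bind_P: "\<nu> \<in> space (prob_algebra borel_pt) \<Longrightarrow> space (\<nu> \<bind> P) = UNIV"
  using sets_eq_imp_space_eq[OF sets_bind_P] by simp

text \<open>A generator of the augmented \<open>\<sigma>\<close>-algebra differs from a natural event by a null set of the given
  initial law.\<close>

lemma measurable_aug_filt_completion:
  assumes W: "W \<in> borel_measurable (aug_filt X P t)" and \<nu>: "\<nu> \<in> space (prob_algebra borel_pt)"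
  shows "W \<in> borel_measurable (completion (\<nu> \<bind> P))"
proof -
  have "sets (aug_filt X P t) \<subseteq> sets (completion (\<nu> \<bind> P))"
    unfolding sets_aug_filt
  proof (rule sets.sigma_sets_subset[where M="completion (\<nu> \<bind> P)", unfolded space_completion space_bind_P[OF \<nu>]])
    show "{\<Lambda>. \<forall>\<nu>\<in>space (prob_algebra borel_pt). \<exists>\<Lambda>'\<in>sets (natural_filt X t).
     (\<Lambda> - \<Lambda>') \<union> (\<Lambda>' - \<Lambda>) \<in> null_sets (completion (\<nu> \<bind> P))} \<subseteq> sets (completion (\<nu> \<bind> P))"
    proof
      fix \<Lambda> assume "\<Lambda> \<in> {\<Lambda>. \<forall>\<nu>\<in>space (prob_algebra borel_pt). \<exists>\<Lambda>'\<in>sets (natural_filt X t).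
         (\<Lambda> - \<Lambda>') \<union> (\<Lambda>' - \<Lambda>) \<in> null_sets (completion (\<nu> \<bind> P))}"
      then obtain \<Lambda>' where \<Lambda>': "\<Lambda>' \<in> sets (natural_filt X t)"
        and D: "(\<Lambda> - \<Lambda>') \<union> (\<Lambda>' - \<Lambda>) \<in> null_sets (completion (\<nu> \<bind> P))" using \<nu> by blast
      have "\<Lambda>' \<in> sets (\<nu> \<bind> P)"
        unfolding sets_bind_P[OF \<nu>] by (rule subsetD[OF natural_filt_mono \<Lambda>']) simp
      then have L: "\<Lambda>' \<in> sets (completion (\<nu> \<bind> P))" by simp
      note Ds = null_setsD2[OF D]
      have "(\<Lambda>' - ((\<Lambda> - \<Lambda>') \<union> (\<Lambda>' - \<Lambda>))) \<union> (((\<Lambda> - \<Lambda>') \<union> (\<Lambda>' - \<Lambda>)) - \<Lambda>') \<in> sets (completion (\<nu> \<bind> P))"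
        by (rule sets.Un[OF sets.Diff[OF L Ds] sets.Diff[OF Ds L]])
      moreover have "(\<Lambda>' - ((\<Lambda> - \<Lambda>') \<union> (\<Lambda>' - \<Lambda>))) \<union> (((\<Lambda> - \<Lambda>') \<union> (\<Lambda>' - \<Lambda>)) - \<Lambda>') = \<Lambda>" by blast
      ultimately show "\<Lambda> \<in> sets (completion (\<nu> \<bind> P))" by simp
    qed
  qed
  then show ?thesis using W
    by (auto simp: measurable_def space_bind_P[OF \<nu>])
qed

definition simple_markov :: "'w measure \<Rightarrow> bool" where
  "simple_markov Q \<longleftrightarrow> sets Q = sets N \<and> prob_space Q \<and>
     (\<forall>t s. \<forall>f\<in>borel_measurable borel_pt. \<forall>\<Lambda>\<in>sets (natural_filt X t).
        (\<integral>\<^sup>+\<omega>. indicator \<Lambda> \<omega> * f (X (t + s) \<omega>) \<partial>Q) =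
        (\<integral>\<^sup>+\<omega>. indicator \<Lambda> \<omega> * (\<integral>\<^sup>+\<omega>'. f (X s \<omega>') \<partial>P (X t \<omega>)) \<partial>Q))"

lemma simple_markovD:
  assumes "simple_markov Q" "f \<in> borel_measurable borel_pt" "\<Lambda> \<in> sets (natural_filt X t)"
  shows "(\<integral>\<^sup>+\<omega>. indicator \<Lambda> \<omega> * f (X (t + s) \<omega>) \<partial>Q) =
        (\<integral>\<^sup>+\<omega>. indicator \<Lambda> \<omega> * (\<integral>\<^sup>+\<omega>'. f (X s \<omega>') \<partial>P (X t \<omega>)) \<partial>Q)"
  using assms unfolding simple_markov_def by (elim conjE) simp

lemma measurable_path_integral[measurable]:
  assumes [measurable]: "f \<in> borel_measurable N"
  shows "(\<lambda>y. \<integral>\<^sup>+\<omega>. f \<omega> \<partial>P y) \<in> borel_measurable borel_pt"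
  using measurable_compose[OF measurable_P_subprob nn_integral_measurable_subprob_algebra[OF assms]] .

text \<open>For indicators this is the strong Markov property at a constant time; the general case follows
  by approximation with simple functions.\<close>

lemma simple_markov_bind:
  assumes \<nu>: "\<nu> \<in> space (prob_algebra borel_pt)"
  shows "simple_markov (\<nu> \<bind> P)"
  unfolding simple_markov_def
proof (intro conjI allI ballI)
  let ?Q = "\<nu> \<bind> P"
  note sQ[measurable_cong] = sets_bind_P[OF \<nu>]
  show "sets ?Q = sets N" by fact
  show "prob_space ?Q" by (rule prob_space_bind'[OF \<nu> measurable_P])
  fix t s :: ennreal and f :: "'a option \<Rightarrow> ennreal" and \<Lambda>
  assume f: "f \<in> borel_measurable borel_pt" and \<Lambda>: "\<Lambda> \<in> sets (natural_filt X t)"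
  have \<Lambda>N[measurable]: "\<Lambda> \<in> sets N" by (rule subsetD[OF natural_filt_mono \<Lambda>]) simp
  have st: "stopping_time (aug_filt X P) (\<lambda>_. t)" by (rule stopping_time_const)
  have pre: "\<Lambda> \<in> sets (filtration.pre_sigma UNIV (aug_filt X P) (\<lambda>_. t))"
  proof (rule filtration.sets_pre_sigmaI[OF filtration_aug_filt st])
    fix r
    show "{\<omega> \<in> \<Lambda>. t \<le> r} \<in> sets (aug_filt X P r)"
      using natural_filt_in_aug_filt[OF \<Lambda>] filtration.sets_F_mono[OF filtration_aug_filt, of t r]
      by (cases "t \<le> r") auto
  qed
  have SM: "\<forall>\<nu>\<in>space (prob_algebra borel_pt). \<forall>\<sigma>. stopping_time (aug_filt X P) \<sigma> \<longrightarrow>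
        (\<forall>s. \<forall>B\<in>sets borel_pt. \<forall>\<Lambda>\<in>sets (filtration.pre_sigma UNIV (aug_filt X P) \<sigma>).
           emeasure (completion (\<nu> \<bind> P)) {\<omega>\<in>\<Lambda>. X (\<sigma> \<omega> + s) \<omega> \<in> B} =
           (\<integral>\<^sup>+\<omega>\<in>\<Lambda>. emeasure (P (X (\<sigma> \<omega>) \<omega>)) {\<omega>'. X s \<omega>' \<in> B} \<partial>completion (\<nu> \<bind> P)))"
    using hunt unfolding hunt_process_def by (elim conjE)
  have indB: "(\<integral>\<^sup>+\<omega>. indicator \<Lambda> \<omega> * indicator B (X (t + s) \<omega>) \<partial>?Q)
      = (\<integral>\<^sup>+\<omega>. indicator \<Lambda> \<omega> * (\<integral>\<^sup>+\<omega>'. indicator B (X s \<omega>') \<partial>P (X t \<omega>)) \<partial>?Q)"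
    if B[measurable]: "B \<in> sets borel_pt" for B
  proof -
    have m: "{\<omega>\<in>\<Lambda>. X (t + s) \<omega> \<in> B} \<in> sets ?Q"
    proof -
      have "\<Lambda> \<inter> (X (t + s) -` B \<inter> space N) \<in> sets N" by measurable
      moreover have "\<Lambda> \<inter> (X (t + s) -` B \<inter> space N) = {\<omega>\<in>\<Lambda>. X (t + s) \<omega> \<in> B}" by auto
      ultimately show ?thesis using sQ by simp
    qed
    have m2: "{\<omega>'. X s \<omega>' \<in> B} \<in> sets N"
    proof -
      have "X s -` B \<inter> space N \<in> sets N" by measurable
      then show ?thesis by (simp add: vimage_def)
    qed
    have "(\<integral>\<^sup>+\<omega>. indicator \<Lambda> \<omega> * indicator B (X (t + s) \<omega>) \<partial>?Q) = (\<integral>\<^sup>+\<omega>. indicator {\<omega>\<in>\<Lambda>. X (t + s) \<omega> \<in> B} \<omega> \<partial>?Q)"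
      by (intro nn_integral_cong) (auto split: split_indicator)
    also have "\<dots> = emeasure (completion ?Q) {\<omega>\<in>\<Lambda>. X (t + s) \<omega> \<in> B}" using m by simp
    also have "\<dots> = (\<integral>\<^sup>+\<omega>\<in>\<Lambda>. emeasure (P (X t \<omega>)) {\<omega>'. X s \<omega>' \<in> B} \<partial>completion ?Q)"
      using SM[rule_format, OF \<nu> st B pre, of s] .
    also have "\<dots> = (\<integral>\<^sup>+\<omega>. emeasure (P (X t \<omega>)) {\<omega>'. X s \<omega>' \<in> B} * indicator \<Lambda> \<omega> \<partial>?Q)"
      by (rule nn_integral_completion)
    also have "\<dots> = (\<integral>\<^sup>+\<omega>. indicator \<Lambda> \<omega> * (\<integral>\<^sup>+\<omega>'. indicator B (X s \<omega>') \<partial>P (X t \<omega>)) \<partial>?Q)"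
    proof (intro nn_integral_cong)
      fix \<omega>
      have "(\<integral>\<^sup>+\<omega>'. indicator B (X s \<omega>') \<partial>P (X t \<omega>)) = (\<integral>\<^sup>+\<omega>'. indicator {\<omega>'. X s \<omega>' \<in> B} \<omega>' \<partial>P (X t \<omega>))"
        by (intro nn_integral_cong) (auto split: split_indicator)
      also have "\<dots> = emeasure (P (X t \<omega>)) {\<omega>'. X s \<omega>' \<in> B}" using m2 by simp
      finally show "emeasure (P (X t \<omega>)) {\<omega>'. X s \<omega>' \<in> B} * indicator \<Lambda> \<omega>
          = indicator \<Lambda> \<omega> * (\<integral>\<^sup>+\<omega>'. indicator B (X s \<omega>') \<partial>P (X t \<omega>))" by (simp add: mult.commute)
    qed
    finally show ?thesis .
  qed
  show "(\<integral>\<^sup>+\<omega>. indicator \<Lambda> \<omega> * f (X (t + s) \<omega>) \<partial>?Q) =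
        (\<integral>\<^sup>+\<omega>. indicator \<Lambda> \<omega> * (\<integral>\<^sup>+\<omega>'. f (X s \<omega>') \<partial>P (X t \<omega>)) \<partial>?Q)"
    using f
  proof (induction rule: borel_measurable_induct)
    case (cong f g)
    then have "f = g" by auto
    with cong show ?case by simp
  next
    case (set A) then show ?case by (rule indB)
  next
    case (mult u c)
    note [measurable] = mult.hyps(2)
    have "(\<integral>\<^sup>+\<omega>. indicator \<Lambda> \<omega> * (c * u (X (t + s) \<omega>)) \<partial>?Q) = c * (\<integral>\<^sup>+\<omega>. indicator \<Lambda> \<omega> * u (X (t + s) \<omega>) \<partial>?Q)"
      by (subst nn_integral_cmult[symmetric]) (measurable, simp add: mult_ac)
    also have "\<dots> = c * (\<integral>\<^sup>+\<omega>. indicator \<Lambda> \<omega> * (\<integral>\<^sup>+\<omega>'. u (X s \<omega>') \<partial>P (X t \<omega>)) \<partial>?Q)" using mult by simp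
    also have "\<dots> = (\<integral>\<^sup>+\<omega>. indicator \<Lambda> \<omega> * (\<integral>\<^sup>+\<omega>'. c * u (X s \<omega>') \<partial>P (X t \<omega>)) \<partial>?Q)"
      by (subst nn_integral_cmult[symmetric]) (measurable, simp add: nn_integral_cmult mult_ac)
    finally show ?case .
  next
    case (add u v)
    note [measurable] = add.hyps(1) add.hyps(3)
    have "(\<integral>\<^sup>+\<omega>. indicator \<Lambda> \<omega> * (v (X (t + s) \<omega>) + u (X (t + s) \<omega>)) \<partial>?Q)
        = (\<integral>\<^sup>+\<omega>. indicator \<Lambda> \<omega> * v (X (t + s) \<omega>) \<partial>?Q) + (\<integral>\<^sup>+\<omega>. indicator \<Lambda> \<omega> * u (X (t + s) \<omega>) \<partial>?Q)"
      by (subst nn_integral_add[symmetric]) (measurable, simp add: distrib_left)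
    also have "\<dots> = (\<integral>\<^sup>+\<omega>. indicator \<Lambda> \<omega> * (\<integral>\<^sup>+\<omega>'. v (X s \<omega>') \<partial>P (X t \<omega>)) \<partial>?Q)
        + (\<integral>\<^sup>+\<omega>. indicator \<Lambda> \<omega> * (\<integral>\<^sup>+\<omega>'. u (X s \<omega>') \<partial>P (X t \<omega>)) \<partial>?Q)" using add by simp
    also have "\<dots> = (\<integral>\<^sup>+\<omega>. indicator \<Lambda> \<omega> * (\<integral>\<^sup>+\<omega>'. v (X s \<omega>') + u (X s \<omega>') \<partial>P (X t \<omega>)) \<partial>?Q)"
      by (subst nn_integral_add[symmetric]) (measurable, simp add: nn_integral_add distrib_left)
    finally show ?case .
  next
    case (seq U)
    note [measurable] = seq.hyps(1)
    have inc: "incseq (\<lambda>i. U i y)" for y using seq.hyps(3) by (auto simp: incseq_def le_fun_def)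
    have "(\<integral>\<^sup>+\<omega>. indicator \<Lambda> \<omega> * (SUP i. U i (X (t + s) \<omega>)) \<partial>?Q)
        = (\<integral>\<^sup>+\<omega>. (SUP i. indicator \<Lambda> \<omega> * U i (X (t + s) \<omega>)) \<partial>?Q)"
      by (simp add: SUP_mult_left_ennreal)
    also have "\<dots> = (SUP i. \<integral>\<^sup>+\<omega>. indicator \<Lambda> \<omega> * U i (X (t + s) \<omega>) \<partial>?Q)"
      using inc by (intro nn_integral_monotone_convergence_SUP) (measurable, auto simp: incseq_def le_fun_def intro!: mult_left_mono)
    also have "\<dots> = (SUP i. \<integral>\<^sup>+\<omega>. indicator \<Lambda> \<omega> * (\<integral>\<^sup>+\<omega>'. U i (X s \<omega>') \<partial>P (X t \<omega>)) \<partial>?Q)"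
      using seq.IH by simp
    also have "\<dots> = (\<integral>\<^sup>+\<omega>. (SUP i. indicator \<Lambda> \<omega> * (\<integral>\<^sup>+\<omega>'. U i (X s \<omega>') \<partial>P (X t \<omega>))) \<partial>?Q)"
      using inc by (intro nn_integral_monotone_convergence_SUP[symmetric])
        (measurable, auto simp: incseq_def le_fun_def intro!: mult_left_mono nn_integral_mono)
    also have "\<dots> = (\<integral>\<^sup>+\<omega>. indicator \<Lambda> \<omega> * (\<integral>\<^sup>+\<omega>'. (SUP i. U i (X s \<omega>')) \<partial>P (X t \<omega>)) \<partial>?Q)"
    proof (intro nn_integral_cong)
      fix \<omega>
      have "(\<integral>\<^sup>+\<omega>'. (SUP i. U i (X s \<omega>')) \<partial>P (X t \<omega>)) = (SUP i. \<integral>\<^sup>+\<omega>'. U i (X s \<omega>') \<partial>P (X t \<omega>))"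
        using inc by (intro nn_integral_monotone_convergence_SUP) (measurable, auto simp: incseq_def le_fun_def)
      then show "(SUP i. indicator \<Lambda> \<omega> * (\<integral>\<^sup>+\<omega>'. U i (X s \<omega>') \<partial>P (X t \<omega>)))
          = indicator \<Lambda> \<omega> * (\<integral>\<^sup>+\<omega>'. (SUP i. U i (X s \<omega>')) \<partial>P (X t \<omega>))"
        by (simp add: SUP_mult_left_ennreal)
    qed
    finally show ?case by (simp add: image_comp)
  qed
qed

text \<open>The law of a process with the simple Markov property is determined by its initial law: the
  probability of a cylinder set is computed by peeling off the earliest time.\<close>

primrec cyl :: "(ennreal \<Rightarrow> 'a option set) \<Rightarrow> ennreal \<Rightarrow> ennreal list \<Rightarrow> 'a option \<Rightarrow> ennreal" where
  "cyl B t [] = (\<lambda>y. 1)"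
| "cyl B t (r # ts) = (\<lambda>y. \<integral>\<^sup>+\<omega>. indicator (B r) (X (r - t) \<omega>) * cyl B r ts (X (r - t) \<omega>) \<partial>P y)"

lemma measurable_cyl[measurable]:
  assumes [measurable]: "\<And>r. B r \<in> sets borel_pt"
  shows "cyl B t ts \<in> borel_measurable borel_pt"
proof (induction ts arbitrary: t)
  case (Cons r ts)
  note [measurable] = Cons
  show ?case by simp
qed simp

lemma cylinder_in_natural:
  assumes [measurable]: "\<And>r. B r \<in> sets borel_pt" and "finite I" "\<And>r. r \<in> I \<Longrightarrow> r \<le> t"
  shows "{\<omega>. \<forall>r\<in>I. X r \<omega> \<in> B r} \<in> sets (natural_filt X t)"
proof (cases "I = {}")
  case True then show ?thesis using sets.top[of "natural_filt X t"] by simp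
next
  case False
  have "(\<Inter>r\<in>I. X r -` B r \<inter> space (natural_filt X t)) \<in> sets (natural_filt X t)"
    using assms False by (intro sets.finite_INT measurable_sets[OF measurable_coord]) auto
  moreover have "(\<Inter>r\<in>I. X r -` B r \<inter> space (natural_filt X t)) = {\<omega>. \<forall>r\<in>I. X r \<omega> \<in> B r}" using False by auto
  ultimately show ?thesis by simp
qed

lemma cylinder_formula:
  assumes Q: "simple_markov Q" and B[measurable]: "\<And>r. B r \<in> sets borel_pt"
    and "sorted (t # ts)" "\<Lambda> \<in> sets (natural_filt X t)"
  shows "emeasure Q (\<Lambda> \<inter> {\<omega>. \<forall>r\<in>set ts. X r \<omega> \<in> B r}) = (\<integral>\<^sup>+\<omega>. indicator \<Lambda> \<omega> * cyl B t ts (X t \<omega>) \<partial>Q)"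
  using assms(3,4)
proof (induction ts arbitrary: t \<Lambda>)
  case Nil
  have "\<Lambda> \<in> sets Q" using Q subsetD[OF natural_filt_mono[of t \<infinity>] Nil(2)] by (simp add: simple_markov_def)
  then show ?case by simp
next
  case (Cons r ts)
  have tr: "t \<le> r" and s: "sorted (r # ts)" using Cons.prems(1) by auto
  have r: "t + (r - t) = r" using tr by (simp add: add_diff_inverse_ennreal)
  let ?\<Lambda> = "\<Lambda> \<inter> (X r -` B r)"
  have \<Lambda>r: "\<Lambda> \<in> sets (natural_filt X r)" using natural_filt_mono[OF tr] Cons.prems(2) by blast
  have "X r -` B r \<inter> space (natural_filt X r) \<in> sets (natural_filt X r)"
    by (rule measurable_sets[OF measurable_coord B]) simp
  then have \<Lambda>': "?\<Lambda> \<in> sets (natural_filt X r)" using \<Lambda>r by auto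
  have "\<Lambda> \<inter> {\<omega>. \<forall>q\<in>set (r # ts). X q \<omega> \<in> B q} = ?\<Lambda> \<inter> {\<omega>. \<forall>q\<in>set ts. X q \<omega> \<in> B q}" by auto
  then have "emeasure Q (\<Lambda> \<inter> {\<omega>. \<forall>q\<in>set (r # ts). X q \<omega> \<in> B q}) = (\<integral>\<^sup>+\<omega>. indicator ?\<Lambda> \<omega> * cyl B r ts (X r \<omega>) \<partial>Q)"
    using Cons.IH[OF s \<Lambda>'] by simp
  also have "\<dots> = (\<integral>\<^sup>+\<omega>. indicator \<Lambda> \<omega> * (\<lambda>y. indicator (B r) y * cyl B r ts y) (X (t + (r - t)) \<omega>) \<partial>Q)"
    unfolding r by (intro nn_integral_cong) (auto split: split_indicator)
  also have "\<dots> = (\<integral>\<^sup>+\<omega>. indicator \<Lambda> \<omega> * (\<integral>\<^sup>+\<omega>'. (\<lambda>y. indicator (B r) y * cyl B r ts y) (X (r - t) \<omega>') \<partial>P (X t \<omega>)) \<partial>Q)"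
  proof -
    have "(\<lambda>y. indicator (B r) y * cyl B r ts y) \<in> borel_measurable borel_pt" by measurable
    from simple_markovD[OF Q this Cons.prems(2)] show ?thesis .
  qed
  finally show ?case by simp
qed

lemma simple_markov_unique:
  assumes Q1: "simple_markov Q1" and Q2: "simple_markov Q2"
    and init: "distr Q1 borel_pt (X 0) = distr Q2 borel_pt (X 0)"
  shows "Q1 = Q2"
proof -
  let ?E = "{{\<omega>. \<forall>r\<in>I. X r \<omega> \<in> B r} | I B. finite I \<and> (\<forall>r. B r \<in> sets borel_pt)}"
  have s1: "sets Q1 = sets N" and s2: "sets Q2 = sets N" using Q1 Q2 by (auto simp: simple_markov_def)
  have sN: "sets N = sigma_sets UNIV ?E"
  proof
    show "sets N \<subseteq> sigma_sets UNIV ?E"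
      unfolding sets_natural_filt
    proof (rule sigma_sets_mono, safe)
      fix s :: ennreal and B :: "'a option set" assume "B \<in> sets borel_pt"
      then have "{\<omega>. \<forall>r\<in>{s}. X r \<omega> \<in> (\<lambda>_. B) r} \<in> ?E" by (intro CollectI exI[of _ "{s}"] exI[of _ "\<lambda>_. B"]) auto
      then have "X s -` B \<in> ?E" by (simp add: vimage_def)
      then show "X s -` B \<in> sigma_sets UNIV ?E" by (rule sigma_sets.Basic)
    qed
    show "sigma_sets UNIV ?E \<subseteq> sets N"
    proof (rule sets.sigma_sets_subset[where M=N, unfolded space_natural_filt], safe)
      fix I :: "ennreal set" and B :: "ennreal \<Rightarrow> 'a option set" assume "finite I" "\<forall>r. B r \<in> sets borel_pt"
      then show "{\<omega>. \<forall>r\<in>I. X r \<omega> \<in> B r} \<in> sets N" by (intro cylinder_in_natural) auto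
    qed
  qed
  have eval: "emeasure Q {\<omega>. \<forall>r\<in>I. X r \<omega> \<in> B r} = (\<integral>\<^sup>+y. cyl B 0 (sorted_list_of_set I) y \<partial>distr Q borel_pt (X 0))"
    if Q: "simple_markov Q" and I: "finite I" "\<And>r. B r \<in> sets borel_pt" for Q I B
  proof -
    have "emeasure Q (UNIV \<inter> {\<omega>. \<forall>r\<in>set (sorted_list_of_set I). X r \<omega> \<in> B r})
        = (\<integral>\<^sup>+\<omega>. indicator UNIV \<omega> * cyl B 0 (sorted_list_of_set I) (X 0 \<omega>) \<partial>Q)"
      using sets.top[of "natural_filt X 0"] by (intro cylinder_formula Q I) auto
    moreover have "sets Q = sets N" using Q by (simp add: simple_markov_def)
    then have "X 0 \<in> Q \<rightarrow>\<^sub>M borel_pt"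
      by (subst measurable_cong_sets[OF _ refl]) (assumption, rule measurable_X)
    then have "(\<integral>\<^sup>+y. cyl B 0 (sorted_list_of_set I) y \<partial>distr Q borel_pt (X 0))
        = (\<integral>\<^sup>+\<omega>. cyl B 0 (sorted_list_of_set I) (X 0 \<omega>) \<partial>Q)"
      by (rule nn_integral_distr) (use I in simp)
    ultimately show ?thesis using I by simp
  qed
  show ?thesis
  proof (rule measure_eqI_generator_eq[where E="?E" and \<Omega>=UNIV and A="\<lambda>_. UNIV"])
    show "Int_stable ?E"
    proof (rule Int_stableI, safe)
      fix I J :: "ennreal set" and B C :: "ennreal \<Rightarrow> 'a option set"
      assume *: "finite I" "\<forall>r. B r \<in> sets borel_pt" "finite J" "\<forall>r. C r \<in> sets borel_pt"
      let ?D = "\<lambda>r. (if r \<in> I then B r else UNIV) \<inter> (if r \<in> J then C r else UNIV)"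
      have "?D r \<in> sets borel_pt" for r using * sets.top[of borel_pt] by (intro sets.Int) auto
      moreover have "{\<omega>. \<forall>r\<in>I. X r \<omega> \<in> B r} \<inter> {\<omega>. \<forall>r\<in>J. X r \<omega> \<in> C r} = {\<omega>. \<forall>r\<in>I \<union> J. X r \<omega> \<in> ?D r}" by auto
      ultimately show "\<exists>I' B'. {\<omega>. \<forall>r\<in>I. X r \<omega> \<in> B r} \<inter> {\<omega>. \<forall>r\<in>J. X r \<omega> \<in> C r} = {\<omega>. \<forall>r\<in>I'. X r \<omega> \<in> B' r} \<and>
          finite I' \<and> (\<forall>r. B' r \<in> sets borel_pt)"
        using * by (intro exI[of _ "I \<union> J"] exI[of _ ?D]) auto
    qed
    show "emeasure Q1 S = emeasure Q2 S" if "S \<in> ?E" for S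
    proof -
      from that obtain I :: "ennreal set" and B :: "ennreal \<Rightarrow> 'a option set"
        where S: "S = {\<omega>. \<forall>r\<in>I. X r \<omega> \<in> B r}" "finite I" "\<And>r. B r \<in> sets borel_pt" by blast
      show ?thesis unfolding S(1) eval[OF Q1 S(2,3)] eval[OF Q2 S(2,3)] init ..
    qed
    have "UNIV = {\<omega>. \<forall>r\<in>{}. X r \<omega> \<in> (\<lambda>_. {}) r}" by simp
    then have "UNIV \<in> ?E" by (intro CollectI exI[of _ "{}"] exI[of _ "\<lambda>_. {}"]) auto
    then show "range (\<lambda>_. UNIV) \<subseteq> ?E" by blast
    show "emeasure Q1 UNIV \<noteq> \<infinity>"
      using Q1 prob_space.emeasure_space_1[of Q1] sets_eq_imp_space_eq[OF s1] by (simp add: simple_markov_def)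
  qed (use s1 s2 sN in auto)
qed

lemma shift_coord: "X s (\<theta> t \<omega>) = X (s + t) \<omega>"
proof -
  have "\<forall>s t \<omega>. X s (\<theta> t \<omega>) = X (s + t) \<omega>"
    using hunt unfolding hunt_process_def by (elim conjE)
  then show ?thesis by blast
qed

lemma measurable_shift: "\<theta> t \<in> natural_filt X (u + t) \<rightarrow>\<^sub>M natural_filt X u"
  unfolding natural_filt_def[of X u]
proof (rule measurable_measure_of)
  fix S assume "S \<in> {X s -` B | s B. s \<le> u \<and> B \<in> sets borel_pt}"
  then obtain s B where S: "S = X s -` B" "s \<le> u" "B \<in> sets borel_pt" by blast
  have "\<theta> t -` S \<inter> space (natural_filt X (u + t)) = X (s + t) -` B \<inter> space (natural_filt X (u + t))"
    by (auto simp: S shift_coord)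
  moreover have "X (s + t) -` B \<inter> space (natural_filt X (u + t)) \<in> sets (natural_filt X (u + t))"
    using S by (intro measurable_sets[OF measurable_coord]) (auto intro: add_right_mono)
  ultimately show "\<theta> t -` S \<inter> space (natural_filt X (u + t)) \<in> sets (natural_filt X (u + t))" by simp
qed auto

lemma measurable_shift_N[measurable]: "\<theta> t \<in> N \<rightarrow>\<^sub>M N"
  using measurable_shift[of t \<infinity>] by simp

text \<open>Both sides have the simple Markov property and the same initial law, the law of \<open>X\<^sub>t\<close>.\<close>

theorem markov_property:
  assumes "\<nu> \<in> space (prob_algebra borel_pt)"
  shows "distr (\<nu> \<bind> P) N (\<theta> t) = distr (\<nu> \<bind> P) borel_pt (X t) \<bind> P"
proof -
  let ?Q = "\<nu> \<bind> P"
  note sQ[measurable_cong] = sets_bind_P[OF assms]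
  have Q: "simple_markov ?Q" by (rule simple_markov_bind[OF assms])
  then have pQ: "prob_space ?Q" by (simp add: simple_markov_def)
  have Xm[measurable]: "X s \<in> ?Q \<rightarrow>\<^sub>M borel_pt" for s by measurable
  have \<nu>': "distr ?Q borel_pt (X t) \<in> space (prob_algebra borel_pt)"
    using prob_space.prob_space_distr[OF pQ Xm] by (simp add: space_prob_algebra)
  have \<theta>Q: "\<theta> t \<in> ?Q \<rightarrow>\<^sub>M N" by measurable
  show ?thesis
  proof (rule simple_markov_unique)
    show "simple_markov (distr ?Q borel_pt (X t) \<bind> P)" by (rule simple_markov_bind[OF \<nu>'])
    show "simple_markov (distr ?Q N (\<theta> t))"
      unfolding simple_markov_def
    proof (intro conjI allI ballI)
      show "prob_space (distr ?Q N (\<theta> t))" by (rule prob_space.prob_space_distr[OF pQ \<theta>Q])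
      fix u s :: ennreal and f :: "'a option \<Rightarrow> ennreal" and \<Lambda>
      assume f[measurable]: "f \<in> borel_measurable borel_pt" and \<Lambda>: "\<Lambda> \<in> sets (natural_filt X u)"
      have [measurable]: "\<Lambda> \<in> sets N" by (rule subsetD[OF natural_filt_mono \<Lambda>]) simp
      have \<Lambda>': "\<theta> t -` \<Lambda> \<in> sets (natural_filt X (u + t))"
        using measurable_sets[OF measurable_shift \<Lambda>, of t] by simp
      have "(\<integral>\<^sup>+\<omega>. indicator \<Lambda> \<omega> * f (X (u + s) \<omega>) \<partial>distr ?Q N (\<theta> t))
          = (\<integral>\<^sup>+\<omega>. indicator \<Lambda> (\<theta> t \<omega>) * f (X (u + s) (\<theta> t \<omega>)) \<partial>?Q)"
        using \<theta>Q by (subst nn_integral_distr) measurable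
      also have "\<dots> = (\<integral>\<^sup>+\<omega>. indicator (\<theta> t -` \<Lambda>) \<omega> * f (X ((u + t) + s) \<omega>) \<partial>?Q)"
        by (intro nn_integral_cong) (simp add: shift_coord indicator_def add_ac)
      also have "\<dots> = (\<integral>\<^sup>+\<omega>. indicator (\<theta> t -` \<Lambda>) \<omega> * (\<integral>\<^sup>+\<omega>'. f (X s \<omega>') \<partial>P (X (u + t) \<omega>)) \<partial>?Q)"
        by (rule simple_markovD[OF Q f \<Lambda>'])
      also have "\<dots> = (\<integral>\<^sup>+\<omega>. indicator \<Lambda> (\<theta> t \<omega>) * (\<integral>\<^sup>+\<omega>'. f (X s \<omega>') \<partial>P (X u (\<theta> t \<omega>))) \<partial>?Q)"
        by (intro nn_integral_cong) (simp add: shift_coord indicator_def)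
      also have "\<dots> = (\<integral>\<^sup>+\<omega>. indicator \<Lambda> \<omega> * (\<integral>\<^sup>+\<omega>'. f (X s \<omega>') \<partial>P (X u \<omega>)) \<partial>distr ?Q N (\<theta> t))"
        using \<theta>Q by (subst nn_integral_distr) measurable
      finally show "(\<integral>\<^sup>+\<omega>. indicator \<Lambda> \<omega> * f (X (u + s) \<omega>) \<partial>distr ?Q N (\<theta> t))
          = (\<integral>\<^sup>+\<omega>. indicator \<Lambda> \<omega> * (\<integral>\<^sup>+\<omega>'. f (X s \<omega>') \<partial>P (X u \<omega>)) \<partial>distr ?Q N (\<theta> t))" .
    qed simp
    show "distr (distr ?Q N (\<theta> t)) borel_pt (X 0) = distr (distr ?Q borel_pt (X t) \<bind> P) borel_pt (X 0)"
    proof (rule measure_eqI)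
      fix B assume "B \<in> sets (distr (distr ?Q N (\<theta> t)) borel_pt (X 0))"
      then have B[measurable]: "B \<in> sets borel_pt" by simp
      have "emeasure (distr (distr ?Q N (\<theta> t)) borel_pt (X 0)) B = emeasure (distr ?Q borel_pt (X t)) B"
      proof -
        have "distr (distr ?Q N (\<theta> t)) borel_pt (X 0) = distr ?Q borel_pt (X 0 \<circ> \<theta> t)"
          by (rule distr_distr[OF measurable_X \<theta>Q])
        also have "X 0 \<circ> \<theta> t = X t" by (auto simp: shift_coord)
        finally show ?thesis by simp
      qed
      moreover have "emeasure (distr (distr ?Q borel_pt (X t) \<bind> P) borel_pt (X 0)) B = emeasure (distr ?Q borel_pt (X t)) B"
      proof -
        let ?\<nu> = "distr ?Q borel_pt (X t)"
        note sQ'[measurable_cong] = sets_bind_P[OF \<nu>']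
        have Xm': "X 0 \<in> (?\<nu> \<bind> P) \<rightarrow>\<^sub>M borel_pt" by measurable
        have PM: "P \<in> ?\<nu> \<rightarrow>\<^sub>M subprob_algebra N" by measurable
        have "emeasure (distr (?\<nu> \<bind> P) borel_pt (X 0)) B = (\<integral>\<^sup>+y. indicator B y \<partial>distr (?\<nu> \<bind> P) borel_pt (X 0))" by simp
        also have "\<dots> = (\<integral>\<^sup>+\<omega>. indicator B (X 0 \<omega>) \<partial>(?\<nu> \<bind> P))"
          using Xm' by (subst nn_integral_distr) measurable
        also have "\<dots> = (\<integral>\<^sup>+y. \<integral>\<^sup>+\<omega>. indicator B (X 0 \<omega>) \<partial>P y \<partial>?\<nu>)"
          by (rule nn_integral_bind[OF _ PM]) measurable
        also have "\<dots> = (\<integral>\<^sup>+y. indicator B y \<partial>?\<nu>)"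
        proof (intro nn_integral_cong)
          fix y
          have "(\<integral>\<^sup>+\<omega>. indicator B (X 0 \<omega>) \<partial>P y) = (\<integral>\<^sup>+\<omega>. indicator B y \<partial>P y)"
            using X0[of y] by (intro nn_integral_cong_AE) auto
          then show "(\<integral>\<^sup>+\<omega>. indicator B (X 0 \<omega>) \<partial>P y) = indicator B y" by simp
        qed
        finally show ?thesis by simp
      qed
      ultimately show "emeasure (distr (distr ?Q N (\<theta> t)) borel_pt (X 0)) B
          = emeasure (distr (distr ?Q borel_pt (X t) \<bind> P) borel_pt (X 0)) B" by simp
    qed simp
  qed
qed

end

section \<open>The resolvent as an occupation integral\<close>

text \<open>Vanishing at infinity is continuity at the added point: a neighbourhood of \<open>0\<close> has preimage
  with compact complement.\<close>

lemma continuous_map_ext0: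
  fixes f :: "'a::t2_space \<Rightarrow> real"
  assumes "f \<in> C_infty" shows "continuous_map top_pt euclidean (ext0 f)"
  unfolding continuous_map_def
proof (intro conjI allI impI)
  have top: "topspace (top_pt :: 'a option topology) = UNIV"
    unfolding top_pt_def topspace_Alexandroff_compactification by (auto simp: UNIV_option_conv)
  show "ext0 f \<in> topspace top_pt \<rightarrow> topspace euclidean" by simp
  fix V :: "real set" assume "openin euclidean V"
  then have V: "open V" by simp
  have cont: "continuous_on UNIV f" using assms by (rule C_infty_continuous)
  have pre: "open (f -` V)" using V cont by (rule open_vimage)
  show "openin top_pt {x \<in> topspace top_pt. ext0 f x \<in> V}"
  proof (cases "0 \<in> V")
    case False
    have "{x \<in> topspace top_pt. ext0 f x \<in> V} = Some ` (f -` V)"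
    proof (rule set_eqI)
      fix z show "z \<in> {x \<in> topspace top_pt. ext0 f x \<in> V} \<longleftrightarrow> z \<in> Some ` (f -` V)"
        using False by (cases z) (auto simp: top)
    qed
    then show ?thesis using pre by (simp add: top_pt_def)
  next
    case True
    then obtain e where e: "e > 0" "ball 0 e \<subseteq> V" using V openE by blast
    obtain K where K: "compact K" "\<And>x. x \<notin> K \<Longrightarrow> \<bar>f x\<bar> < e" using assms e(1) unfolding C_infty_def by blast
    have sub: "- (f -` V) \<subseteq> K"
    proof
      fix x assume "x \<in> - (f -` V)"
      then have "f x \<notin> ball 0 e" using e(2) by auto
      then show "x \<in> K" using K(2)[of x] by (auto simp: dist_real_def)
    qed
    have cl: "closed (- (f -` V))" using pre by (simp add: closed_Compl)
    have cp: "compact (- (f -` V))" by (rule compact_if_subset[OF K(1) sub cl])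
    have "{x \<in> topspace top_pt. ext0 f x \<in> V} = insert None (Some ` (topspace euclidean - - (f -` V)))"
    proof (rule set_eqI)
      fix z show "z \<in> {x \<in> topspace top_pt. ext0 f x \<in> V} \<longleftrightarrow> z \<in> insert None (Some ` (topspace euclidean - - (f -` V)))"
        using True by (cases z) (auto simp: top)
    qed
    then show ?thesis using cl cp unfolding top_pt_def openin_Alexandroff_compactification by auto
  qed
qed

text \<open>Strictly to the right of \<open>t\<close> even when \<open>t\<close> is dyadic, so that right continuity of the paths applies.\<close>

definition dyadic_above :: "nat \<Rightarrow> real \<Rightarrow> real" where
  "dyadic_above n t = (of_int \<lfloor>2 ^ n * t\<rfloor> + 1) / 2 ^ n"

definition dyadic_below :: "nat \<Rightarrow> real \<Rightarrow> real" where
  "dyadic_below n t = of_int \<lfloor>2 ^ n * t\<rfloor> / 2 ^ n"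

lemma dyadic_above_gt: "t < dyadic_above n t" and dyadic_above_le: "dyadic_above n t \<le> t + 1 / 2 ^ n"
proof -
  have "2 ^ n * t < of_int \<lfloor>2 ^ n * t\<rfloor> + 1" by linarith
  then show "t < dyadic_above n t" by (simp add: dyadic_above_def field_simps)
  have "of_int \<lfloor>2 ^ n * t\<rfloor> \<le> 2 ^ n * t" by linarith
  then show "dyadic_above n t \<le> t + 1 / 2 ^ n" by (simp add: dyadic_above_def field_simps)
qed

lemma dyadic_below_le: "dyadic_below n t \<le> t" and dyadic_below_ge: "t - 1 / 2 ^ n \<le> dyadic_below n t"
proof -
  have "of_int \<lfloor>2 ^ n * t\<rfloor> \<le> 2 ^ n * t" by linarith
  then show "dyadic_below n t \<le> t" by (simp add: dyadic_below_def field_simps)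
  have "2 ^ n * t < of_int \<lfloor>2 ^ n * t\<rfloor> + 1" by linarith
  then have "2 ^ n * t - 1 \<le> of_int \<lfloor>2 ^ n * t\<rfloor>" by linarith
  then have "(2 ^ n * t - 1) / 2 ^ n \<le> dyadic_below n t"
    unfolding dyadic_below_def by (intro divide_right_mono) auto
  then show "t - 1 / 2 ^ n \<le> dyadic_below n t" by (simp add: diff_divide_distrib)
qed

lemma dyadic_below_mono: "dyadic_below n t \<le> dyadic_below (Suc n) t"
proof -
  have "2 * \<lfloor>2 ^ n * t\<rfloor> \<le> \<lfloor>2 ^ Suc n * t\<rfloor>"
  proof (subst le_floor_iff)
    have "real_of_int \<lfloor>2 ^ n * t\<rfloor> \<le> 2 ^ n * t" by linarith
    then show "real_of_int (2 * \<lfloor>2 ^ n * t\<rfloor>) \<le> 2 ^ Suc n * t" by simp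
  qed
  then have "2 * real_of_int \<lfloor>2 ^ n * t\<rfloor> \<le> of_int \<lfloor>2 ^ Suc n * t\<rfloor>" by linarith
  then show ?thesis by (simp add: dyadic_below_def field_simps)
qed

lemma inverse_power2_tendsto_0: "(\<lambda>n. 1 / 2 ^ n :: real) \<longlonglongrightarrow> 0"
  using LIMSEQ_power_zero[of "1/2::real"] by (simp add: power_one_over)

lemma dyadic_above_tendsto: "(\<lambda>n. dyadic_above n t) \<longlonglongrightarrow> t"
proof (rule tendsto_sandwich[of "\<lambda>_. t" _ _ "\<lambda>n. t + 1 / 2 ^ n"])
  show "(\<lambda>n. t + 1 / 2 ^ n) \<longlonglongrightarrow> t"
    using tendsto_add[OF tendsto_const inverse_power2_tendsto_0, of t] by simp
qed (auto intro!: always_eventually dyadic_above_le less_imp_le[OF dyadic_above_gt])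

lemma dyadic_below_tendsto: "(\<lambda>n. dyadic_below n t) \<longlonglongrightarrow> t"
proof (rule tendsto_sandwich[of "\<lambda>n. t - 1 / 2 ^ n" _ _ "\<lambda>_. t"])
  show "(\<lambda>n. t - 1 / 2 ^ n) \<longlonglongrightarrow> t"
    using tendsto_diff[OF tendsto_const inverse_power2_tendsto_0, of t] by simp
qed (auto intro!: always_eventually dyadic_below_le dyadic_below_ge)

lemma measurable_floor_compose:
  fixes f :: "real \<Rightarrow> 'c \<Rightarrow> 'd"
  assumes f: "\<And>r. f r \<in> M \<rightarrow>\<^sub>M L" and g: "g \<in> M \<rightarrow>\<^sub>M (borel :: real measure)"
  shows "(\<lambda>z. f (dyadic_below n (g z)) z) \<in> M \<rightarrow>\<^sub>M L" "(\<lambda>z. f (dyadic_above n (g z)) z) \<in> M \<rightarrow>\<^sub>M L"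
proof -
  have *: "(\<lambda>z. \<lfloor>2 ^ n * g z\<rfloor>) \<in> M \<rightarrow>\<^sub>M count_space UNIV" using g by measurable
  show "(\<lambda>z. f (dyadic_below n (g z)) z) \<in> M \<rightarrow>\<^sub>M L" unfolding dyadic_below_def
    by (rule measurable_compose_countable[of "\<lambda>i z. f (of_int i / 2 ^ n) z", OF f *])
  show "(\<lambda>z. f (dyadic_above n (g z)) z) \<in> M \<rightarrow>\<^sub>M L" unfolding dyadic_above_def
    by (rule measurable_compose_countable[of "\<lambda>i z. f ((of_int i + 1) / 2 ^ n) z", OF f *])
qed

context hunt_space
begin

text \<open>Right continuity of the paths, along times taking countably many values; this is what makes the
  path jointly measurable in time and randomness.\<close>

lemma path_right_continuous:
  assumes "f \<in> C_infty" "t \<ge> 0"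
  shows "(\<lambda>n. ext0 f (X (ennreal (dyadic_above n t)) \<omega>)) \<longlonglongrightarrow> ext0 f (X (ennreal t) \<omega>)"
proof -
  have "\<forall>\<omega> t. t < \<infinity> \<longrightarrow> limitin top_pt (\<lambda>s. X s \<omega>) (X t \<omega>) (at_right t)"
    using hunt unfolding hunt_process_def by (elim conjE)
  then have "limitin top_pt (\<lambda>s. X s \<omega>) (X (ennreal t) \<omega>) (at_right (ennreal t))" by simp
  from continuous_map_limit[OF continuous_map_ext0[OF assms(1)] this]
  have lim: "((\<lambda>s. ext0 f (X s \<omega>)) \<longlongrightarrow> ext0 f (X (ennreal t) \<omega>)) (at_right (ennreal t))"
    by (simp add: o_def)
  have "filterlim (\<lambda>n. ennreal (dyadic_above n t)) (at_right (ennreal t)) sequentially"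
    unfolding filterlim_at
  proof
    show "(\<lambda>n. ennreal (dyadic_above n t)) \<longlonglongrightarrow> ennreal t"
      by (intro tendsto_ennrealI dyadic_above_tendsto)
    show "\<forall>\<^sub>F n in sequentially. ennreal (dyadic_above n t) \<in> {ennreal t<..} \<and> ennreal (dyadic_above n t) \<noteq> ennreal t"
      using assms(2) dyadic_above_gt[of t] by (intro always_eventually allI) (simp add: ennreal_less_iff less_imp_neq neq_iff)
  qed
  with lim show ?thesis by (rule filterlim_compose)
qed

lemma measurable_path_time:
  assumes f: "f \<in> C_infty"
  shows "(\<lambda>(\<omega>, t). ext0 f (X (ennreal t) \<omega>)) \<in> borel_measurable (P x \<Otimes>\<^sub>M borel)"
proof -
  have [measurable]: "f \<in> borel_measurable borel" using f by (rule C_infty_borel)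
  have "(\<lambda>z. ext0 f (X (ennreal (max (snd z) 0)) (fst z))) \<in> borel_measurable (P x \<Otimes>\<^sub>M borel)"
  proof (rule borel_measurable_LIMSEQ_real)
    show "(\<lambda>n. ext0 f (X (ennreal (dyadic_above n (max (snd z) 0))) (fst z))) \<longlonglongrightarrow> ext0 f (X (ennreal (max (snd z) 0)) (fst z))" for z
      by (rule path_right_continuous[OF f]) simp
    show "(\<lambda>z. ext0 f (X (ennreal (dyadic_above n (max (snd z) 0))) (fst z))) \<in> borel_measurable (P x \<Otimes>\<^sub>M borel)" for n
      by (rule measurable_floor_compose(2)[where f="\<lambda>r z. ext0 f (X (ennreal r) (fst z))"]) measurable
  qed
  moreover have "ennreal (max t 0) = ennreal t" for t :: real by (auto simp: max_def ennreal_neg)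
  ultimately show ?thesis by (simp add: split_beta)
qed

end

lemma (in feller_form) resolvent_eq:
  assumes h: "test_fn h" and a: "\<alpha> > 0"
  shows "resolvent X P \<alpha> (\<lambda>x. ennreal (h x)) x = ennreal (R \<alpha> h x)"
proof -
  note hC = test_fnD(1)[OF h]
  interpret prob_space "P (Some x)" by (rule prob_P)
  interpret pair_sigma_finite "P (Some x)" lborel ..
  note m1 = measurable_path_time[OF hC, of "Some x"]
  have e: "ext0 (\<lambda>x. ennreal (h x)) z = ennreal (ext0 h z)" for z by (cases z) auto
  have [measurable]: "(\<lambda>z. ext0 h (X (ennreal (snd z)) (fst z))) \<in> borel_measurable (P (Some x) \<Otimes>\<^sub>M lborel)"
    using m1 by (simp add: split_beta measurable_cong_sets[OF sets_pair_measure_cong[OF refl sets_lborel] refl])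
  have nn: "0 \<le> ext0 h z" for z using test_fnD(3)[OF h] by (cases z) auto
  obtain M where M: "\<And>x. \<bar>h x\<bar> \<le> M" using C_infty_bounded[OF hC] by auto
  have hM: "h y \<le> M" for y using M[of y] by simp
  have "resolvent X P \<alpha> (\<lambda>x. ennreal (h x)) x =
    (\<integral>\<^sup>+\<omega>. \<integral>\<^sup>+t. ennreal (exp (- \<alpha> * t)) * ennreal (ext0 h (X (ennreal t) \<omega>)) * indicator {0..} t \<partial>lborel \<partial>P (Some x))"
    by (simp add: resolvent_def e)
  also have "\<dots> = (\<integral>\<^sup>+t. \<integral>\<^sup>+\<omega>. ennreal (exp (- \<alpha> * t)) * ennreal (ext0 h (X (ennreal t) \<omega>)) * indicator {0..} t \<partial>P (Some x) \<partial>lborel)"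
    by (rule Fubini'[symmetric]) (unfold split_beta, measurable)
  also have "\<dots> = (\<integral>\<^sup>+t. ennreal (1 / \<alpha>) * (ennreal (exponential_density \<alpha> t) * ennreal (p (max t 0) h x)) \<partial>lborel)"
  proof (intro nn_integral_cong)
    fix t :: real
    show "(\<integral>\<^sup>+\<omega>. ennreal (exp (- \<alpha> * t)) * ennreal (ext0 h (X (ennreal t) \<omega>)) * indicator {0..} t \<partial>P (Some x))
      = ennreal (1 / \<alpha>) * (ennreal (exponential_density \<alpha> t) * ennreal (p (max t 0) h x))"
    proof (cases "t \<ge> 0")
      case True
      have [measurable]: "h \<in> borel_measurable borel" using C_infty_borel[OF hC] .
      have "(\<integral>\<^sup>+\<omega>. ennreal (exp (- \<alpha> * t)) * ennreal (ext0 h (X (ennreal t) \<omega>)) * indicator {0..} t \<partial>P (Some x))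
        = ennreal (exp (- \<alpha> * t)) * nn_trans X P t (\<lambda>x. ennreal (h x)) x"
        using True by (simp add: nn_trans_def e nn_integral_cmult)
      also have "nn_trans X P t (\<lambda>x. ennreal (h x)) x = ennreal (p t h x)"
        using test_fnD(3)[OF h] hM by (intro ennreal_p[symmetric]) auto
      finally show ?thesis using True a p_nonneg[of h t x, OF test_fnD(3)[OF h]]
        by (simp add: exponential_density_def ennreal_mult[symmetric] mult.commute)
    next
      case False then show ?thesis by (simp add: exponential_density_def)
    qed
  qed
  also have "\<dots> = ennreal (1 / \<alpha>) * (\<integral>\<^sup>+t. ennreal (exponential_density \<alpha> t) * ennreal (p (max t 0) h x) \<partial>lborel)"
    using hC by (intro nn_integral_cmult) measurable
  also have "(\<integral>\<^sup>+t. ennreal (exponential_density \<alpha> t) * ennreal (p (max t 0) h x) \<partial>lborel) = (\<integral>\<^sup>+t. ennreal (p (max t 0) h x) \<partial>expo \<alpha>)"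
  proof (rule nn_integral_density[symmetric])
    show "(\<lambda>t. ennreal (p (max t 0) h x)) \<in> borel_measurable lborel" using hC by measurable
  qed measurable
  also have "\<dots> = ennreal (\<integral>t. p (max t 0) h x \<partial>expo \<alpha>)"
    using p_integrable_expo[OF hC a, of "\<lambda>t. t" x] p_nonneg[of h, OF test_fnD(3)[OF h]]
    by (intro nn_integral_eq_integral) auto
  finally show ?thesis
    using a p_nonneg[of h, OF test_fnD(3)[OF h]] by (simp add: R_def ennreal_mult'[symmetric])
qed

section \<open>Potentials of positive continuous additive functionals\<close>

text \<open>The case \<open>z = \<infinity>\<close> is separate because subtraction is continuous only at finite values.\<close>

lemma le_liminf_if_le_add:
  fixes a b :: "nat \<Rightarrow> ennreal"
  assumes a: "a \<longlonglongrightarrow> 0" and le: "\<And>n. z \<le> a n + b n"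
  shows "z \<le> liminf b"
proof (cases "z = top")
  case True
  have "\<forall>\<^sub>F n in sequentially. a n < top" using a by (rule order_tendstoD) simp
  then have "\<forall>\<^sub>F n in sequentially. top \<le> b n"
  proof eventually_elim
    case (elim n)
    then show ?case using le[of n] True by (auto simp: top_unique)
  qed
  then have "top \<le> liminf b" by (intro Liminf_bounded) auto
  then show ?thesis using True by simp
next
  case False
  have "(\<lambda>n. z - a n) \<longlonglongrightarrow> z - 0" using False by (intro tendsto_diff_ennreal tendsto_const a) auto
  then have "liminf (\<lambda>n. z - a n) = z" by (intro lim_imp_Liminf) auto
  moreover have "liminf (\<lambda>n. z - a n) \<le> liminf b"
    using le False by (intro Liminf_mono always_eventually allI) (simp add: ennreal_minus_le_iff)
  ultimately show ?thesis by simp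
qed

locale positive_af = hunt_space m X \<theta> P
  for m :: "'a::{metric_space, second_countable_topology} measure"
    and X :: "('w, 'a) coords" and \<theta> P +
  fixes A :: "ennreal \<Rightarrow> 'w \<Rightarrow> ennreal" and \<Lambda> :: "'w set" and N0 :: "'a set"
  assumes A_meas: "\<And>t. t < \<infinity> \<Longrightarrow> A t \<in> borel_measurable (aug_filt X P t)"
    and \<Lambda>_AE: "\<And>x. x \<notin> N0 \<Longrightarrow> AE \<omega> in P (Some x). \<omega> \<in> \<Lambda>"
    and \<Lambda>_shift: "\<And>t \<omega>. 0 < t \<Longrightarrow> t < \<infinity> \<Longrightarrow> \<omega> \<in> \<Lambda> \<Longrightarrow> \<theta> t \<omega> \<in> \<Lambda>"
    and A_cont: "\<And>\<omega>. \<omega> \<in> \<Lambda> \<Longrightarrow> continuous_on {..<\<infinity>} (\<lambda>t. A t \<omega>)"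
    and A_0: "\<And>\<omega>. \<omega> \<in> \<Lambda> \<Longrightarrow> A 0 \<omega> = 0"
    and A_finite: "\<And>t \<omega>. \<omega> \<in> \<Lambda> \<Longrightarrow> t < lifetime X \<omega> \<Longrightarrow> A t \<omega> < \<infinity>"
    and A_const: "\<And>t \<omega>. \<omega> \<in> \<Lambda> \<Longrightarrow> lifetime X \<omega> \<le> t \<Longrightarrow> t < \<infinity> \<Longrightarrow> A t \<omega> = A (lifetime X \<omega>) \<omega>"
    and A_add: "\<And>s t \<omega>. \<omega> \<in> \<Lambda> \<Longrightarrow> s < \<infinity> \<Longrightarrow> t < \<infinity> \<Longrightarrow> A (s + t) \<omega> = A s \<omega> + A t (\<theta> s \<omega>)"
begin

lemma A_mono: "\<omega> \<in> \<Lambda> \<Longrightarrow> s \<le> t \<Longrightarrow> t < \<infinity> \<Longrightarrow> A s \<omega> \<le> A t \<omega>"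
proof -
  assume \<omega>: "\<omega> \<in> \<Lambda>" and st: "s \<le> t" "t < \<infinity>"
  have "t = s + (t - s)" using st(1) by (simp add: add_diff_inverse_ennreal)
  moreover have "A (s + (t - s)) \<omega> = A s \<omega> + A (t - s) (\<theta> s \<omega>)"
    using st by (intro A_add \<omega>) (auto intro: le_less_trans[OF diff_le_self_ennreal] le_less_trans)
  ultimately have "A t \<omega> = A s \<omega> + A (t - s) (\<theta> s \<omega>)" by metis
  then show ?thesis by (simp add: add_increasing2)
qed

lemma alive: "t < lifetime X \<omega> \<Longrightarrow> X t \<omega> \<noteq> None"
proof
  assume "t < lifetime X \<omega>" "X t \<omega> = None"
  moreover from this have "lifetime X \<omega> \<le> t" unfolding lifetime_def by (intro Inf_lower) simp
  ultimately show False by simp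
qed

lemma lifetime_0: "X 0 \<omega> = None \<Longrightarrow> lifetime X \<omega> = 0"
  unfolding lifetime_def by (intro antisym Inf_lower) auto

lemma A_dead: "\<omega> \<in> \<Lambda> \<Longrightarrow> lifetime X \<omega> = 0 \<Longrightarrow> t < \<infinity> \<Longrightarrow> A t \<omega> = 0"
  using A_const[of \<omega> t] A_0[of \<omega>] by simp

lemma A_real_cont: "\<omega> \<in> \<Lambda> \<Longrightarrow> continuous_on UNIV (\<lambda>r. A (ennreal r) \<omega>)"
  by (rule continuous_on_compose2[OF A_cont]) (auto intro: continuous_on_ennreal continuous_on_id)

lemma A_real_meas: "\<omega> \<in> \<Lambda> \<Longrightarrow> (\<lambda>r. A (ennreal r) \<omega>) \<in> borel_measurable borel"
  by (intro borel_measurable_continuous_onI A_real_cont)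

text \<open>The functional \<open>\<integral>\<^sub>0\<^sup>\<infinity> e\<^sup>-\<^sup>\<alpha>\<^sup>t dA\<^sub>t = \<integral>\<^sub>0\<^sup>\<infinity> \<alpha> e\<^sup>-\<^sup>\<alpha>\<^sup>r A\<^sub>r dr\<close>, as a limit that is measurable
  without restriction to the defining set. Its value \<open>0\<close> for paths started at the cemetery is needed
  because nothing is known about \<open>A\<close> under the law \<open>P None\<close>.\<close>

definition Z :: "real \<Rightarrow> 'w \<Rightarrow> ennreal" where
  "Z \<alpha> \<omega> = (if X 0 \<omega> = None then 0 else SUP n. \<integral>\<^sup>+r. A (ennreal (dyadic_below n r)) \<omega> \<partial>expo \<alpha>)"

lemma Z_measurable:
  assumes \<nu>: "\<nu> \<in> space (prob_algebra borel_pt)" and a: "\<alpha> > 0"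
  shows "Z \<alpha> \<in> borel_measurable (completion (\<nu> \<bind> P))"
proof -
  let ?M = "completion (\<nu> \<bind> P)"
  interpret prob_space "expo \<alpha>" using a by (rule prob_space_exponential_density)
  have Am: "A (ennreal r) \<in> borel_measurable ?M" for r
    by (rule measurable_aug_filt_completion[OF A_meas \<nu>]) simp
  have "(\<lambda>z. A (ennreal (dyadic_below n (snd z))) (fst z)) \<in> borel_measurable (?M \<Otimes>\<^sub>M expo \<alpha>)" for n
    by (rule measurable_floor_compose(1)[where f="\<lambda>r z. A (ennreal r) (fst z)"])
      (auto intro!: measurable_compose[OF measurable_fst Am])
  then have [measurable]: "(\<lambda>\<omega>. \<integral>\<^sup>+r. A (ennreal (dyadic_below n r)) \<omega> \<partial>expo \<alpha>) \<in> borel_measurable ?M" for n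
    by (intro borel_measurable_nn_integral) (simp add: split_beta)
  have "X 0 \<in> (\<nu> \<bind> P) \<rightarrow>\<^sub>M borel_pt"
    by (subst measurable_cong_sets[OF sets_bind_P[OF \<nu>] refl]) (rule measurable_X)
  then have [measurable]: "X 0 \<in> ?M \<rightarrow>\<^sub>M borel_pt" by (rule measurable_completion)
  have [measurable]: "Measurable.pred borel_pt (\<lambda>z. z = (None :: 'a option))"
    using singleton_None_borel_pt by (simp add: pred_def)
  show ?thesis unfolding Z_def[abs_def] by measurable
qed

text \<open>On the defining set \<open>A\<close> is increasing and continuous, so the dyadic approximations increase to it.\<close>

lemma Z_eq:
  assumes \<omega>: "\<omega> \<in> \<Lambda>" and a: "\<alpha> > 0"
  shows "Z \<alpha> \<omega> = (\<integral>\<^sup>+r. A (ennreal r) \<omega> \<partial>expo \<alpha>)"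
proof (cases "X 0 \<omega> = None")
  case True
  then have "A (ennreal r) \<omega> = 0" for r using A_dead[OF \<omega> lifetime_0] by simp
  then show ?thesis using True by (simp add: Z_def)
next
  case False
  have inc: "incseq (\<lambda>n. A (ennreal (dyadic_below n r)) \<omega>)" for r
    by (intro incseq_SucI A_mono \<omega> ennreal_leI dyadic_below_mono) simp
  have sup: "(SUP n. A (ennreal (dyadic_below n r)) \<omega>) = A (ennreal r) \<omega>" for r
  proof (rule LIMSEQ_unique[OF LIMSEQ_SUP[OF inc]])
    show "(\<lambda>n. A (ennreal (dyadic_below n r)) \<omega>) \<longlonglongrightarrow> A (ennreal r) \<omega>"
      by (rule continuous_on_tendsto_compose[OF A_real_cont[OF \<omega>] dyadic_below_tendsto]) auto
  qed
  have "(\<integral>\<^sup>+r. (SUP n. A (ennreal (dyadic_below n r)) \<omega>) \<partial>expo \<alpha>) = (SUP n. \<integral>\<^sup>+r. A (ennreal (dyadic_below n r)) \<omega> \<partial>expo \<alpha>)"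
  proof (rule nn_integral_monotone_convergence_SUP)
    show "incseq (\<lambda>n r. A (ennreal (dyadic_below n r)) \<omega>)" using inc by (auto simp: incseq_def le_fun_def)
    show "(\<lambda>r. A (ennreal (dyadic_below n r)) \<omega>) \<in> borel_measurable (expo \<alpha>)" for n
      using measurable_floor_compose(1)[where f="\<lambda>r z. A (ennreal r) \<omega>" and g="\<lambda>r. r" and M="expo \<alpha>" and L=borel] by simp
  qed
  then show ?thesis unfolding Z_def sup by (simp only: False if_False)
qed

text \<open>\<open>A\<^sub>r \<le> A\<^sub>t\<^sub>+\<^sub>r = A\<^sub>t + A\<^sub>r \<circ> \<theta>\<^sub>t\<close>, integrated over \<open>r\<close>.\<close>

lemma Z_le_shift:
  assumes \<omega>: "\<omega> \<in> \<Lambda>" and a: "\<alpha> > 0" and t: "t > 0"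
  shows "Z \<alpha> \<omega> \<le> A (ennreal t) \<omega> + Z \<alpha> (\<theta> (ennreal t) \<omega>)"
proof -
  interpret prob_space "expo \<alpha>" using a by (rule prob_space_exponential_density)
  have \<theta>: "\<theta> (ennreal t) \<omega> \<in> \<Lambda>" using t by (intro \<Lambda>_shift \<omega>) (auto simp: ennreal_zero_less_top)
  note [measurable] = A_real_meas[OF \<theta>]
  have "Z \<alpha> \<omega> = (\<integral>\<^sup>+r. A (ennreal r) \<omega> \<partial>expo \<alpha>)" by (rule Z_eq[OF \<omega> a])
  also have "\<dots> \<le> (\<integral>\<^sup>+r. A (ennreal t) \<omega> + A (ennreal r) (\<theta> (ennreal t) \<omega>) \<partial>expo \<alpha>)"
  proof (rule nn_integral_mono)
    fix r
    have "A (ennreal r) \<omega> \<le> A (ennreal t + ennreal r) \<omega>" by (intro A_mono \<omega>) (auto simp: less_top[symmetric])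
    also have "\<dots> = A (ennreal t) \<omega> + A (ennreal r) (\<theta> (ennreal t) \<omega>)" by (intro A_add \<omega>) auto
    finally show "A (ennreal r) \<omega> \<le> A (ennreal t) \<omega> + A (ennreal r) (\<theta> (ennreal t) \<omega>)" .
  qed
  also have "\<dots> = (\<integral>\<^sup>+r. A (ennreal t) \<omega> \<partial>expo \<alpha>) + (\<integral>\<^sup>+r. A (ennreal r) (\<theta> (ennreal t) \<omega>) \<partial>expo \<alpha>)"
    by (rule nn_integral_add) measurable
  also have "(\<integral>\<^sup>+r. A (ennreal t) \<omega> \<partial>expo \<alpha>) = A (ennreal t) \<omega>"
    using emeasure_space_1 by simp
  finally show ?thesis using Z_eq[OF \<theta> a] by simp
qed

lemma approach_lifetime:
  assumes "0 < (L::ennreal)"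
  obtains s :: "nat \<Rightarrow> real" where "\<And>n. 0 \<le> s n" "\<And>n. ennreal (s n) < L" "incseq s" "(\<lambda>n. ennreal (s n)) \<longlonglongrightarrow> L"
proof (cases L)
  case (real z)
  then have z: "z > 0" using assms by simp
  define s where "s n = z - z / real (Suc n)" for n
  have "s \<longlonglongrightarrow> z - z * 0"
    unfolding s_def divide_inverse by (intro tendsto_diff tendsto_mult tendsto_const LIMSEQ_inverse_real_of_nat)
  then have "(\<lambda>n. ennreal (s n)) \<longlonglongrightarrow> ennreal z" by (intro tendsto_ennrealI) simp
  moreover have "incseq s" unfolding s_def using z by (intro incseq_SucI diff_left_mono divide_left_mono) auto
  moreover have "0 \<le> s n" for n using z by (simp add: s_def field_simps)
  moreover have "ennreal (s n) < L" for n using z real by (auto simp: s_def intro!: ennreal_lessI)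
  ultimately show ?thesis using real by (intro that[of s]) auto
next
  case top
  have "(\<lambda>n. ennreal (real n)) \<longlonglongrightarrow> top" using of_nat_tendsto_top_ennreal by (simp add: ennreal_of_nat_eq_real_of_nat)
  then show ?thesis using top by (intro that[of real]) (auto simp: incseq_def)
qed

text \<open>Integration by parts, in the form of Tonelli's theorem for \<open>e\<^sup>-\<^sup>\<alpha>\<^sup>t = \<integral>\<^sub>t\<^sup>\<infinity> \<alpha> e\<^sup>-\<^sup>\<alpha>\<^sup>r dr\<close>.\<close>

lemma stieltjes_eq:
  assumes \<omega>: "\<omega> \<in> \<Lambda>" and a: "\<alpha> > 0" and s: "0 \<le> s" "ennreal s < lifetime X \<omega>"
    and g: "\<And>t. 0 < t \<Longrightarrow> ennreal t < lifetime X \<omega> \<Longrightarrow> g t = ennreal (exp (- \<alpha> * t))"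
  shows "(\<integral>\<^sup>+t. g t \<partial>interval_measure (\<lambda>t. enn2real (A (ennreal (min t s)) \<omega>)))
      = (\<integral>\<^sup>+r. A (ennreal (min r s)) \<omega> \<partial>expo \<alpha>)"
proof -
  interpret E: prob_space "expo \<alpha>" using a by (rule prob_space_exponential_density)
  define G where "G t = enn2real (A (ennreal (min t s)) \<omega>)" for t
  have fin: "A (ennreal (min t s)) \<omega> < \<infinity>" for t
    by (rule le_less_trans[OF A_mono[OF \<omega>] A_finite[OF \<omega> s(2)]]) (auto intro: ennreal_leI)
  have GA: "ennreal (G t) = A (ennreal (min t s)) \<omega>" for t using fin[of t] by (simp add: G_def)
  have mono: "G x \<le> G y" if "x \<le> y" for x y
    unfolding G_def using that fin by (intro enn2real_mono A_mono \<omega> ennreal_leI) auto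
  have cont: "continuous_on UNIV G"
    unfolding continuous_on_def
  proof
    fix t
    have "continuous_on UNIV (\<lambda>r. A (ennreal (min r s)) \<omega>)"
      by (rule continuous_on_compose2[OF A_real_cont[OF \<omega>]]) (auto intro!: continuous_intros)
    then have "((\<lambda>r. A (ennreal (min r s)) \<omega>) \<longlongrightarrow> ennreal (G t)) (at t)"
      unfolding continuous_on_def GA by simp
    then show "(G \<longlongrightarrow> G t) (at t within UNIV)"
      unfolding G_def[abs_def] by (rule tendsto_enn2real) (simp add: G_def)
  qed
  have rc: "continuous (at_right x) G" for x
    using cont by (auto simp: continuous_on_eq_continuous_at intro: continuous_at_imp_continuous_at_within)
  let ?I = "interval_measure G"
  interpret I: sigma_finite_measure ?I by (rule sigma_finite_interval_measure[OF mono rc])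
  interpret pair_sigma_finite ?I "expo \<alpha>" ..
  have Ioc: "emeasure ?I {x<..y} = ennreal (G y - G x)" if "x \<le> y" for x y
    by (rule emeasure_interval_measure_Ioc[OF that mono rc])
  have G0: "G t = 0" if "t \<le> 0" for t using that s A_0[OF \<omega>] by (simp add: G_def ennreal_neg)
  have Gs: "G t = G s" if "s \<le> t" for t using that by (simp add: G_def)
  have "emeasure ?I (\<Union>n::nat. {- real n<..0}) = 0"
    by (rule emeasure_UN_eq_0) (auto simp: Ioc G0)
  moreover have "(\<Union>n::nat. {- real n<..0}) = {..0}"
  proof (rule set_eqI)
    fix x :: real
    obtain n :: nat where "- x < real n" using reals_Archimedean2 by blast
    then show "x \<in> (\<Union>n::nat. {- real n<..0}) \<longleftrightarrow> x \<in> {..0}" by (auto intro!: exI[of _ n])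
  qed
  ultimately have n1: "{..0} \<in> null_sets ?I" by (simp add: null_sets_def)
  have "emeasure ?I {s<..s + real n} = 0" for n
    using Ioc[of s "s + real n"] Gs[of "s + real n"] by simp
  then have "emeasure ?I (\<Union>n::nat. {s<..s + real n}) = 0"
    by (intro emeasure_UN_eq_0) auto
  moreover have "(\<Union>n::nat. {s<..s + real n}) = {s<..}"
  proof (rule set_eqI)
    fix x :: real
    obtain n :: nat where "x - s < real n" using reals_Archimedean2 by blast
    then show "x \<in> (\<Union>n::nat. {s<..s + real n}) \<longleftrightarrow> x \<in> {s<..}" by (auto intro!: exI[of _ n])
  qed
  ultimately have n2: "{s<..} \<in> null_sets ?I" by (simp add: null_sets_def)
  have AEI: "AE t in ?I. 0 < t \<and> t \<le> s"
    using AE_not_in[OF n1] AE_not_in[OF n2] by eventually_elim auto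
  have tail: "(\<integral>\<^sup>+r. indicator {0<..r} t \<partial>expo \<alpha>) = ennreal (exp (- \<alpha> * t))" if "0 < t" for t
  proof -
    have "AE r in lborel. r \<noteq> t" by (rule AE_lborel_singleton)
    then have ne: "AE r in expo \<alpha>. r \<noteq> t" by (subst AE_density) auto
    have "(\<integral>\<^sup>+r. indicator {0<..r} t \<partial>expo \<alpha>) = (\<integral>\<^sup>+r. indicator {t<..} r \<partial>expo \<alpha>)"
      using ne that by (intro nn_integral_cong_AE) (auto split: split_indicator)
    also have "\<dots> = ennreal (measure (expo \<alpha>) {t<..})" by (simp add: E.emeasure_eq_measure)
    finally show ?thesis using expo_tail[OF a, of t] that by simp
  qed
  have "(\<integral>\<^sup>+t. g t \<partial>?I) = (\<integral>\<^sup>+t. (\<integral>\<^sup>+r. indicator {0<..r} t \<partial>expo \<alpha>) \<partial>?I)"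
  proof (rule nn_integral_cong_AE)
    show "AE t in ?I. g t = (\<integral>\<^sup>+r. indicator {0<..r} t \<partial>expo \<alpha>)"
      using AEI
    proof eventually_elim
      case (elim t)
      then have "ennreal t < lifetime X \<omega>" using s(2) by (meson ennreal_leI le_less_trans)
      then show ?case using g[of t] tail[of t] elim by simp
    qed
  qed
  also have "\<dots> = (\<integral>\<^sup>+r. (\<integral>\<^sup>+t. indicator {0<..r} t \<partial>?I) \<partial>expo \<alpha>)"
  proof (rule Fubini'[symmetric])
    have "(\<lambda>z. indicator {z. 0 < fst z \<and> fst z \<le> (snd z :: real)} z :: ennreal) \<in> borel_measurable (borel \<Otimes>\<^sub>M borel)"
      by measurable
    moreover have "(\<lambda>(t, r). indicator {0<..r} t :: ennreal) = (\<lambda>z. indicator {z. 0 < fst z \<and> fst z \<le> (snd z :: real)} z)"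
      by (auto split: split_indicator)
    ultimately have "(\<lambda>(t, r). indicator {0<..r} t :: ennreal) \<in> borel_measurable (borel \<Otimes>\<^sub>M (borel :: real measure))" by simp
    then show "(\<lambda>(t, r). indicator {0<..r} t :: ennreal) \<in> borel_measurable (?I \<Otimes>\<^sub>M expo \<alpha>)"
      by (subst measurable_cong_sets[OF sets_pair_measure_cong refl]) auto
  qed
  also have "\<dots> = (\<integral>\<^sup>+r. A (ennreal (min r s)) \<omega> \<partial>expo \<alpha>)"
  proof (rule nn_integral_cong_AE)
    show "AE r in expo \<alpha>. (\<integral>\<^sup>+t. indicator {0<..r} t \<partial>?I) = A (ennreal (min r s)) \<omega>"
      using AE_expo_pos by eventually_elim (simp add: Ioc G0 GA)
  qed
  finally show ?thesis by (simp add: G_def[abs_def])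
qed

text \<open>The integrals over \<open>(0,s]\<close> increase to \<open>Z\<close> as \<open>s\<close> increases to the lifetime, by continuity of \<open>A\<close>
  there and constancy afterwards. The integrand matters only at positive times before the lifetime,
  which lets \<open>g\<close> carry the factor \<open>1(X\<^sub>t)\<close> of the Revuz formula.\<close>

lemma af_integral_eq_Z:
  assumes \<omega>: "\<omega> \<in> \<Lambda>" and a: "\<alpha> > 0"
    and g: "\<And>t. 0 < t \<Longrightarrow> ennreal t < lifetime X \<omega> \<Longrightarrow> g t = ennreal (exp (- \<alpha> * t))"
  shows "af_integral X A g \<omega> = Z \<alpha> \<omega>"
proof -
  let ?T = "{s. 0 \<le> s \<and> ennreal s < lifetime X \<omega>}"
  have eq: "af_integral X A g \<omega> = (SUP s\<in>?T. \<integral>\<^sup>+r. A (ennreal (min r s)) \<omega> \<partial>expo \<alpha>)"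
    unfolding af_integral_def using stieltjes_eq[OF \<omega> a _ _ g] by (intro SUP_cong) auto
  have "(SUP s\<in>?T. \<integral>\<^sup>+r. A (ennreal (min r s)) \<omega> \<partial>expo \<alpha>) = (\<integral>\<^sup>+r. A (ennreal r) \<omega> \<partial>expo \<alpha>)"
  proof (rule antisym)
    show "(SUP s\<in>?T. \<integral>\<^sup>+r. A (ennreal (min r s)) \<omega> \<partial>expo \<alpha>) \<le> (\<integral>\<^sup>+r. A (ennreal r) \<omega> \<partial>expo \<alpha>)"
      by (intro SUP_least nn_integral_mono A_mono \<omega> ennreal_leI) auto
    show "(\<integral>\<^sup>+r. A (ennreal r) \<omega> \<partial>expo \<alpha>) \<le> (SUP s\<in>?T. \<integral>\<^sup>+r. A (ennreal (min r s)) \<omega> \<partial>expo \<alpha>)"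
    proof (cases "lifetime X \<omega> = 0")
      case True
      then have "A (ennreal r) \<omega> = 0" for r using A_dead[OF \<omega> True] by simp
      then show ?thesis by simp
    next
      case False
      then have "0 < lifetime X \<omega>" by (simp add: zero_less_iff_neq_zero)
      then obtain s :: "nat \<Rightarrow> real" where s: "\<And>n. 0 \<le> s n" "\<And>n. ennreal (s n) < lifetime X \<omega>" "incseq s"
        "(\<lambda>n. ennreal (s n)) \<longlonglongrightarrow> lifetime X \<omega>" by (rule approach_lifetime) (rule that; assumption)
      have inc: "incseq (\<lambda>n. A (ennreal (min r (s n))) \<omega>)" for r
        using s(3) by (intro incseq_SucI A_mono \<omega> ennreal_leI min.mono) (auto simp: incseq_Suc_iff)
      have mine: "ennreal (min r (s n)) = min (ennreal r) (ennreal (s n))" for r n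
        using s(1)[of n] by (auto simp: min_def ennreal_leI ennreal_le_iff2 ennreal_neg)
      have sup: "(SUP n. A (ennreal (min r (s n))) \<omega>) = A (ennreal r) \<omega>" for r
      proof (rule LIMSEQ_unique[OF LIMSEQ_SUP[OF inc]])
        have "(\<lambda>n. ennreal (min r (s n))) \<longlonglongrightarrow> min (ennreal r) (lifetime X \<omega>)"
          unfolding mine by (intro tendsto_min tendsto_const s(4))
        then have "(\<lambda>n. A (ennreal (min r (s n))) \<omega>) \<longlonglongrightarrow> A (min (ennreal r) (lifetime X \<omega>)) \<omega>"
          by (rule continuous_on_tendsto_compose[OF A_cont[OF \<omega>]]) (auto simp: min_less_iff_disj)
        moreover have "A (min (ennreal r) (lifetime X \<omega>)) \<omega> = A (ennreal r) \<omega>"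
          using A_const[OF \<omega>, of "ennreal r"] by (auto simp: min_def)
        ultimately show "(\<lambda>n. A (ennreal (min r (s n))) \<omega>) \<longlonglongrightarrow> A (ennreal r) \<omega>" by simp
      qed
      have "(\<integral>\<^sup>+r. A (ennreal r) \<omega> \<partial>expo \<alpha>) = (\<integral>\<^sup>+r. (SUP n. A (ennreal (min r (s n))) \<omega>) \<partial>expo \<alpha>)"
        by (simp add: sup)
      also have "\<dots> = (SUP n. \<integral>\<^sup>+r. A (ennreal (min r (s n))) \<omega> \<partial>expo \<alpha>)"
      proof (rule nn_integral_monotone_convergence_SUP)
        show "incseq (\<lambda>n r. A (ennreal (min r (s n))) \<omega>)" using inc by (auto simp: incseq_def le_fun_def)
        show "(\<lambda>r. A (ennreal (min r (s n))) \<omega>) \<in> borel_measurable (expo \<alpha>)" for n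
          using measurable_compose[OF _ A_real_meas[OF \<omega>], of "\<lambda>r. min r (s n)" borel] by simp
      qed
      also have "\<dots> \<le> (SUP s\<in>?T. \<integral>\<^sup>+r. A (ennreal (min r s)) \<omega> \<partial>expo \<alpha>)"
        using s(1,2) by (intro SUP_least SUP_upper) auto
      finally show ?thesis .
    qed
  qed
  then show ?thesis using eq Z_eq[OF \<omega> a] by simp
qed

end

context radon_space
begin

text \<open>Functionals of the augmented filtration have Borel measurable versions for one initial law at a
  time; this provides a law under which almost sure statements hold \<open>m\<close>-almost everywhere.\<close>

lemma equivalent_law:
  obtains \<nu> where "\<nu> \<in> space (prob_algebra (borel_pt :: 'a option measure))"
    "\<And>Q. (AE y in \<nu>. Q y) \<Longrightarrow> (AE x in m. Q (Some x))"
proof -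
  interpret sigma_finite_measure m by (rule sigma_finite_m)
  obtain f :: "'a \<Rightarrow> real" where f: "f \<in> borel_measurable m" "\<And>x. f x > 0" "\<And>x. f x \<le> 1" "integrable m f"
    by (rule obtain_positive_integrable_function) (rule that; assumption)
  note [measurable] = f(1)
  define I where "I = (\<integral>x. f x \<partial>m)"
  have I: "I > 0"
  proof (rule ccontr)
    assume "\<not> I > 0"
    moreover have "0 \<le> I" unfolding I_def using f(2) by (intro Bochner_Integration.integral_nonneg) (auto intro: less_imp_le)
    ultimately have "I = 0" by simp
    then have "AE x in m. f x = 0"
      using f unfolding I_def by (subst (asm) integral_nonneg_eq_0_iff_AE) (auto intro: less_imp_le)
    then have "AE x in m. False" by eventually_elim (metis f(2) less_irrefl)
    then have "emeasure m UNIV = 0" by (subst (asm) AE_iff_measurable[of UNIV]) auto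
    then show False using full unfolding full_support_def by (metis UNIV_not_empty less_irrefl open_UNIV)
  qed
  define M where "M = density m (\<lambda>x. ennreal (f x / I))"
  have "emeasure M (space M) = (\<integral>\<^sup>+x. ennreal (f x / I) \<partial>m)" by (simp add: M_def emeasure_density)
  also have "\<dots> = ennreal (\<integral>x. f x / I \<partial>m)"
  proof (rule nn_integral_eq_integral)
    have "0 \<le> f x / I" for x using f(2)[of x] I by simp
    then show "AE x in m. 0 \<le> f x / I" by simp
  qed (use f in simp)
  also have "\<dots> = 1" using I by (simp add: I_def)
  finally have pM: "prob_space M" by (rule prob_spaceI)
  have S: "Some \<in> M \<rightarrow>\<^sub>M borel_pt" using measurable_Some_pt by (simp add: M_def)
  show ?thesis
  proof (rule that[of "distr M borel_pt Some"])
    show "distr M borel_pt Some \<in> space (prob_algebra borel_pt)"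
      using prob_space.prob_space_distr[OF pM S] by (simp add: space_prob_algebra)
    fix Q :: "'a option \<Rightarrow> bool" assume "AE y in distr M borel_pt Some. Q y"
    then have "AE x in M. Q (Some x)" by (rule AE_distrD[OF S])
    then have "AE x in m. 0 < ennreal (f x / I) \<longrightarrow> Q (Some x)" unfolding M_def by (subst (asm) AE_density) auto
    then show "AE x in m. Q (Some x)" by eventually_elim (use f(2) I in auto)
  qed
qed

end

context positive_af
begin

definition Zpot :: "real \<Rightarrow> 'a option \<Rightarrow> ennreal" where
  "Zpot \<alpha> y = (\<integral>\<^sup>+\<omega>. Z \<alpha> \<omega> \<partial>P y)"

lemma af_expectation_eq:
  assumes x: "x \<notin> N0" and a: "\<alpha> > 0"
    and g: "\<And>\<omega> t. 0 < t \<Longrightarrow> ennreal t < lifetime X \<omega> \<Longrightarrow> g \<omega> t = ennreal (exp (- \<alpha> * t))"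
  shows "(\<integral>\<^sup>+\<omega>. af_integral X A (g \<omega>) \<omega> \<partial>completion (P (Some x))) = Zpot \<alpha> (Some x)"
  unfolding Zpot_def nn_integral_completion
proof (rule nn_integral_cong_AE)
  show "AE \<omega> in P (Some x). af_integral X A (g \<omega>) \<omega> = Z \<alpha> \<omega>"
    using \<Lambda>_AE[OF x] by eventually_elim (rule af_integral_eq_Z[OF _ a g])
qed

lemma Zpot_None: "Zpot \<alpha> None = 0"
proof -
  have "Zpot \<alpha> None = (\<integral>\<^sup>+\<omega>. 0 \<partial>P None)"
    unfolding Zpot_def
  proof (rule nn_integral_cong_AE)
    show "AE \<omega> in P None. Z \<alpha> \<omega> = 0" using X0[of None] by eventually_elim (simp add: Z_def)
  qed
  then show ?thesis by simp
qed

text \<open>A version of \<open>Z\<close> that is measurable for the natural \<open>\<sigma>\<close>-algebra. It depends on the initial law,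
  and its expectations agree with those of \<open>Z\<close> from almost every starting point under that law.\<close>

lemma Z_modification:
  assumes \<nu>: "\<nu> \<in> space (prob_algebra borel_pt)" and a: "\<alpha> > 0"
  obtains Z' where "Z' \<in> borel_measurable N" "AE \<omega> in \<nu> \<bind> P. Z \<alpha> \<omega> = Z' \<omega>"
    "AE y in \<nu>. Zpot \<alpha> y = (\<integral>\<^sup>+\<omega>. Z' \<omega> \<partial>P y)"
proof -
  obtain Z' where Z': "Z' \<in> borel_measurable (\<nu> \<bind> P)" "AE \<omega> in \<nu> \<bind> P. Z \<alpha> \<omega> = Z' \<omega>"
    using completion_ex_borel_measurable[OF Z_measurable[OF \<nu> a]] by blast
  have ZN: "Z' \<in> borel_measurable N" using Z'(1) by (simp add: measurable_cong_sets[OF sets_bind_P[OF \<nu>] refl])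
  obtain S where S: "S \<in> null_sets (\<nu> \<bind> P)" "{\<omega> \<in> space (\<nu> \<bind> P). \<not> Z \<alpha> \<omega> = Z' \<omega>} \<subseteq> S"
    using Z'(2) by (auto simp: eventually_ae_filter)
  have SN: "S \<in> sets N" using S(1) sets_bind_P[OF \<nu>] by auto
  have s\<nu>: "sets \<nu> = sets borel_pt" using \<nu> by (simp add: space_prob_algebra)
  have PM: "P \<in> \<nu> \<rightarrow>\<^sub>M subprob_algebra N"
    by (subst measurable_cong_sets[OF s\<nu> refl]) (rule measurable_P_subprob)
  have "AE \<omega> in \<nu> \<bind> P. \<omega> \<notin> S" using S(1) by (rule AE_not_in)
  then have "AE y in \<nu>. AE \<omega> in P y. \<omega> \<notin> S"
    by (subst (asm) AE_bind[OF PM]) (use SN in auto)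
  then have "AE y in \<nu>. Zpot \<alpha> y = (\<integral>\<^sup>+\<omega>. Z' \<omega> \<partial>P y)"
  proof eventually_elim
    case (elim y)
    show ?case unfolding Zpot_def
    proof (rule nn_integral_cong_AE)
      show "AE \<omega> in P y. Z \<alpha> \<omega> = Z' \<omega>"
        using elim by eventually_elim (use S(2) space_bind_P[OF \<nu>] in auto)
    qed
  qed
  then show ?thesis using ZN Z'(2) by (intro that)
qed

text \<open>By the Markov property at time \<open>t\<close>, the bound off \<open>B\<close> carries over to the shifted functional
  as soon as \<open>X\<^sub>t\<close> avoids \<open>B\<close>.\<close>

lemma shifted_expectation_le:
  assumes a: "\<alpha> > 0" and B: "B \<in> sets borel" "\<And>x. x \<notin> B \<Longrightarrow> Zpot \<alpha> (Some x) \<le> c"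
    and av: "AE \<omega> in P (Some x). X t \<omega> \<notin> Some ` B"
  obtains Y where "Y \<in> borel_measurable N" "AE \<omega> in P (Some x). Z \<alpha> (\<theta> t \<omega>) = Y \<omega>" "(\<integral>\<^sup>+\<omega>. Y \<omega> \<partial>P (Some x)) \<le> c"
proof -
  have r: "return borel_pt (Some x) \<in> space (prob_algebra borel_pt)"
    by (simp add: space_prob_algebra prob_space_return)
  have rP: "return borel_pt (Some x) \<bind> P = P (Some x)"
    by (rule bind_return[OF measurable_P_subprob]) simp
  define \<nu> where "\<nu> = distr (P (Some x)) borel_pt (X t)"
  have markov: "distr (P (Some x)) N (\<theta> t) = \<nu> \<bind> P"
    using markov_property[OF r, of t] unfolding rP \<nu>_def .
  have \<nu>: "\<nu> \<in> space (prob_algebra borel_pt)"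
    unfolding \<nu>_def using prob_space.prob_space_distr[OF prob_P measurable_X_P] by (simp add: space_prob_algebra)
  obtain Z' where Z': "Z' \<in> borel_measurable N" "AE \<omega> in \<nu> \<bind> P. Z \<alpha> \<omega> = Z' \<omega>"
    "AE y in \<nu>. Zpot \<alpha> y = (\<integral>\<^sup>+\<omega>. Z' \<omega> \<partial>P y)" by (rule Z_modification[OF \<nu> a]) (rule that; assumption)
  note [measurable] = Z'(1)
  have \<theta>P: "\<theta> t \<in> P (Some x) \<rightarrow>\<^sub>M N" by (subst measurable_cong_sets[OF sets_P refl]) (rule measurable_shift_N)
  show ?thesis
  proof (rule that[of "\<lambda>\<omega>. Z' (\<theta> t \<omega>)"])
    show "(\<lambda>\<omega>. Z' (\<theta> t \<omega>)) \<in> borel_measurable N" by measurable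
    show "AE \<omega> in P (Some x). Z \<alpha> (\<theta> t \<omega>) = Z' (\<theta> t \<omega>)"
      using Z'(2) unfolding markov[symmetric] by (rule AE_distrD[OF \<theta>P])
    have s\<nu>: "sets \<nu> = sets borel_pt" by (simp add: \<nu>_def)
    have PM: "P \<in> \<nu> \<rightarrow>\<^sub>M subprob_algebra N"
      by (subst measurable_cong_sets[OF s\<nu> refl]) (rule measurable_P_subprob)
    have "(\<integral>\<^sup>+\<omega>. Z' (\<theta> t \<omega>) \<partial>P (Some x)) = (\<integral>\<^sup>+\<omega>. Z' \<omega> \<partial>distr (P (Some x)) N (\<theta> t))"
      by (rule nn_integral_distr[symmetric, OF \<theta>P]) measurable
    also have "\<dots> = (\<integral>\<^sup>+y. \<integral>\<^sup>+\<omega>. Z' \<omega> \<partial>P y \<partial>\<nu>)"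
      unfolding markov by (rule nn_integral_bind[OF Z'(1) PM])
    also have "\<dots> \<le> (\<integral>\<^sup>+y. c \<partial>\<nu>)"
    proof (rule nn_integral_mono_AE)
      have "{y \<in> space borel_pt. y \<notin> Some ` B} \<in> sets borel_pt"
        using sets.compl_sets[OF image_Some_borel_pt[OF B(1)]] by (simp add: set_diff_eq)
      from AE_distr_iff[OF measurable_X_P this] av have "AE y in \<nu>. y \<notin> Some ` B"
        unfolding \<nu>_def by simp
      with Z'(3) show "AE y in \<nu>. (\<integral>\<^sup>+\<omega>. Z' \<omega> \<partial>P y) \<le> c"
      proof eventually_elim
        case (elim y)
        have "Zpot \<alpha> y \<le> c" using elim(2) B(2) by (cases y) (auto simp: Zpot_None)
        then show ?case using elim(1) by simp
      qed
    qed
    also have "\<dots> = c" using \<nu> prob_space.emeasure_space_1[of \<nu>] by (simp add: space_prob_algebra)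
    finally show "(\<integral>\<^sup>+\<omega>. Z' (\<theta> t \<omega>) \<partial>P (Some x)) \<le> c" .
  qed
qed

text \<open>The hypothesis provides times \<open>t\<^sub>n \<down> 0\<close> at which the process avoids \<open>B\<close>. As \<open>Z \<le> A\<^sub>t + Z \<circ> \<theta>\<^sub>t\<close> and
  \<open>A\<^sub>t \<rightarrow> 0\<close>, Fatou's lemma applies to the shifted functionals.\<close>

lemma Zpot_le:
  assumes a: "\<alpha> > 0" and B: "B \<in> sets borel" "\<And>x. x \<notin> B \<Longrightarrow> Zpot \<alpha> (Some x) \<le> c"
    and x: "x \<notin> N0" and av: "AE t in expo 1. AE \<omega> in P (Some x). X (ennreal t) \<omega> \<notin> Some ` B"
  shows "Zpot \<alpha> (Some x) \<le> c"
proof -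
  have "\<exists>t>0. t < 1 / Suc n \<and> (AE \<omega> in P (Some x). X (ennreal t) \<omega> \<notin> Some ` B)" for n
  proof (rule ccontr)
    assume no: "\<not> ?thesis"
    define d where "d = 1 / real (Suc n)"
    have d: "d > 0" by (simp add: d_def)
    have "AE t in expo 1. indicator {..<d} t = (0::real)"
      using av AE_expo_pos by eventually_elim (use no in \<open>auto simp: d_def split: split_indicator\<close>)
    then have "(\<integral>t. indicator {..<d} t * (1::real) \<partial>expo 1) = (\<integral>t. 0 \<partial>expo 1)"
      by (intro integral_cong_AE) auto
    then show False using expo_head[of 1 d] d by simp
  qed
  then obtain t where t: "\<And>n. 0 < t n" "\<And>n. t n < 1 / Suc n" "\<And>n. AE \<omega> in P (Some x). X (ennreal (t n)) \<omega> \<notin> Some ` B"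
    by metis
  have "\<exists>Y. Y \<in> borel_measurable N \<and> (AE \<omega> in P (Some x). Z \<alpha> (\<theta> (ennreal (t n)) \<omega>) = Y \<omega>) \<and> (\<integral>\<^sup>+\<omega>. Y \<omega> \<partial>P (Some x)) \<le> c" for n
    by (rule shifted_expectation_le[OF a B t(3)[of n]]) (assumption, blast)
  then obtain Y where Y: "\<And>n. Y n \<in> borel_measurable N" "\<And>n. AE \<omega> in P (Some x). Z \<alpha> (\<theta> (ennreal (t n)) \<omega>) = Y n \<omega>"
    "\<And>n. (\<integral>\<^sup>+\<omega>. Y n \<omega> \<partial>P (Some x)) \<le> c" by metis
  note [measurable] = Y(1)
  have t0: "t \<longlonglongrightarrow> 0"
  proof (rule tendsto_sandwich[of "\<lambda>_. 0" _ _ "\<lambda>n. 1 / real (Suc n)"])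
    show "(\<lambda>n. 1 / real (Suc n)) \<longlonglongrightarrow> 0" using LIMSEQ_inverse_real_of_nat by (simp only: inverse_eq_divide)
  qed (use t(1,2) in \<open>auto intro!: always_eventually less_imp_le\<close>)
  have "Zpot \<alpha> (Some x) \<le> (\<integral>\<^sup>+\<omega>. liminf (\<lambda>n. Y n \<omega>) \<partial>P (Some x))"
    unfolding Zpot_def
  proof (rule nn_integral_mono_AE)
    have "AE \<omega> in P (Some x). \<forall>n. Z \<alpha> (\<theta> (ennreal (t n)) \<omega>) = Y n \<omega>" using Y(2) by (simp add: AE_all_countable)
    then show "AE \<omega> in P (Some x). Z \<alpha> \<omega> \<le> liminf (\<lambda>n. Y n \<omega>)"
      using \<Lambda>_AE[OF x]
    proof eventually_elim
      case (elim \<omega>)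
      have "(\<lambda>n. A (ennreal (t n)) \<omega>) \<longlonglongrightarrow> A (ennreal 0) \<omega>"
        by (rule continuous_on_tendsto_compose[OF A_real_cont[OF elim(2)] t0]) auto
      then have "(\<lambda>n. A (ennreal (t n)) \<omega>) \<longlonglongrightarrow> 0" using A_0[OF elim(2)] by simp
      then show ?case
      proof (rule le_liminf_if_le_add)
        show "Z \<alpha> \<omega> \<le> A (ennreal (t n)) \<omega> + Y n \<omega>" for n
          using Z_le_shift[OF elim(2) a t(1)[of n]] elim(1) by simp
      qed
    qed
  qed
  also have "\<dots> \<le> liminf (\<lambda>n. \<integral>\<^sup>+\<omega>. Y n \<omega> \<partial>P (Some x))"
    by (rule nn_integral_liminf) measurable
  also have "\<dots> \<le> liminf (\<lambda>n::nat. c)" using Y(3) by (intro Liminf_mono always_eventually allI)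
  also have "\<dots> = c" by (simp add: Liminf_const)
  finally show ?thesis .
qed

end

section \<open>Membership in the Kato class\<close>

locale potential_af = continuous_potential m F E X \<theta> P \<mu> u + positive_af m X \<theta> P A \<Lambda> N0
  for m :: "'a::{metric_space, second_countable_topology} measure"
    and F E and X :: "('w, 'a) coords" and \<theta> P \<mu> u A \<Lambda> N0 +
  assumes cap_N0: "cap m F E N0 = 0" and rev: "revuz m X P A \<mu>"
begin

text \<open>The Revuz formula with \<open>f = 1\<close> turns the bound on \<open>\<integral> R\<^sub>\<alpha>h d\<mu>\<close> into a bound on \<open>\<integral> h \<psi> dm\<close>, where \<open>\<psi>\<close>
  is a Borel version of the potential.\<close>

lemma Zpot_AE_le:
  assumes a: "\<alpha> > 0" and e: "e > 0"
    and small: "\<And>h. test_fn h \<Longrightarrow> (\<integral>x. R \<alpha> h x \<partial>\<mu>) \<le> e * (\<integral>x. h x \<partial>m)"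
  shows "AE x in m. Zpot \<alpha> (Some x) \<le> ennreal (2 * e)"
proof -
  obtain \<nu> where \<nu>: "\<nu> \<in> space (prob_algebra (borel_pt :: 'a option measure))"
    "\<And>Q. (AE y in \<nu>. Q y) \<Longrightarrow> (AE x in m. Q (Some x))" by (rule equivalent_law) (rule that; assumption)
  obtain Z' where Z': "Z' \<in> borel_measurable N" "AE \<omega> in \<nu> \<bind> P. Z \<alpha> \<omega> = Z' \<omega>"
    "AE y in \<nu>. Zpot \<alpha> y = (\<integral>\<^sup>+\<omega>. Z' \<omega> \<partial>P y)" by (rule Z_modification[OF \<nu>(1) a]) (rule that; assumption)
  define \<psi> where "\<psi> x = (\<integral>\<^sup>+\<omega>. Z' \<omega> \<partial>P (Some x))" for x
  have \<psi>m: "\<psi> \<in> borel_measurable borel"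
    unfolding \<psi>_def[abs_def] by (rule measurable_compose[OF measurable_Some_pt measurable_path_integral[OF Z'(1)]])
  have eq: "AE x in m. Zpot \<alpha> (Some x) = \<psi> x" using \<nu>(2)[OF Z'(3)] by (simp add: \<psi>_def)
  obtain B0 where B0: "B0 \<in> null_sets m" "N0 \<subseteq> B0" using cap_zero_null[OF cap_N0] by blast
  have "AE x in m. \<psi> x \<le> ennreal (2 * e)"
  proof (rule AE_le_if_C_c_pairing_le[OF \<psi>m e])
    fix h :: "'a \<Rightarrow> real" assume h: "h \<in> C_c" "\<And>x. 0 \<le> h x"
    have hg: "test_fn h" using h by (rule test_fn_C_c)
    have hm: "(\<lambda>x. ennreal (h x)) \<in> borel_measurable borel" using C_infty_borel[OF test_fnD(1)[OF hg]] by measurable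
    define af1 where "af1 x = (\<integral>\<^sup>+\<omega>. af_integral X A (\<lambda>s. ennreal (exp (- \<alpha> * s)) * ext0 (\<lambda>_. 1) (X (ennreal s) \<omega>)) \<omega>
              \<partial>completion (P (Some x)))" for x
    have af: "af1 x = Zpot \<alpha> (Some x)" if "x \<notin> N0" for x
      unfolding af1_def
    proof (rule af_expectation_eq[OF that a])
      fix \<omega> and t :: real assume "0 < t" "ennreal t < lifetime X \<omega>"
      then have "X (ennreal t) \<omega> \<noteq> None" by (intro alive)
      then show "ennreal (exp (- \<alpha> * t)) * ext0 (\<lambda>_. 1) (X (ennreal t) \<omega>) = ennreal (exp (- \<alpha> * t))" by auto
    qed
    have "(\<integral>\<^sup>+x. ennreal (h x) * \<psi> x \<partial>m) = (\<integral>\<^sup>+x. ennreal (h x) * af1 x \<partial>m)"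
    proof (rule nn_integral_cong_AE)
      show "AE x in m. ennreal (h x) * \<psi> x = ennreal (h x) * af1 x"
        using eq AE_not_in[OF B0(1)]
      proof eventually_elim
        case (elim x)
        then have "x \<notin> N0" using B0(2) by blast
        then show ?case using af elim(1) by simp
      qed
    qed
    also have "\<dots> = (\<integral>\<^sup>+x. ennreal (h x) * af1 x \<partial>completion m)" by (rule nn_integral_completion[symmetric])
    also have "\<dots> = (\<integral>\<^sup>+x. 1 * resolvent X P \<alpha> (\<lambda>x. ennreal (h x)) x \<partial>\<mu>)"
    proof -
      have "\<forall>\<alpha>>0. \<forall>f\<in>borel_measurable borel. \<forall>h\<in>borel_measurable borel.
        (\<integral>\<^sup>+x. h x *
           (\<integral>\<^sup>+\<omega>. af_integral X A (\<lambda>s. ennreal (exp (- \<alpha> * s)) * ext0 f (X (ennreal s) \<omega>)) \<omega>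
              \<partial>completion (P (Some x))) \<partial>completion m)
        = (\<integral>\<^sup>+x. f x * resolvent X P \<alpha> h x \<partial>\<mu>)" using rev unfolding revuz_def .
      from this[rule_format, OF a _ hm, of "\<lambda>_. 1"] show ?thesis unfolding af1_def by simp
    qed
    also have "\<dots> = (\<integral>\<^sup>+x. ennreal (R \<alpha> h x) \<partial>\<mu>)" by (simp add: resolvent_eq[OF hg a])
    also have "\<dots> = ennreal (\<integral>x. R \<alpha> h x \<partial>\<mu>)"
      using integral_R_\<mu>(1)[OF hg a] R_nonneg[OF hg a] by (intro nn_integral_eq_integral) auto
    also have "\<dots> \<le> ennreal (e * (\<integral>x. h x \<partial>m))" using small[OF hg] by (rule ennreal_leI)
    also have "\<dots> = ennreal e * (\<integral>\<^sup>+x. ennreal (h x) \<partial>m)"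
      using test_fnD(2)[OF hg] h(2) e by (subst nn_integral_eq_integral) (auto simp: ennreal_mult')
    finally show "(\<integral>\<^sup>+x. ennreal (h x) * \<psi> x \<partial>m) \<le> ennreal e * (\<integral>\<^sup>+x. ennreal (h x) \<partial>m)" .
  qed
  with eq show ?thesis by eventually_elim simp
qed

text \<open>Two sets of zero capacity are discarded: the exceptional set of the functional, and a set outside
  of which the process avoids, at almost every time, the null set where the almost everywhere bound
  fails.\<close>

lemma qnorm_af_potential_le:
  assumes a: "\<alpha> > 0" and e: "e > 0"
    and small: "\<And>h. test_fn h \<Longrightarrow> (\<integral>x. R \<alpha> h x \<partial>\<mu>) \<le> e * (\<integral>x. h x \<partial>m)"
  shows "qnorm m F E (af_potential X P A \<alpha>) \<le> ennreal (3 * e)"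
proof -
  obtain B where B: "B \<in> null_sets m" "{x \<in> space m. \<not> Zpot \<alpha> (Some x) \<le> ennreal (2 * e)} \<subseteq> B"
    using Zpot_AE_le[OF assms] by (auto simp: eventually_ae_filter)
  obtain S where S: "cap m F E S = 0"
    "\<And>x. x \<notin> S \<Longrightarrow> AE t in expo 1. AE \<omega> in P (Some x). X (ennreal t) \<omega> \<notin> Some ` B"
    by (rule null_set_not_hit[OF B(1)]) (rule that; assumption)
  have le: "af_potential X P A \<alpha> x \<le> ennreal (2 * e)" if x: "x \<notin> N0 \<union> S" for x
  proof -
    have "af_potential X P A \<alpha> x = Zpot \<alpha> (Some x)"
      unfolding af_potential_def by (rule af_expectation_eq[OF _ a]) (use x in auto)
    also have "\<dots> \<le> ennreal (2 * e)"
    proof (rule Zpot_le[OF a])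
      show "B \<in> sets borel" using null_setsD2[OF B(1)] by simp
      show "Zpot \<alpha> (Some y) \<le> ennreal (2 * e)" if "y \<notin> B" for y using B(2) that by auto
      show "AE t in expo 1. AE \<omega> in P (Some x). X (ennreal t) \<omega> \<notin> Some ` B" by (rule S(2)) (use x in simp)
    qed (use x in simp)
    finally show ?thesis .
  qed
  have "{x. ennreal (3 * e) \<le> af_potential X P A \<alpha> x} \<subseteq> N0 \<union> S"
  proof (rule subsetI, rule ccontr)
    fix x assume "x \<in> {x. ennreal (3 * e) \<le> af_potential X P A \<alpha> x}" "x \<notin> N0 \<union> S"
    then have "ennreal (3 * e) \<le> ennreal (2 * e)" using le[of x] by (auto intro: order_trans)
    then show False using e by simp
  qed
  then have "cap m F E {x. ennreal (3 * e) \<le> af_potential X P A \<alpha> x} = 0"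
    by (rule cap_zero_mono[OF cap_zero_Un[OF cap_N0 S(1)]])
  then show ?thesis unfolding qnorm_def using e by (intro INF_lower) auto
qed

lemma qnorm_af_potential_tendsto_0: "((\<lambda>\<alpha>. qnorm m F E (af_potential X P A \<alpha>)) \<longlongrightarrow> 0) at_top"
proof (rule order_tendstoI)
  fix b :: ennreal assume "0 < b"
  then obtain c where c: "0 < c" "c < b" using dense by blast
  then have "c < top" by (meson less_le_trans top_greatest)
  then obtain r where r: "0 < ennreal r" "ennreal r < b" using c by (cases c) auto
  then have "r > 0" by simp
  then obtain \<alpha>0 where \<alpha>0: "\<alpha>0 \<ge> 1" "\<And>\<alpha> h. \<alpha> \<ge> \<alpha>0 \<Longrightarrow> test_fn h \<Longrightarrow> (\<integral>x. R \<alpha> h x \<partial>\<mu>) \<le> r / 3 * (\<integral>x. h x \<partial>m)"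
    using integral_R_\<mu>_small[of "r / 3"] by auto
  have "qnorm m F E (af_potential X P A \<alpha>) < b" if "\<alpha> \<ge> \<alpha>0" for \<alpha>
  proof -
    have "qnorm m F E (af_potential X P A \<alpha>) \<le> ennreal (3 * (r / 3))"
      using that \<alpha>0 \<open>r > 0\<close> by (intro qnorm_af_potential_le) auto
    then show ?thesis using r(2) by simp
  qed
  then show "\<forall>\<^sub>F \<alpha> in at_top. qnorm m F E (af_potential X P A \<alpha>) < b"
    by (auto simp: eventually_at_top_linorder)
qed simp

end

theorem proposition3p6:
  fixes m :: "'a::{metric_space, second_countable_topology} measure"
    and F :: "('a \<Rightarrow> real) set"
    and E :: "'a bilin"
    and X :: "('w, 'a) coords"
    and \<theta> :: "ennreal \<Rightarrow> 'w \<Rightarrow> 'w"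
    and P :: "'a option \<Rightarrow> 'w measure"
    and A :: "'a measure \<Rightarrow> ennreal \<Rightarrow> 'w \<Rightarrow> ennreal"
    and \<mu> :: "'a measure"
  assumes "locally compact (UNIV :: 'a set)"
    and "radon_measure m" and "full_support m"
    and "dirichlet_form m F E" and "regular_form m F E"
    and "hunt_process X \<theta> P" and "m_symmetric m X P" and "associated m F E X P"
    and "revuz_correspondence m F E X \<theta> P A"
    and "feller_semigroup (trans_op X P)"
    and "\<mu> \<in> S00 m F E"
    and "\<exists>u\<in>C_infty. is_U1 m F E \<mu> u"
  shows "\<mu> \<in> K00 m F E X P A"
proof -
  obtain u where u: "u \<in> C_infty" "is_U1 m F E \<mu> u" using assms(12) by blast
  have \<mu>: "sets \<mu> = sets borel" "emeasure \<mu> UNIV < \<infinity>"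
    using assms(11) unfolding S00_def S0_def radon_measure_def by blast+
  interpret continuous_potential m F E X \<theta> P \<mu> u
    by unfold_locales (fact assms \<mu> u)+
  have rc: "pcaf m F E X \<theta> P (A \<mu>)" "revuz m X P (A \<mu>) \<mu>"
    using assms(9) smooth unfolding revuz_correspondence_def by blast+
  from rc(1) have meas: "\<forall>t<\<infinity>. A \<mu> t \<in> borel_measurable (aug_filt X P t)"
    unfolding pcaf_def by (elim conjE)
  from rc(1) obtain \<Lambda> N0 where pc: "cap m F E N0 = 0"
    "\<forall>x. x \<notin> N0 \<longrightarrow> (AE \<omega> in P (Some x). \<omega> \<in> \<Lambda>)"
    "\<forall>t. 0 < t \<and> t < \<infinity> \<longrightarrow> \<theta> t ` \<Lambda> \<subseteq> \<Lambda>"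
    "\<forall>\<omega>\<in>\<Lambda>. continuous_on {..<\<infinity>} (\<lambda>t. A \<mu> t \<omega>) \<and> A \<mu> 0 \<omega> = 0 \<and>
           (\<forall>t. t < lifetime X \<omega> \<longrightarrow> A \<mu> t \<omega> < \<infinity>) \<and>
           (\<forall>t. lifetime X \<omega> \<le> t \<and> t < \<infinity> \<longrightarrow> A \<mu> t \<omega> = A \<mu> (lifetime X \<omega>) \<omega>) \<and>
           (\<forall>s t. s < \<infinity> \<and> t < \<infinity> \<longrightarrow> A \<mu> (s + t) \<omega> = A \<mu> s \<omega> + A \<mu> t (\<theta> s \<omega>))"
    unfolding pcaf_def by (elim conjE bexE exE)
  interpret potential_af m F E X \<theta> P \<mu> u "A \<mu>" \<Lambda> N0
  proof unfold_locales
    show "A \<mu> t \<in> borel_measurable (aug_filt X P t)" if "t < \<infinity>" for t using meas that by simp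
    show "AE \<omega> in P (Some x). \<omega> \<in> \<Lambda>" if "x \<notin> N0" for x using pc(2) that by simp
    show "\<theta> t \<omega> \<in> \<Lambda>" if "0 < t" "t < \<infinity>" "\<omega> \<in> \<Lambda>" for t \<omega> using pc(3) that by blast
    fix \<omega> assume \<omega>: "\<omega> \<in> \<Lambda>"
    note pc4 = bspec[OF pc(4) \<omega>]
    show "continuous_on {..<\<infinity>} (\<lambda>t. A \<mu> t \<omega>)" using pc4 by (elim conjE)
    show "A \<mu> 0 \<omega> = 0" using pc4 by (elim conjE)
    show "A \<mu> t \<omega> < \<infinity>" if "t < lifetime X \<omega>" for t using pc4 that by (elim conjE) simp
    show "A \<mu> t \<omega> = A \<mu> (lifetime X \<omega>) \<omega>" if "lifetime X \<omega> \<le> t" "t < \<infinity>" for t using pc4 that by blast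
    show "A \<mu> (s + t) \<omega> = A \<mu> s \<omega> + A \<mu> t (\<theta> s \<omega>)" if "s < \<infinity>" "t < \<infinity>" for s t using pc4 that by blast
  qed (fact pc(1) rc(2))+
  have "\<mu> \<in> kato_class m F E X P A"
    unfolding kato_class_def using smooth qnorm_af_potential_tendsto_0 by simp
  then show ?thesis using assms(11) by (simp add: K00_def)
qed

end
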